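(* Let $\mathcal D\subset\mathbb R^d$ be a bounded domain satisfying the standing assumptions in the context, and let $\mathcal D'\subset\mathcal D$ be a domain whose boundary satisfies the Lipschitz condition and is almost everywhere continuously differentiable. Let $(\Xi_1,\Xi_2)$ be the random chord of $\mathcal D$ and let $(\Xi_{1,k}',\Xi_{2,k}')$, $k\le\iota$, be the chords obtained by intersecting $\mathcal D'$ with the chord $(\Xi_1,\Xi_2)$, where $\iota\in\{0,1,\dots,\infty\}$ is their number. For every Borel subset $C$ of $\partial\mathcal D'\times\partial\mathcal D'$, we have $$\mathbf E\Big[\sum_{k=1}^{\iota}\mathbf 1\{(\Xi_{1,k}',\Xi_{2,k}')\in C\}\Big]=\frac{|\partial\mathcal D'|}{|\partial\mathcal D|}\times|\partial\mathcal D'|^{-1}\int_C\tilde K_{\mathcal D'}(x,y)\,dx\,dy .$$ In particular, $$\mathbf E[\iota]=\frac{|\partial\mathcal D'|}{|\partial\mathcal D|}.$$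
   Context: Notation: $d\ge 2$; $\|\cdot\|$ is the Euclidean norm, $\mathcal B(x,\varepsilon)$ the open ball, $\mathbb S^{d-1}$ the unit sphere, $e=(1,0,\dots,0)$, $\mathbb S_e=\{w\in\mathbb S^{d-1}:e\cdot w>0\}$; $|A|$ is the $(d-1)$-dimensional Hausdorff measure for subsets of boundaries, and $dx,dy$ on boundaries denote this measure. Standing assumptions on a domain $\mathcal D$: $\mathcal D\subset\mathbb R^d$ is open and connected, and (Lipschitz condition) for every $x\in\partial\mathcal D$ there exist $\varepsilon_x>0$, an affine isometry $\mathfrak I_x:\mathbb R^d\to\mathbb R^d$ with $\mathfrak I_x x=0$ and a Lipschitz function $f_x:\mathbb R^{d-1}\to\mathbb R$ with $f_x(0)=0$ such that $\mathfrak I_x(\mathcal D\cap\mathcal B(x,\varepsilon_x))=\{z\in\mathcal B(0,\varepsilon_x):z^{(d)}>f_x(z^{(1)},\dots,z^{(d-1)})\}$. Moreover (almost everywhere continuously differentiable boundary) there is a relatively open set $\mathcal R_{\mathcal D}\subset\partial\mathcal D$, with $|\partial\mathcal D\setminus\mathcal R_{\mathcal D}|=0$, such that $\partial\mathcal D$ has a local $C^1$ parametrization at each point of $\mathcal R_{\mathcal D}$. For $x\in\mathcal R_{\mathcal D}$, $\mathbf n(x)$ is the unit normal vector pointing into $\mathcal D$. Random chord of a bounded, open, connected domain $\mathcal D\subset\mathbb R^d$ whose boundary satisfies the Lipschitz condition and has a local $C^1$ parametrization at each point of a relatively open set $\mathcal R_{\mathcal D}\subset\partial\mathcal D$ with $|\partial\mathcal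 D\setminus\mathcal R_{\mathcal D}|=0$: the pair of random variables $(\Xi_1,\Xi_2)$ in $\partial\mathcal D$ with joint density $|\partial\mathcal D|^{-1}\tilde K_{\mathcal D}(x,y)$ with respect to the product of Hausdorff measures, where $$\tilde K_{\mathcal D}(x,y)=\frac{\gamma_d\big((y-x)\cdot\mathbf n(x)\big)\big((x-y)\cdot\mathbf n(y)\big)}{\|x-y\|^{d+1}}\,\mathbf 1\{x,y\in\mathcal R_{\mathcal D},\ x\leftrightarrow y\},\qquad \gamma_d=\Big(\int_{\mathbb S_e}u\cdot e\,du\Big)^{-1},$$ ($du$ surface measure) and $x\leftrightarrow y$ means that $x\ne y$ and the open segment $(x,y)$ lies in $\mathcal D$. $\tilde K_{\mathcal D'}$ is the same expression with $\mathcal D$ replaced by $\mathcal D'$ (normals and visibility relative to $\mathcal D'$). Induced chords: $(\Xi_{1,k}',\Xi_{2,k}')$, $k\le\iota$, are the pairs of endpoints of the connected components of $(\Xi_1,\Xi_2)\cap\mathcal D'$ (the open segment intersected with $\mathcal D'$), each pair ordered in the direction from $\Xi_1$ to $\Xi_2$. *)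

theory Defs
  imports "HOL-Probability.Probability"
begin

section \<open>Hausdorff measure\<close>

text \<open>The factor \<open>unit_ball_vol k / 2 ^ k\<close> makes the \<open>k\<close>-dimensional Hausdorff measure agree with
  the usual surface measure. The empty set is singled out only because of \<open>0 ^ 0 = 1\<close>.\<close>

definition hausdorff_premeasure :: "nat \<Rightarrow> real \<Rightarrow> 'a::euclidean_space set \<Rightarrow> ennreal" where
  "hausdorff_premeasure k \<delta> A =
    (INF U \<in> {U :: nat \<Rightarrow> 'a set. (\<forall>i. bounded (U i) \<and> diameter (U i) \<le> \<delta>) \<and> A \<subseteq> (\<Union>i. U i)}.
      \<Sum>i. if U i = {} then 0 else ennreal (unit_ball_vol (real k) * (diameter (U i) / 2) ^ k))"

definition hausdorff_outer :: "nat \<Rightarrow> 'a::euclidean_space set \<Rightarrow> ennreal" where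
  "hausdorff_outer k A = (SUP \<delta> \<in> {0<..}. hausdorff_premeasure k \<delta> A)"

text \<open>As \<open>hausdorff_outer k\<close> is a metric outer measure, it is countably additive on the Borel sets,
  so it is the value of the measure below on every Borel set.\<close>

definition hausdorff_measure :: "nat \<Rightarrow> 'a::euclidean_space measure" where
  "hausdorff_measure k = measure_of UNIV (sets borel) (hausdorff_outer k)"

definition area :: "(real^'n) set \<Rightarrow> ennreal" where
  "area A = emeasure (hausdorff_measure (CARD('n) - 1)) A"

text \<open>The boundary as a measure space of its own. (The Hausdorff measure on the whole space is not
  sigma-finite, so its product measure would not be well behaved.)\<close>

definition boundary_measure :: "(real^'n) set \<Rightarrow> (real^'n) measure" where
  "boundary_measure D = restrict_space (hausdorff_measure (CARD('n) - 1)) (frontier D)"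


section \<open>Domains\<close>

text \<open>The index type is linearly ordered, so that there are a first and a last coordinate.
  The space of the first \<open>d - 1\<close> coordinates is identified with the hyperplane on which the last
  coordinate vanishes.\<close>

definition last_index :: "'n::{finite,wellorder}" where
  "last_index = Max UNIV"

definition base_hyperplane :: "(real^'n::{finite,wellorder}) set" where
  "base_hyperplane = {z. z $ last_index = 0}"

definition base_proj :: "real^'n::{finite,wellorder} \<Rightarrow> real^'n::_" where
  "base_proj z = (\<chi> i. if i = last_index then 0 else z $ i)"

definition affine_isometry :: "('a::euclidean_space \<Rightarrow> 'a) \<Rightarrow> bool" where
  "affine_isometry I \<longleftrightarrow> (\<exists>T b. orthogonal_transformation T \<and> I = (\<lambda>z. T z + b))"

definition lipschitz_boundary :: "(real^'n::{finite,wellorder}) set \<Rightarrow> bool" where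
  "lipschitz_boundary D \<longleftrightarrow>
    (\<forall>x\<in>frontier D. \<exists>\<epsilon>>0. \<exists>I f L.
      affine_isometry I \<and> I x = 0 \<and> L-lipschitz_on base_hyperplane f \<and> f 0 = (0::real) \<and>
      I ` (D \<inter> ball x \<epsilon>) = {z \<in> ball 0 \<epsilon>. z $ last_index > f (base_proj z)})"

text \<open>A regular \<open>C\<^sup>1\<close> parametrization \<open>\<phi>\<close>, defined on an open subset \<open>U\<close> of the base hyperplane,
  of a relatively open piece of \<open>S\<close>. Only the values of the derivative \<open>\<phi>'\<close> on the base hyperplane
  matter.\<close>

definition C1_parametrization ::
  "(real^'n::{finite,wellorder}) set \<Rightarrow> (real^'n::_) set \<Rightarrow> (real^'n::_ \<Rightarrow> real^'n::_) \<Rightarrow>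
    (real^'n::_ \<Rightarrow> (real^'n::_) \<Rightarrow>\<^sub>L (real^'n::_)) \<Rightarrow> bool" where
  "C1_parametrization S U \<phi> \<phi>' \<longleftrightarrow>
    openin (top_of_set base_hyperplane) U \<and>
    openin (top_of_set S) (\<phi> ` U) \<and>
    (\<exists>\<psi>. homeomorphism U (\<phi> ` U) \<phi> \<psi>) \<and>
    continuous_on U \<phi>' \<and>
    (\<forall>u\<in>U. (\<phi> has_derivative blinfun_apply (\<phi>' u)) (at u within base_hyperplane) \<and>
           inj_on (blinfun_apply (\<phi>' u)) base_hyperplane)"

definition ae_C1_boundary :: "(real^'n::{finite,wellorder}) set \<Rightarrow> (real^'n::_) set \<Rightarrow> bool" where
  "ae_C1_boundary D R \<longleftrightarrow>
    openin (top_of_set (frontier D)) R \<and>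
    area (frontier D - R) = 0 \<and>
    (\<forall>x\<in>R. \<exists>U \<phi> \<phi>'. C1_parametrization (frontier D) U \<phi> \<phi>' \<and> x \<in> \<phi> ` U)"

definition admissible_domain :: "(real^'n::{finite,wellorder}) set \<Rightarrow> (real^'n::_) set \<Rightarrow> bool" where
  "admissible_domain D R \<longleftrightarrow>
    open D \<and> connected D \<and> lipschitz_boundary D \<and> ae_C1_boundary D R"

definition inner_normal :: "(real^'n::{finite,wellorder}) set \<Rightarrow> real^'n::_ \<Rightarrow> real^'n::_" where
  "inner_normal D x = (THE v. norm v = 1 \<and>
    (\<exists>U \<phi> \<phi>'. C1_parametrization (frontier D) U \<phi> \<phi>' \<and>
      (\<exists>u\<in>U. \<phi> u = x \<and> (\<forall>h\<in>base_hyperplane. v \<bullet> blinfun_apply (\<phi>' u) h = 0))) \<and>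
    (\<exists>\<delta>>0. \<forall>t. 0 < t \<and> t < \<delta> \<longrightarrow> x + t *\<^sub>R v \<in> D))"


section \<open>The random chord and the induced chords\<close>

definition first_axis :: "real^'n::{finite,wellorder}" where
  "first_axis = axis (Min UNIV) 1"

definition half_sphere :: "(real^'n::{finite,wellorder}) set" where
  "half_sphere = {w \<in> sphere 0 1. first_axis \<bullet> w > 0}"

definition gamma_const :: "'n::{finite,wellorder} itself \<Rightarrow> real" where
  "gamma_const _ =
    inverse (LINT u:half_sphere|hausdorff_measure (CARD('n) - 1). u \<bullet> (first_axis :: real^'n::_))"

definition visible :: "'a::euclidean_space set \<Rightarrow> 'a \<Rightarrow> 'a \<Rightarrow> bool" where
  "visible D x y \<longleftrightarrow> x \<noteq> y \<and> open_segment x y \<subseteq> D"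

definition chord_kernel ::
  "(real^'n::{finite,wellorder}) set \<Rightarrow> (real^'n::_) set \<Rightarrow> real^'n::_ \<Rightarrow> real^'n::_ \<Rightarrow> real" where
  "chord_kernel D R x y =
    gamma_const TYPE('n) * ((y - x) \<bullet> inner_normal D x) * ((x - y) \<bullet> inner_normal D y)
      / norm (x - y) ^ (CARD('n) + 1)
      * of_bool (x \<in> R \<and> y \<in> R \<and> visible D x y)"

definition random_chord ::
  "'w measure \<Rightarrow> (real^'n::{finite,wellorder}) set \<Rightarrow> (real^'n::_) set \<Rightarrow>
    ('w \<Rightarrow> real^'n::_) \<Rightarrow> ('w \<Rightarrow> real^'n::_) \<Rightarrow> bool" where
  "random_chord M D R X Y \<longleftrightarrow>
    prob_space M \<and>
    distributed M (boundary_measure D \<Otimes>\<^sub>M boundary_measure D) (\<lambda>\<omega>. (X \<omega>, Y \<omega>))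
      (\<lambda>(x, y). inverse (area (frontier D)) * ennreal (chord_kernel D R x y))"

text \<open>The endpoint pairs of the components of the chord from \<open>x\<close> to \<open>y\<close> intersected with \<open>D'\<close>,
  ordered in the direction from \<open>x\<close> to \<open>y\<close>.\<close>

definition induced_chords :: "'a::euclidean_space set \<Rightarrow> 'a \<Rightarrow> 'a \<Rightarrow> ('a \<times> 'a) set" where
  "induced_chords D' x y =
    {(a, b). open_segment a b \<in> components (open_segment x y \<inter> D') \<and>
             (\<exists>c>0. b - a = c *\<^sub>R (y - x))}"

definition num_induced_chords :: "'a::euclidean_space set \<Rightarrow> 'a \<Rightarrow> 'a \<Rightarrow> ennreal" where
  "num_induced_chords D' x y = emeasure (count_space UNIV) (induced_chords D' x y)"

end

theory Submission imports Defs begin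

text \<open>Both sides are integrals over oriented lines. The radial projection from \<open>x\<close> turns
  \<open>K(x,y) dy\<close> into \<open>(w \<bullet> n(x))\<^sub>+ dw\<close> on the unit ball, up to a constant, and for a fixed direction \<open>w\<close>
  sweeping the boundary along \<open>w\<close> turns \<open>(w \<bullet> n(x))\<^sub>+ dx\<close> into Lebesgue measure on the domain, in which
  every point is weighted with the reciprocal length of its chord. In this form the two domains are
  compared by transporting mass along the lines with direction \<open>w\<close>, which only needs the translation
  invariance of Lebesgue measure.

  Neither the value of \<open>\<gamma>\<close> nor the normalisation of the Hausdorff measure enters: the total mass of
  the kernel is the same multiple of the boundary area for every domain, and this multiple is one
  because the density of the random chord integrates to one.\<close>

subsection \<open>Hausdorff measure\<close>

text \<open>Whenever the boundary measure is evaluated, boundary points are paired with a real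
  parameter so that a region of full dimension is swept out; the volume element contains the cosine
  between the motion and the normal. Both cosines in the kernel arise in this way, one from the cone
  over the end points, the other from the parallel motion of the starting points. Volume sees the
  normal only up to sign. The sign is tied to the domain because rays on the positive side of a
  regular boundary point enter it and rays on the negative side do not; this rests on the Lipschitz
  condition, as does the finite boundary area behind the Fubini arguments. The exceptional boundary
  points have area zero, but what must be small is the volume of the lines through them, in a fixed
  direction or from a fixed point; a covering argument gives this. Directions range over the unit
  ball and not the sphere because the weight is homogeneous: for an end point at distance r, the
  integral of t^d over 0 < t < 1/r is 1/((d+1) r^(d+1)), which yields the power of the distance in
  the kernel.\<close>

definition diam_weight :: "nat \<Rightarrow> 'a::euclidean_space set \<Rightarrow> ennreal" where
  "diam_weight k U = (if U = {} then 0 else ennreal (unit_ball_vol (real k) * (diameter U / 2) ^ k))"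

lemma diam_weight_empty [simp]: "diam_weight k {} = 0"
  by (simp add: diam_weight_def)

lemma premeasure_eq:
  "hausdorff_premeasure k \<delta> A =
    (INF U \<in> {U :: nat \<Rightarrow> 'a::euclidean_space set. (\<forall>i. bounded (U i) \<and> diameter (U i) \<le> \<delta>) \<and> A \<subseteq> (\<Union>i. U i)}.
      \<Sum>i. diam_weight k (U i))"
  unfolding hausdorff_premeasure_def diam_weight_def by simp

lemma premeasure_le:
  assumes "\<And>i. bounded (U i)" "\<And>i. diameter (U i) \<le> \<delta>" "A \<subseteq> (\<Union>i. U i)"
  shows "hausdorff_premeasure k \<delta> A \<le> (\<Sum>i. diam_weight k (U i))"
  unfolding premeasure_eq using assms by (intro INF_lower) auto

lemma premeasure_ge:
  assumes "\<And>U :: nat \<Rightarrow> 'a::euclidean_space set. (\<And>i. bounded (U i)) \<Longrightarrow> (\<And>i. diameter (U i) \<le> \<delta>) \<Longrightarrow>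
    A \<subseteq> (\<Union>i. U i) \<Longrightarrow> c \<le> (\<Sum>i. diam_weight k (U i))"
  shows "c \<le> hausdorff_premeasure k \<delta> A"
  unfolding premeasure_eq using assms by (intro INF_greatest) auto

lemma premeasure_coverE:
  assumes "hausdorff_premeasure k \<delta> A < c"
  obtains U :: "nat \<Rightarrow> 'a::euclidean_space set" where "\<And>i. bounded (U i)" "\<And>i. diameter (U i) \<le> \<delta>"
    "A \<subseteq> (\<Union>i. U i)" "(\<Sum>i. diam_weight k (U i)) < c"
  using assms unfolding premeasure_eq INF_less_iff by auto

lemma premeasure_mono: "A \<subseteq> B \<Longrightarrow> hausdorff_premeasure k \<delta> A \<le> hausdorff_premeasure k \<delta> B"
  unfolding premeasure_eq by (rule INF_superset_mono) auto

lemma premeasure_antimono: "\<delta> \<le> \<epsilon> \<Longrightarrow> hausdorff_premeasure k \<epsilon> A \<le> hausdorff_premeasure k \<delta> A"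
  unfolding premeasure_eq by (rule INF_superset_mono) (auto intro: order_trans)

lemma premeasure_le_outer: "\<delta> > 0 \<Longrightarrow> hausdorff_premeasure k \<delta> A \<le> hausdorff_outer k A"
  unfolding hausdorff_outer_def by (rule SUP_upper) auto

lemma outer_leI: "(\<And>\<delta>. \<delta> > 0 \<Longrightarrow> hausdorff_premeasure k \<delta> A \<le> c) \<Longrightarrow> hausdorff_outer k A \<le> c"
  unfolding hausdorff_outer_def by (rule SUP_least) auto

lemma outer_mono: "A \<subseteq> B \<Longrightarrow> hausdorff_outer k A \<le> hausdorff_outer k B"
  unfolding hausdorff_outer_def by (intro SUP_mono) (auto intro: premeasure_mono)

lemma outer_empty [simp]: "hausdorff_outer k {} = 0"
proof -
  have "hausdorff_outer k {} \<le> (0::ennreal)"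
  proof (rule outer_leI)
    fix \<delta> :: real assume "\<delta> > 0"
    then show "hausdorff_premeasure k \<delta> {} \<le> 0"
      using premeasure_le[of "\<lambda>_. {}" \<delta> "{}" k] by (simp add: diameter_def)
  qed
  then show ?thesis by simp
qed

lemma premeasure_UN_le:
  "hausdorff_premeasure k \<delta> (\<Union>n. A n) \<le> (\<Sum>n. hausdorff_premeasure k \<delta> (A n :: 'a::euclidean_space set))"
proof (rule ennreal_le_epsilon)
  fix e :: real
  assume e: "0 < e" and fin: "(\<Sum>n. hausdorff_premeasure k \<delta> (A n)) < top"
  then have *: "hausdorff_premeasure k \<delta> (A n) < hausdorff_premeasure k \<delta> (A n) + e * (1/2)^Suc n" for n
    by (auto simp add: less_top dest!: ennreal_suminf_lessD)
  have "\<exists>U :: nat \<Rightarrow> 'a set. (\<forall>i. bounded (U i)) \<and> (\<forall>i. diameter (U i) \<le> \<delta>) \<and> A n \<subseteq> (\<Union>i. U i) \<and>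
      (\<Sum>i. diam_weight k (U i)) \<le> hausdorff_premeasure k \<delta> (A n) + e * (1/2)^Suc n" for n
    using premeasure_coverE[OF *[of n]] by (metis less_imp_le)
  then obtain U :: "nat \<Rightarrow> nat \<Rightarrow> 'a set" where U: "\<And>n i. bounded (U n i)" "\<And>n i. diameter (U n i) \<le> \<delta>"
    "\<And>n. A n \<subseteq> (\<Union>i. U n i)"
    "\<And>n. (\<Sum>i. diam_weight k (U n i)) \<le> hausdorff_premeasure k \<delta> (A n) + e * (1/2)^Suc n"
    by metis
  define V where "V = (\<lambda>m. case prod_decode m of (n, i) \<Rightarrow> U n i)"
  have "(\<Union>n. A n) \<subseteq> (\<Union>m. V m)"
  proof safe
    fix x n assume "x \<in> A n"
    then obtain i where "x \<in> U n i" using U(3) by blast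
    then show "x \<in> (\<Union>m. V m)"
      by (intro UN_I[of "prod_encode (n, i)"]) (auto simp: V_def)
  qed
  then have "hausdorff_premeasure k \<delta> (\<Union>n. A n) \<le> (\<Sum>m. diam_weight k (V m))"
    by (intro premeasure_le) (auto simp: V_def U split: prod.split)
  also have "\<dots> = (\<Sum>n. \<Sum>i. diam_weight k (U n i))"
    by (subst suminf_ennreal_2dimen[where f = "\<lambda>p. diam_weight k (U (fst p) (snd p))", symmetric])
      (auto simp: V_def split_beta comp_def)
  also have "\<dots> \<le> (\<Sum>n. hausdorff_premeasure k \<delta> (A n) + e * (1/2)^Suc n)"
    by (intro suminf_le U) auto
  also have "\<dots> = (\<Sum>n. hausdorff_premeasure k \<delta> (A n)) + (\<Sum>n. ennreal e * ennreal ((1/2) ^ Suc n))"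
    using \<open>0 < e\<close> by (subst suminf_add[symmetric])
      (auto simp del: ennreal_suminf_cmult simp add: ennreal_mult[symmetric])
  also have "(\<Sum>n. ennreal e * ennreal ((1/2) ^ Suc n)) = e"
    unfolding ennreal_suminf_cmult
    by (subst suminf_ennreal_eq[OF zero_le_power power_half_series]) auto
  finally show "hausdorff_premeasure k \<delta> (\<Union>n. A n) \<le> (\<Sum>n. hausdorff_premeasure k \<delta> (A n)) + e" .
qed

lemma outer_UN_le: "hausdorff_outer k (\<Union>n::nat. A n) \<le> (\<Sum>n. hausdorff_outer k (A n :: 'a::euclidean_space set))"
proof (rule outer_leI)
  fix \<delta> :: real assume "\<delta> > 0"
  have "hausdorff_premeasure k \<delta> (\<Union>n. A n) \<le> (\<Sum>n. hausdorff_premeasure k \<delta> (A n))"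
    by (rule premeasure_UN_le)
  also have "\<dots> \<le> (\<Sum>n. hausdorff_outer k (A n))"
    using \<open>\<delta> > 0\<close> by (intro suminf_le premeasure_le_outer) auto
  finally show "hausdorff_premeasure k \<delta> (\<Union>n. A n) \<le> (\<Sum>n. hausdorff_outer k (A n))" .
qed

lemma outer_Un_le: "hausdorff_outer k (A \<union> B) \<le> hausdorff_outer k A + hausdorff_outer k (B :: 'a::euclidean_space set)"
proof -
  have "hausdorff_outer k (A \<union> B) = hausdorff_outer k (\<Union>n::nat. if n = 0 then A else if n = 1 then B else {})"
    by (rule arg_cong[where f = "hausdorff_outer k"]) (auto split: if_splits)
  also have "\<dots> \<le> (\<Sum>n::nat. hausdorff_outer k (if n = 0 then A else if n = 1 then B else {}))"
    by (rule outer_UN_le)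
  also have "\<dots> = (\<Sum>n<2::nat. hausdorff_outer k (if n = 0 then A else if n = 1 then B else {}))"
    by (rule suminf_finite) auto
  also have "\<dots> = hausdorff_outer k A + hausdorff_outer k B"
    by (simp add: numeral_2_eq_2)
  finally show ?thesis .
qed

text \<open>A covering set of diameter less than \<open>r\<close> cannot meet both sets, so every
  fine cover of the union splits into a cover of \<open>A\<close> and a cover of \<open>B\<close>
  without shared members.\<close>

lemma outer_separated:
  fixes A B :: "'a::euclidean_space set"
  assumes r: "r > 0" and sep: "\<And>x y. x \<in> A \<Longrightarrow> y \<in> B \<Longrightarrow> dist x y \<ge> r"
  shows "hausdorff_outer k A + hausdorff_outer k B \<le> hausdorff_outer k (A \<union> B)"
proof -
  have small: "hausdorff_premeasure k \<delta> A + hausdorff_premeasure k \<delta> B \<le> hausdorff_premeasure k \<delta> (A \<union> B)"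
    if \<delta>: "0 < \<delta>" "\<delta> < r" for \<delta>
  proof (rule premeasure_ge)
    fix U :: "nat \<Rightarrow> 'a set"
    assume U: "\<And>i. bounded (U i)" "\<And>i. diameter (U i) \<le> \<delta>" "A \<union> B \<subseteq> (\<Union>i. U i)"
    define V W where "V i = (if U i \<inter> A = {} then {} else U i)" and "W i = (if U i \<inter> B = {} then {} else U i)" for i
    have le: "diam_weight k (V i) + diam_weight k (W i) \<le> diam_weight k (U i)" for i
    proof -
      have "U i \<inter> A = {} \<or> U i \<inter> B = {}"
      proof (rule ccontr)
        assume "\<not> ?thesis"
        then obtain x y where "x \<in> U i" "x \<in> A" "y \<in> U i" "y \<in> B" by auto
        then show False
          using sep[of x y] diameter_bounded_bound[OF U(1)[of i], of x y] U(2)[of i] \<delta> by linarith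
      qed
      then show ?thesis by (auto simp: V_def W_def)
    qed
    have "hausdorff_premeasure k \<delta> A \<le> (\<Sum>i. diam_weight k (V i))"
      proof (rule premeasure_le)
      show "A \<subseteq> (\<Union>i. V i)"
      proof
        fix x assume "x \<in> A"
        then obtain i where "x \<in> U i" using U(3) by blast
        with \<open>x \<in> A\<close> have "x \<in> V i" by (auto simp: V_def)
        then show "x \<in> (\<Union>i. V i)" by blast
      qed
    qed (use U \<delta> in \<open>auto simp: V_def\<close>)
    moreover have "hausdorff_premeasure k \<delta> B \<le> (\<Sum>i. diam_weight k (W i))"
      proof (rule premeasure_le)
      show "B \<subseteq> (\<Union>i. W i)"
      proof
        fix x assume "x \<in> B"
        then obtain i where "x \<in> U i" using U(3) by blast
        with \<open>x \<in> B\<close> have "x \<in> W i" by (auto simp: W_def)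
        then show "x \<in> (\<Union>i. W i)" by blast
      qed
    qed (use U \<delta> in \<open>auto simp: W_def\<close>)
    ultimately have "hausdorff_premeasure k \<delta> A + hausdorff_premeasure k \<delta> B \<le>
        (\<Sum>i. diam_weight k (V i)) + (\<Sum>i. diam_weight k (W i))"
      by (rule add_mono)
    also have "\<dots> = (\<Sum>i. diam_weight k (V i) + diam_weight k (W i))"
      by (rule suminf_add) auto
    also have "\<dots> \<le> (\<Sum>i. diam_weight k (U i))"
      by (intro suminf_le le) auto
    finally show "hausdorff_premeasure k \<delta> A + hausdorff_premeasure k \<delta> B \<le> (\<Sum>i. diam_weight k (U i))" .
  qed
  have "hausdorff_premeasure k \<delta> A + hausdorff_premeasure k \<epsilon> B \<le> hausdorff_outer k (A \<union> B)"
    if "0 < \<delta>" "0 < \<epsilon>" for \<delta> \<epsilon>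
  proof -
    \<comment> \<open>The two suprema have independent mesh sizes; at a common finer mesh below
      \<open>r\<close> both premeasures are at least as large.\<close>
    define \<eta> where "\<eta> = min (min \<delta> \<epsilon>) (r / 2)"
    have \<eta>: "0 < \<eta>" "\<eta> < r" "\<eta> \<le> \<delta>" "\<eta> \<le> \<epsilon>" using that r by (auto simp: \<eta>_def)
    have "hausdorff_premeasure k \<delta> A + hausdorff_premeasure k \<epsilon> B \<le> hausdorff_premeasure k \<eta> A + hausdorff_premeasure k \<eta> B"
      using \<eta> by (intro add_mono premeasure_antimono) auto
    also have "\<dots> \<le> hausdorff_outer k (A \<union> B)"
      using small[OF \<eta>(1,2)] premeasure_le_outer[OF \<eta>(1)] by (rule order_trans)
    finally show ?thesis .
  qed
  then show ?thesis
    unfolding hausdorff_outer_def[of k A] hausdorff_outer_def[of k B]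
    by (subst ennreal_SUP_add_left[symmetric], simp, intro SUP_least,
      subst ennreal_SUP_add_right, simp, intro SUP_least) auto
qed

lemma diameter_leI:
  fixes S :: "'a::metric_space set"
  assumes "0 \<le> d" "\<And>x y. x \<in> S \<Longrightarrow> y \<in> S \<Longrightarrow> dist x y \<le> d"
  shows "diameter S \<le> d"
  using assms by (auto simp: diameter_def intro!: cSUP_least)

section \<open>Borel sets are measurable for the outer measure\<close>

lemma outer_measure_space_hausdorff:
  "outer_measure_space (Pow UNIV) (hausdorff_outer k :: 'a::euclidean_space set \<Rightarrow> ennreal)"
  unfolding outer_measure_space_def positive_def increasing_def countably_subadditive_def
  using outer_UN_le outer_mono by auto

text \<open>Caratheodory's criterion: the shells \<open>1/(n+2) \<le> dist x F < 1/(n+1)\<close> of even index are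
  separated from each other, and so are those of odd index; hence their outer measures are summable.\<close>

lemma outer_closed_split:
  fixes F T :: "'a::euclidean_space set"
  assumes F: "closed F" "F \<noteq> {}"
  shows "hausdorff_outer k (T \<inter> F) + hausdorff_outer k (T - F) \<le> hausdorff_outer k T"
proof (cases "hausdorff_outer k T = top")
  case False
  let ?H = "hausdorff_outer k :: 'a set \<Rightarrow> ennreal"
  define A where "A n = {x \<in> T. infdist x F \<ge> 1 / real (Suc n)}" for n
  define B where "B n = A (Suc n) - A n" for n
  have dist_F: "dist x y \<ge> \<bar>infdist x F - infdist y F\<bar>" for x y
    by (rule infdist_triangle_abs)
  have Bsub: "B n \<subseteq> T" for n by (auto simp: B_def A_def)
  have parity: "(\<Sum>n<N. ?H (B (2 * n + p))) \<le> ?H (\<Union>n<N. B (2 * n + p))" for N p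
  proof (induction N)
    case (Suc N)
    \<comment> \<open>The distance used for the separation is the next smaller gap in the sequence.
      It stays positive for \<open>N = 0\<close> and \<open>p = 0\<close>, where
      \<open>1 / real (2 * N + p)\<close> is a division by zero.\<close>
    have pos: "1 / real (Suc (2 * N + p)) - 1 / real (Suc (2 * N + p + 1)) > 0"
      by (intro diff_gt_0_iff_gt[THEN iffD2] divide_strict_left_mono) auto
    have "?H (\<Union>n<N. B (2 * n + p)) + ?H (B (2 * N + p)) \<le> ?H ((\<Union>n<N. B (2 * n + p)) \<union> B (2 * N + p))"
    proof (rule outer_separated)
      show "1 / real (Suc (2 * N + p)) - 1 / real (Suc (2 * N + p + 1)) > 0" using pos .
      fix x y assume "x \<in> (\<Union>n<N. B (2 * n + p))" "y \<in> B (2 * N + p)"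
      then obtain n where n: "n < N" "x \<in> B (2 * n + p)" by auto
      have x: "infdist x F \<ge> 1 / real (Suc (Suc (2 * n + p)))" using n by (auto simp: B_def A_def)
      have y: "infdist y F < 1 / real (Suc (2 * N + p))" using \<open>y \<in> _\<close> by (auto simp: B_def A_def)
      have "1 / real (Suc (Suc (2 * n + p))) \<ge> 1 / real (2 * N + p)"
        using n by (intro divide_left_mono) auto
      moreover have "1 / m - 1 / (m + 1) \<ge> 1 / (m + 1) - 1 / (m + 2)" if "m > 0" for m :: real
        using that by (auto simp: field_simps intro!: divide_left_mono mult_pos_pos add_pos_pos)
      from this[of "real (2 * N + p)"]
      have "1 / real (2 * N + p) - 1 / real (Suc (2 * N + p)) \<ge>
          1 / real (Suc (2 * N + p)) - 1 / real (Suc (2 * N + p + 1))"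
        using n by (simp add: add_ac)
      ultimately show "1 / real (Suc (2 * N + p)) - 1 / real (Suc (2 * N + p + 1)) \<le> dist x y"
        using x y dist_F[of x y] by linarith
    qed
    also have "(\<Union>n<N. B (2 * n + p)) \<union> B (2 * N + p) = (\<Union>n<Suc N. B (2 * n + p))"
      by (auto simp: lessThan_Suc)
    finally show ?case using Suc by (auto intro: order_trans add_right_mono)
  qed simp
  have parity': "(\<Sum>n. ?H (B (2 * n + p))) < top" for p
  proof -
    have "(\<Sum>n. ?H (B (2 * n + p))) \<le> ?H T"
    proof (rule suminf_le_const)
      fix N
      have "?H (\<Union>n<N. B (2 * n + p)) \<le> ?H T"
        by (rule outer_mono) (use Bsub in auto)
      then show "(\<Sum>n<N. ?H (B (2 * n + p))) \<le> ?H T" using parity[of p N] by (rule order_trans[rotated])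
    qed auto
    then show ?thesis using False by (metis less_top order_le_less_trans)
  qed
  have TF: "T - F = A m \<union> (\<Union>n. B (n + m))" for m
  proof (intro equalityI subsetI)
    fix x assume x: "x \<in> T - F"
    then have "infdist x F > 0"
      using F by (metis DiffD2 in_closed_iff_infdist_zero infdist_nonneg less_eq_real_def)
    then obtain n where "1 / real (Suc n) < infdist x F"
      using reals_Archimedean[of "infdist x F"] by (auto simp: inverse_eq_divide)
    then have ex: "\<exists>n. x \<in> A n" using x by (auto simp: A_def intro!: exI[of _ n])
    define n where "n = (LEAST n. x \<in> A n)"
    have n: "x \<in> A n" "\<And>j. j < n \<Longrightarrow> x \<notin> A j"
      using LeastI_ex[OF ex] not_less_Least by (auto simp: n_def)
    show "x \<in> A m \<union> (\<Union>n. B (n + m))"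
    proof (cases "x \<in> A m")
      case False
      have "n > m"
      proof (rule ccontr)
        assume "\<not> n > m"
        then have "1 / real (Suc m) \<le> 1 / real (Suc n)" by (intro divide_left_mono) auto
        then show False using n(1) False by (auto simp: A_def)
      qed
      then have "x \<in> B (n - 1)" using n by (auto simp: B_def)
      with \<open>n > m\<close> show ?thesis by (auto intro!: exI[of _ "n - 1 - m"])
    qed auto
  next
    fix x assume "x \<in> A m \<union> (\<Union>n. B (n + m))"
    then obtain n where "x \<in> A n" by (auto simp: B_def)
    then have "x \<in> T" "1 / real (Suc n) \<le> infdist x F" by (auto simp: A_def)
    moreover have "0 < 1 / real (Suc n)" by simp
    ultimately have "x \<in> T" "infdist x F > 0" by linarith+
    then show "x \<in> T - F" by auto
  qed
  have sepA: "?H (T \<inter> F) + ?H (A m) \<le> ?H T" for m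
  proof -
    have "?H (T \<inter> F) + ?H (A m) \<le> ?H (T \<inter> F \<union> A m)"
    proof (rule outer_separated)
      show "1 / real (Suc m) > 0" by simp
      show "1 / real (Suc m) \<le> dist x y" if "x \<in> T \<inter> F" "y \<in> A m" for x y
        using that infdist_le[of x F y] by (auto simp: A_def dist_commute)
    qed
    also have "\<dots> \<le> ?H T" by (rule outer_mono) (auto simp: A_def)
    finally show ?thesis .
  qed
  have "?H (T \<inter> F) + ?H (T - F) \<le> ?H T + ennreal e" if "e > 0" for e :: real
  proof -
    \<comment> \<open>The shells beyond a large index contribute arbitrarily little, so
      \<open>T - F\<close> is exhausted by the sets \<open>A m\<close>, which keep a positive
      distance from \<open>F\<close>.\<close>
    have tail: "\<exists>M. \<forall>m\<ge>M. (\<Sum>n. f (n + m)) < ennreal (e / 2)" if "(\<Sum>n. f n) < top" for f :: "nat \<Rightarrow> ennreal"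
    proof -
      have "\<forall>n. f n \<noteq> top" using ennreal_suminf_lessD[OF that] by (metis less_irrefl)
      then have f: "f n = ennreal (enn2real (f n))" for n by (simp add: less_top)
      have s: "summable (\<lambda>n. enn2real (f n))"
        using that f by (metis (no_types, lifting) enn2real_nonneg less_irrefl suminf_cong summable_suminf_not_top)
      have "(\<lambda>m. \<Sum>n. enn2real (f (n + m))) \<longlonglongrightarrow> 0"
        using suminf_exist_split2[OF s] .
      then have "\<forall>\<^sub>F m in sequentially. (\<Sum>n. enn2real (f (n + m))) < e / 2"
        using \<open>e > 0\<close> by (intro order_tendstoD) auto
      then obtain M where M: "\<And>m. m \<ge> M \<Longrightarrow> (\<Sum>n. enn2real (f (n + m))) < e / 2"
        by (auto simp: eventually_sequentially)
      have "(\<Sum>n. f (n + m)) < ennreal (e / 2)" if "m \<ge> M" for m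
      proof -
        have "(\<Sum>n. f (n + m)) = (\<Sum>n. ennreal (enn2real (f (n + m))))" using f by simp
        also have "\<dots> = ennreal (\<Sum>n. enn2real (f (n + m)))"
          using s by (intro suminf_ennreal2) (auto simp: summable_iff_shift[of "\<lambda>n. enn2real (f n)"])
        finally show ?thesis using M[OF that] \<open>e > 0\<close> by (simp add: ennreal_lessI)
      qed
      then show ?thesis by blast
    qed
    obtain M where M: "\<And>p m. p < 2 \<Longrightarrow> m \<ge> M \<Longrightarrow> (\<Sum>n. ?H (B (2 * (n + m) + p))) < ennreal (e / 2)"
    proof -
      obtain M0 where M0: "\<forall>m\<ge>M0. (\<Sum>n. ?H (B (2 * (n + m) + 0))) < ennreal (e / 2)"
        using tail[OF parity'[of 0]] by auto
      obtain M1 where M1: "\<forall>m\<ge>M1. (\<Sum>n. ?H (B (2 * (n + m) + 1))) < ennreal (e / 2)"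
        using tail[OF parity'[of 1]] by auto
      have "(\<Sum>n. ?H (B (2 * (n + m) + p))) < ennreal (e / 2)" if "p < 2" "m \<ge> max M0 M1" for p m
        using that M0 M1 by (cases "p = 0") (auto simp: less_2_cases_iff)
      then show ?thesis using that by blast
    qed
    \<comment> \<open>An even starting index, so that the remaining shells are exactly the tails
      from \<open>M\<close> of the two parity series.\<close>
    let ?m = "2 * M"
    have "(\<Union>n. B (n + ?m)) = (\<Union>n. B (2 * (n + M) + 0)) \<union> (\<Union>n. B (2 * (n + M) + 1))"
    proof (intro equalityI subsetI)
      fix x assume "x \<in> (\<Union>n. B (n + ?m))"
      then obtain n where n: "x \<in> B (n + ?m)" by auto
      show "x \<in> (\<Union>n. B (2 * (n + M) + 0)) \<union> (\<Union>n. B (2 * (n + M) + 1))"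
      proof (cases "even n")
        case True then obtain j where "n = 2 * j" by auto
        then have "x \<in> B (2 * (j + M) + 0)" using n by (simp add: algebra_simps)
        then show ?thesis by blast
      next
        case False then obtain j where "n = 2 * j + 1" by (auto elim: oddE)
        then have "x \<in> B (2 * (j + M) + 1)" using n by (simp add: algebra_simps)
        then show ?thesis by blast
      qed
    next
      fix x assume "x \<in> (\<Union>n. B (2 * (n + M) + 0)) \<union> (\<Union>n. B (2 * (n + M) + 1))"
      then obtain n p where "x \<in> B (2 * (n + M) + p)" by blast
      then have "x \<in> B ((2 * n + p) + ?m)" by (simp add: algebra_simps)
      then show "x \<in> (\<Union>n. B (n + ?m))" by blast
    qed
    then have "T - F = A ?m \<union> ((\<Union>n. B (2 * (n + M) + 0)) \<union> (\<Union>n. B (2 * (n + M) + 1)))"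
      using TF[of ?m] by simp
    then have "?H (T - F) \<le> ?H (A ?m) + (?H (\<Union>n. B (2 * (n + M) + 0)) + ?H (\<Union>n. B (2 * (n + M) + 1)))"
      by (metis (no_types, lifting) outer_Un_le add_left_mono order_trans)
    also have "\<dots> \<le> ?H (A ?m) + ((\<Sum>n. ?H (B (2 * (n + M) + 0))) + (\<Sum>n. ?H (B (2 * (n + M) + 1))))"
      by (intro add_mono outer_UN_le order_refl)
    also have "\<dots> \<le> ?H (A ?m) + (ennreal (e / 2) + ennreal (e / 2))"
      by (intro add_mono order_refl less_imp_le M) auto
    also have "ennreal (e / 2) + ennreal (e / 2) = ennreal e"
      using \<open>e > 0\<close> by (subst ennreal_plus[symmetric]) auto
    finally have "?H (T \<inter> F) + ?H (T - F) \<le> ?H (T \<inter> F) + (?H (A ?m) + ennreal e)"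
      by (rule add_left_mono)
    also have "\<dots> \<le> ?H T + ennreal e"
      using sepA[of ?m] by (simp add: add.assoc[symmetric] add_right_mono)
    finally show ?thesis .
  qed
  then show ?thesis by (rule ennreal_le_epsilon)
qed auto

text \<open>The sets that split every set additively form a sigma-algebra on which the outer measure
  is a measure. It contains the closed sets by the criterion above, hence all Borel sets.\<close>

lemma measure_space_hausdorff:
  "measure_space UNIV (sets borel) (hausdorff_outer k :: 'a::euclidean_space set \<Rightarrow> ennreal)"
proof -
  let ?H = "hausdorff_outer k :: 'a set \<Rightarrow> ennreal"
  interpret S: sigma_algebra "UNIV :: 'a set" "Pow UNIV" by (rule sigma_algebra_Pow)
  let ?L = "lambda_system UNIV (Pow UNIV) ?H"
  have ms: "measure_space UNIV ?L ?H"
    using S.caratheodory_lemma[OF outer_measure_space_hausdorff] .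
  then interpret L: sigma_algebra UNIV ?L by (simp add: measure_space_def)
  have "F \<in> ?L" if "closed F" for F :: "'a set"
  proof (cases "F = {}")
    case False
    show ?thesis
      unfolding S.lambda_system_eq[unfolded Pow_UNIV] Pow_UNIV
    proof (intro CollectI conjI ballI antisym)
      fix T :: "'a set"
      show "?H (T \<inter> F) + ?H (T - F) \<le> ?H T" by (rule outer_closed_split[OF that False])
      have "T = T \<inter> F \<union> (T - F)" by blast
      then show "?H T \<le> ?H (T \<inter> F) + ?H (T - F)"
        using outer_Un_le[of k "T \<inter> F" "T - F"] by argo
    qed auto
  qed (use L.empty_sets in auto)
  then have "sigma_sets UNIV (Collect closed) \<subseteq> ?L"
    by (intro L.sigma_sets_subset) auto
  then have "sets (borel :: 'a measure) \<subseteq> ?L"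
    by (simp add: borel_eq_closed sets_measure_of)
  show ?thesis
    unfolding measure_space_def
  proof (intro conjI)
    show "sigma_algebra UNIV (sets (borel :: 'a measure))"
      using sets.sigma_algebra_axioms[of "borel :: 'a measure"] by simp
    show "positive (sets borel) ?H" by (simp add: positive_def)
    have "countably_additive ?L ?H" using ms by (simp add: measure_space_def)
    then show "countably_additive (sets borel) ?H"
      unfolding countably_additive_def using \<open>sets borel \<subseteq> ?L\<close> by (meson order_trans subsetD)
  qed
qed

lemma sets_hausdorff [simp, measurable_cong]: "sets (hausdorff_measure k) = sets borel"
  unfolding hausdorff_measure_def using sets.sigma_sets_eq[of borel] by (simp add: sets_measure_of)

lemma space_hausdorff [simp]: "space (hausdorff_measure k) = UNIV"
  unfolding hausdorff_measure_def by (simp add: space_measure_of)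

text \<open>Without the measure space property, \<open>measure_of\<close> would return the zero
  measure; with it, the value on a Borel set is that of the outer measure.\<close>

lemma emeasure_hausdorff:
  assumes "A \<in> sets borel"
  shows "emeasure (hausdorff_measure k) A = hausdorff_outer k A"
  using measure_space_hausdorff[of k] assms sets.sigma_sets_eq[of "borel :: 'a measure"]
  unfolding measure_space_def
  by (intro emeasure_measure_of[OF hausdorff_measure_def]) auto

text \<open>The image of a cover with mesh \<open>\<delta> / L\<close> is a cover with mesh
  \<open>\<delta>\<close>, and each weight grows at most by the factor \<open>L ^ k\<close>.\<close>

lemma outer_lipschitz_image:
  fixes f :: "'a::euclidean_space \<Rightarrow> 'b::euclidean_space"
  assumes L: "L > 0" and f: "\<And>x y. x \<in> A \<Longrightarrow> y \<in> A \<Longrightarrow> dist (f x) (f y) \<le> L * dist x y"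
  shows "hausdorff_outer k (f ` A) \<le> ennreal (L ^ k) * hausdorff_outer k A"
proof (rule outer_leI)
  fix \<delta> :: real assume "\<delta> > 0"
  have "hausdorff_premeasure k \<delta> (f ` A) / ennreal (L ^ k) \<le> hausdorff_premeasure k (\<delta> / L) A"
  proof (rule premeasure_ge)
    fix U :: "nat \<Rightarrow> 'a set"
    assume U: "\<And>i. bounded (U i)" "\<And>i. diameter (U i) \<le> \<delta> / L" "A \<subseteq> (\<Union>i. U i)"
    \<comment> \<open>The Lipschitz bound is assumed on \<open>A\<close> only, so the covering sets
      are cut down to \<open>A\<close> before they are mapped.\<close>
    define V where "V i = f ` (U i \<inter> A)" for i
    have d: "dist (f x) (f y) \<le> L * diameter (U i)" if "x \<in> U i \<inter> A" "y \<in> U i \<inter> A" for x y i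
    proof -
      have "dist (f x) (f y) \<le> L * dist x y" using that f by auto
      also have "\<dots> \<le> L * diameter (U i)"
        using that L diameter_bounded_bound[OF U(1)] by (intro mult_left_mono) auto
      finally show ?thesis .
    qed
    have bV: "bounded (V i)" for i
      unfolding bounded_two_points V_def using d by blast
    have dV: "diameter (V i) \<le> L * diameter (U i)" for i
      using d L diameter_ge_0[OF U(1)] by (intro diameter_leI) (auto simp: V_def)
    have "hausdorff_premeasure k \<delta> (f ` A) \<le> (\<Sum>i. diam_weight k (V i))"
    proof (rule premeasure_le)
      show "diameter (V i) \<le> \<delta>" for i
        using dV[of i] U(2)[of i] L by (simp add: field_simps)
      show "f ` A \<subseteq> (\<Union>i. V i)" using U(3) by (force simp: V_def)
    qed (rule bV)
    also have "\<dots> \<le> (\<Sum>i. ennreal (L ^ k) * diam_weight k (U i))"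
    proof (intro suminf_le allI)
      fix i
      show "diam_weight k (V i) \<le> ennreal (L ^ k) * diam_weight k (U i)"
      proof (cases "V i = {}")
        case False
        then have "U i \<noteq> {}" by (auto simp: V_def)
        have "unit_ball_vol (real k) * (diameter (V i) / 2) ^ k \<le> L ^ k * (unit_ball_vol (real k) * (diameter (U i) / 2) ^ k)"
        proof -
          have "(diameter (V i) / 2) ^ k \<le> (L * (diameter (U i) / 2)) ^ k"
            using dV[of i] diameter_ge_0[OF bV[of i]] by (intro power_mono) auto
          then have "unit_ball_vol (real k) * (diameter (V i) / 2) ^ k \<le> unit_ball_vol (real k) * (L * (diameter (U i) / 2)) ^ k"
            by (intro mult_left_mono) auto
          then show ?thesis by (simp only: power_mult_distrib mult.left_commute)
        qed
        then show ?thesis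
          using False \<open>U i \<noteq> {}\<close> L by (simp add: diam_weight_def ennreal_mult'[symmetric] ennreal_leI)
      qed auto
    qed auto
    also have "\<dots> = ennreal (L ^ k) * (\<Sum>i. diam_weight k (U i))" by simp
    finally show "hausdorff_premeasure k \<delta> (f ` A) / ennreal (L ^ k) \<le> (\<Sum>i. diam_weight k (U i))"
      using L by (intro divide_le_posI_ennreal) (auto simp: mult.commute)
  qed
  then have "hausdorff_premeasure k \<delta> (f ` A) / ennreal (L ^ k) * ennreal (L ^ k) \<le>
      hausdorff_premeasure k (\<delta> / L) A * ennreal (L ^ k)"
    by (rule mult_right_mono) simp
  also have "hausdorff_premeasure k \<delta> (f ` A) / ennreal (L ^ k) * ennreal (L ^ k) = hausdorff_premeasure k \<delta> (f ` A)"
  proof -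
    have "ennreal (L ^ k) / ennreal (L ^ k) = 1" using L by (intro ennreal_divide_self) auto
    then show ?thesis by (simp add: ennreal_divide_times)
  qed
  also have "hausdorff_premeasure k (\<delta> / L) A * ennreal (L ^ k) = ennreal (L ^ k) * hausdorff_premeasure k (\<delta> / L) A"
    by (rule mult.commute)
  also have "\<dots> \<le> ennreal (L ^ k) * hausdorff_outer k A"
    using \<open>\<delta> > 0\<close> L by (intro mult_left_mono premeasure_le_outer) auto
  finally show "hausdorff_premeasure k \<delta> (f ` A) \<le> ennreal (L ^ k) * hausdorff_outer k A" .
qed

text \<open>The Lipschitz bound with constant one, for the map and for its inverse on the
  image.\<close>

lemma outer_isometry_image:
  fixes f :: "'a::euclidean_space \<Rightarrow> 'b::euclidean_space"
  assumes f: "\<And>x y. x \<in> A \<Longrightarrow> y \<in> A \<Longrightarrow> dist (f x) (f y) = dist x y"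
  shows "hausdorff_outer k (f ` A) = hausdorff_outer k A"
proof (rule antisym)
  show "hausdorff_outer k (f ` A) \<le> hausdorff_outer k A"
    using outer_lipschitz_image[of 1 A f k] f by simp
  have inj: "inj_on f A" by (rule inj_onI) (metis dist_eq_0_iff f)
  have "hausdorff_outer k (inv_into A f ` f ` A) \<le> hausdorff_outer k (f ` A)"
    using outer_lipschitz_image[of 1 "f ` A" "inv_into A f" k] f inj by (force simp: inv_into_f_f)
  then show "hausdorff_outer k A \<le> hausdorff_outer k (f ` A)"
    using inj by (simp add: image_image cong: image_cong)
qed


section \<open>Null sets and the volume they sweep out\<close>

lemma outer_null_cover:
  fixes Z :: "'a::euclidean_space set"
  assumes k: "k > 0" and Z: "hausdorff_outer k Z = 0" and e: "e > 0"
  obtains U \<rho> where "Z \<subseteq> (\<Union>i::nat. U i)" "\<And>i. bounded (U i)" "\<And>i. diameter (U i) \<le> \<rho> i"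
    "\<And>i. 0 < \<rho> i" "\<And>i. \<rho> i \<le> 1" "(\<Sum>i. ennreal (\<rho> i ^ k)) \<le> ennreal e"
proof -
  define c where "c = unit_ball_vol (real k) / 2 ^ k"
  have c: "c > 0" by (simp add: c_def)
  \<comment> \<open>The mesh 1/2 leaves room for enlarging every radius while keeping it at most
    one.\<close>
  have "hausdorff_premeasure k (1/2) Z \<le> 0"
    using premeasure_le_outer[of "1/2" k Z] Z by simp
  also have "\<dots> < ennreal (c * (e / 2))" using c e by simp
  finally obtain U where U: "\<And>i. bounded (U i)" "\<And>i. diameter (U i) \<le> 1/2" "Z \<subseteq> (\<Union>i::nat. U i)"
    "(\<Sum>i. diam_weight k (U i)) < ennreal (c * (e / 2))"
    by (metis premeasure_coverE)
  define d where "d i = diameter (U i)" for i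
  have d0: "0 \<le> d i" for i using U(1) by (simp add: d_def diameter_ge_0)
  have dw: "diam_weight k (U i) = ennreal c * ennreal (d i ^ k)" for i
    using k c d0[of i] by (cases "U i = {}")
      (auto simp: diam_weight_def d_def c_def ennreal_mult[symmetric] field_simps)
  have "ennreal c * (\<Sum>i. ennreal (d i ^ k)) < ennreal c * ennreal (e / 2)"
  proof -
    have "ennreal c * (\<Sum>i. ennreal (d i ^ k)) = (\<Sum>i. diam_weight k (U i))" by (simp add: dw)
    moreover have "ennreal c * ennreal (e / 2) = ennreal (c * (e / 2))" using c e by (intro ennreal_mult'[symmetric]) auto
    ultimately show ?thesis using U(4) by argo
  qed
  then have sum_d: "(\<Sum>i. ennreal (d i ^ k)) < ennreal (e / 2)"
    by (metis linorder_not_le mult_left_mono zero_le)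
  \<comment> \<open>A covering set may be a single point, but later the radii occur as denominators.
    By continuity of the power, each diameter can be raised to a positive radius, at a total cost of
    \<open>e / 2\<close>.\<close>
  have "\<exists>r>0. r \<le> 1 \<and> d i \<le> r \<and> r ^ k \<le> d i ^ k + (e / 2) * (1/2) ^ Suc i" for i
  proof -
    have "((\<lambda>r. r ^ k) \<longlongrightarrow> d i ^ k) (at_right (d i))" by (intro tendsto_intros)
    moreover have "d i ^ k < d i ^ k + (e / 2) * (1/2) ^ Suc i" using e by simp
    ultimately have "\<forall>\<^sub>F r in at_right (d i). r ^ k < d i ^ k + (e / 2) * (1/2) ^ Suc i"
      by (rule order_tendstoD)
    moreover have "\<forall>\<^sub>F r in at_right (d i). r \<in> {d i<..<1}"
      by (rule eventually_at_right_real) (use U(2)[of i] in \<open>simp add: d_def\<close>)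
    ultimately have "\<forall>\<^sub>F r in at_right (d i). r ^ k < d i ^ k + (e / 2) * (1/2) ^ Suc i \<and> r \<in> {d i<..<1}"
      by eventually_elim auto
    then obtain r where "r ^ k < d i ^ k + (e / 2) * (1/2) ^ Suc i" "r \<in> {d i<..<1}"
      using eventually_happens'[OF trivial_limit_at_right_real] by blast
    then show ?thesis using d0[of i] by (intro exI[of _ r]) auto
  qed
  then obtain \<rho> where \<rho>: "\<And>i. \<rho> i > 0" "\<And>i. \<rho> i \<le> 1" "\<And>i. d i \<le> \<rho> i"
    "\<And>i. \<rho> i ^ k \<le> d i ^ k + (e / 2) * (1/2) ^ Suc i"
    by metis
  have "(\<Sum>i. ennreal (\<rho> i ^ k)) \<le> (\<Sum>i. ennreal (d i ^ k) + ennreal (e / 2) * ennreal ((1/2) ^ Suc i))"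
  proof (intro suminf_le allI)
    fix i
    have "ennreal (\<rho> i ^ k) \<le> ennreal (d i ^ k + (e / 2) * (1/2) ^ Suc i)"
      by (rule ennreal_leI[OF \<rho>(4)])
    then show "ennreal (\<rho> i ^ k) \<le> ennreal (d i ^ k) + ennreal (e / 2) * ennreal ((1/2) ^ Suc i)"
      using d0[of i] e by (simp add: ennreal_mult''[symmetric])
  qed auto
  also have "\<dots> = (\<Sum>i. ennreal (d i ^ k)) + (\<Sum>i. ennreal (e / 2) * ennreal ((1/2) ^ Suc i))"
    by (subst suminf_add) auto
  also have "(\<Sum>i. ennreal (e / 2) * ennreal ((1/2) ^ Suc i)) = ennreal (e / 2)"
    unfolding ennreal_suminf_cmult
    by (subst suminf_ennreal_eq[OF zero_le_power power_half_series]) auto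
  also have "(\<Sum>i. ennreal (d i ^ k)) + ennreal (e / 2) \<le> ennreal (e / 2) + ennreal (e / 2)"
    using sum_d by (intro add_right_mono) simp
  also have "\<dots> = ennreal e" using e by (subst ennreal_plus[symmetric]) auto
  finally show ?thesis using that[of U \<rho>] U \<rho> by (simp add: d_def)
qed

text \<open>Over a covering set of size \<open>\<rho>\<close>, the parameter interval is cut into
  about \<open>2 * T / \<rho>\<close> steps of length \<open>\<rho>\<close>, and the image of each
  step lies in a ball of radius \<open>2 * L * \<rho>\<close>. These balls have total volume of
  order \<open>\<rho> ^ Suc k / \<rho> = \<rho> ^ k\<close>, and the powers have an arbitrarily
  small sum because \<open>Z\<close> is null in dimension \<open>k\<close>.\<close>

lemma negligible_null_tube:
  fixes Z :: "'a::euclidean_space set" and \<Psi> :: "'a \<Rightarrow> real \<Rightarrow> 'b::euclidean_space"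
  assumes k: "k > 0" "DIM('b) = Suc k" and Z: "hausdorff_outer k Z = 0"
    and T: "T > 0" and L: "L > 0"
    and lip: "\<And>x y s t. x \<in> Z \<Longrightarrow> y \<in> Z \<Longrightarrow> \<bar>s\<bar> \<le> T \<Longrightarrow> \<bar>t\<bar> \<le> T \<Longrightarrow>
      dist (\<Psi> x s) (\<Psi> y t) \<le> L * (dist x y + \<bar>s - t\<bar>)"
  shows "negligible ((\<lambda>(x, t). \<Psi> x t) ` (Z \<times> {-T..T}))"
  unfolding negligible_outer_le
proof (intro allI impI)
  fix e :: real assume e: "e > 0"
  define C where "C = unit_ball_vol (real (Suc k)) * (2 * L) ^ Suc k"
  have C: "C > 0" using L by (simp add: C_def)
  obtain U \<rho> where U: "Z \<subseteq> (\<Union>i::nat. U i)" "\<And>i. bounded (U i)" "\<And>i. diameter (U i) \<le> \<rho> i"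
    and \<rho>: "\<And>i. 0 < \<rho> i" "\<And>i. \<rho> i \<le> 1"
    and sum: "(\<Sum>i. ennreal (\<rho> i ^ k)) \<le> ennreal (e / (C * (2 * T + 1)))"
    using outer_null_cover[OF k(1) Z, of "e / (C * (2 * T + 1))"] e C T by auto
  \<comment> \<open>The step indices run from 0 to the integer part inclusive, hence the additional
    one.\<close>
  define N where "N i = nat \<lfloor>2 * T / \<rho> i\<rfloor> + 1" for i
  \<comment> \<open>A point of \<open>Z\<close> in the covering set serves as centre. For sets that
    miss \<open>Z\<close> the choice is arbitrary, and the bound on the volume of the balls does not
    depend on it.\<close>
  define x where "x i = (SOME x. x \<in> U i \<inter> Z)" for i
  define B where "B i = (\<Union>j<N i. cball (\<Psi> (x i) (- T + real j * \<rho> i)) (2 * L * \<rho> i))" for i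
  have N: "real (N i) * \<rho> i \<le> 2 * T + 1" for i
  proof -
    have "real (N i) \<le> 2 * T / \<rho> i + 1" using T \<rho>(1)[of i] by (simp add: N_def)
    then have "real (N i) * \<rho> i \<le> (2 * T / \<rho> i + 1) * \<rho> i" using \<rho>(1)[of i] by (intro mult_right_mono) auto
    also have "\<dots> = 2 * T + \<rho> i" using \<rho>(1)[of i] by (simp add: field_simps)
    finally show ?thesis using \<rho>(2)[of i] by simp
  qed
  have sub: "(\<lambda>(x, t). \<Psi> x t) ` (Z \<times> {-T..T}) \<subseteq> (\<Union>i. B i)"
  proof clarsimp
    fix y t assume y: "y \<in> Z" and t: "- T \<le> t" "t \<le> T"
    obtain i where i: "y \<in> U i" using y U(1) by blast
    then have x: "x i \<in> U i" "x i \<in> Z" using someI[of "\<lambda>x. x \<in> U i \<inter> Z" y] y by (auto simp: x_def)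
    define j where "j = nat \<lfloor>(t + T) / \<rho> i\<rfloor>"
    have j: "real j \<le> (t + T) / \<rho> i" "(t + T) / \<rho> i < real j + 1"
      using t \<rho>(1)[of i] by (auto simp: j_def)
    have "(t + T) / \<rho> i \<le> 2 * T / \<rho> i" using t \<rho>(1)[of i] by (intro divide_right_mono) auto
    then have jN: "j < N i" unfolding N_def j_def by (simp add: floor_mono nat_mono less_Suc_eq_le)
    have j': "real j * \<rho> i \<le> t + T" "t + T < real j * \<rho> i + \<rho> i"
      using j \<rho>(1)[of i] by (auto simp: field_simps)
    have "dist (\<Psi> (x i) (- T + real j * \<rho> i)) (\<Psi> y t) \<le> L * (dist (x i) y + \<bar>- T + real j * \<rho> i - t\<bar>)"
    proof (rule lip[OF x(2) y])
      have "0 \<le> real j * \<rho> i" using \<rho>(1)[of i] by simp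
      then show "\<bar>- T + real j * \<rho> i\<bar> \<le> T" "\<bar>t\<bar> \<le> T" using t j' by linarith+
    qed
    also have "\<dots> \<le> L * (\<rho> i + \<rho> i)"
    proof (intro mult_left_mono add_mono)
      show "dist (x i) y \<le> \<rho> i"
        using diameter_bounded_bound[OF U(2) x(1) i] U(3)[of i] by simp
    qed (use j' L in auto)
    finally show "\<exists>i. \<Psi> y t \<in> B i" using jN by (auto simp: B_def intro!: exI[of _ i] bexI[of _ j])
  qed
  have meas: "(\<Union>i. B i) \<in> sets lborel" by (auto simp: B_def)
  have "emeasure lborel (\<Union>i. B i) \<le> (\<Sum>i. emeasure lborel (B i))"
    by (intro emeasure_subadditive_countably) (auto simp: B_def)
  also have "\<dots> \<le> (\<Sum>i. ennreal (C * (2 * T + 1)) * ennreal (\<rho> i ^ k))"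
  proof (intro suminf_le allI)
    fix i
    have "emeasure lborel (B i) \<le> (\<Sum>j<N i. emeasure lborel (cball (\<Psi> (x i) (- T + real j * \<rho> i)) (2 * L * \<rho> i)))"
      unfolding B_def by (intro emeasure_subadditive_finite) auto
    also have "\<dots> = (\<Sum>j<N i. ennreal (unit_ball_vol (real (Suc k)) * (2 * L * \<rho> i) ^ Suc k))"
      using L \<rho>(1)[of i] k(2) by (intro sum.cong refl, subst emeasure_cball) auto
    also have "\<dots> = of_nat (N i) * ennreal (C * \<rho> i ^ Suc k)"
      by (simp add: C_def power_mult_distrib mult_ac)
    also have "\<dots> = ennreal (C * (real (N i) * \<rho> i) * \<rho> i ^ k)"
      using C \<rho>(1)[of i] by (simp add: ennreal_of_nat_eq_real_of_nat ennreal_mult'[symmetric] mult_ac)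
    also have "\<dots> \<le> ennreal (C * (2 * T + 1) * \<rho> i ^ k)"
      using C \<rho>(1)[of i] N[of i] by (intro ennreal_leI mult_right_mono mult_left_mono) auto
    also have "\<dots> = ennreal (C * (2 * T + 1)) * ennreal (\<rho> i ^ k)"
      using C T \<rho>(1)[of i] by (intro ennreal_mult) auto
    finally show "emeasure lborel (B i) \<le> ennreal (C * (2 * T + 1)) * ennreal (\<rho> i ^ k)" .
  qed auto
  also have "\<dots> = ennreal (C * (2 * T + 1)) * (\<Sum>i. ennreal (\<rho> i ^ k))" by simp
  also have "\<dots> \<le> ennreal (C * (2 * T + 1)) * ennreal (e / (C * (2 * T + 1)))"
    by (intro mult_left_mono sum) auto
  also have "\<dots> = ennreal e" using C T e by (subst ennreal_mult[symmetric]) auto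
  finally have le: "emeasure lborel (\<Union>i. B i) \<le> ennreal e" .
  then have "(\<Union>i. B i) \<in> lmeasurable"
    using meas by (intro fmeasurableI) (auto simp: less_top top_unique intro: le_less_trans)
  moreover have "measure lebesgue (\<Union>i. B i) \<le> e"
    using le e meas by (simp add: measure_def enn2real_leI)
  ultimately show "\<exists>T'. (\<lambda>(x, t). \<Psi> x t) ` (Z \<times> {-T..T}) \<subseteq> T' \<and> T' \<in> lmeasurable \<and> measure lebesgue T' \<le> e"
    using sub by blast
qed


text \<open>The finite family becomes a sequence by appending empty sets, whose weight is zero and
  whose diameter is admissible because of \<open>0 \<le> \<delta>\<close>.\<close>

lemma premeasure_finite_cover:
  fixes U :: "'i \<Rightarrow> 'a::euclidean_space set"
  assumes I: "finite I" and \<delta>: "0 \<le> \<delta>" and U: "\<And>i. i \<in> I \<Longrightarrow> bounded (U i)" "\<And>i. i \<in> I \<Longrightarrow> diameter (U i) \<le> \<delta>"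
    and A: "A \<subseteq> (\<Union>i\<in>I. U i)"
  shows "hausdorff_premeasure k \<delta> A \<le> (\<Sum>i\<in>I. diam_weight k (U i))"
proof -
  obtain h where h: "bij_betw h {0..<card I} I"
    using ex_bij_betw_nat_finite[OF I] by blast
  define V where "V n = (if n < card I then U (h n) else {})" for n
  have hI: "h n \<in> I" if "n < card I" for n
    using h that by (auto simp: bij_betw_def)
  have "hausdorff_premeasure k \<delta> A \<le> (\<Sum>n. diam_weight k (V n))"
  proof (rule premeasure_le)
    show "A \<subseteq> (\<Union>n. V n)"
    proof
      fix x assume "x \<in> A"
      then obtain i where "i \<in> I" "x \<in> U i" using A by auto
      moreover have "i \<in> h ` {0..<card I}" using h \<open>i \<in> I\<close> by (simp add: bij_betw_def)
      ultimately obtain n where "n < card I" "h n = i" by auto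
      then have "x \<in> V n" using \<open>x \<in> U i\<close> by (simp add: V_def)
      then show "x \<in> (\<Union>n. V n)" by blast
    qed
  qed (use U hI \<delta> in \<open>auto simp: V_def\<close>)
  also have "\<dots> = (\<Sum>n\<in>{0..<card I}. diam_weight k (V n))"
    by (rule suminf_finite) (auto simp: V_def)
  also have "\<dots> = (\<Sum>n\<in>{0..<card I}. diam_weight k (U (h n)))"
    by (intro sum.cong) (auto simp: V_def)
  also have "\<dots> = (\<Sum>i\<in>I. diam_weight k (U i))"
    by (rule sum.reindex_bij_betw[OF h])
  finally show ?thesis .
qed

text \<open>Unlike \<open>restrict_space\<close>, this keeps all measurability questions in the Borel sets of the
  ambient space.\<close>

definition hausdorff_on :: "nat \<Rightarrow> 'a::euclidean_space set \<Rightarrow> 'a measure" where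
  "hausdorff_on k S = density (hausdorff_measure k) (indicator S)"

lemma sets_hausdorff_on [simp, measurable_cong]: "sets (hausdorff_on k S) = sets borel"
  by (simp add: hausdorff_on_def)

lemma space_hausdorff_on [simp]: "space (hausdorff_on k S) = UNIV"
  by (simp add: hausdorff_on_def)

lemma emeasure_hausdorff_on:
  assumes "S \<in> sets borel" "E \<in> sets borel"
  shows "emeasure (hausdorff_on k S) E = hausdorff_outer k (S \<inter> E)"
proof -
  have "emeasure (hausdorff_on k S) E = (\<integral>\<^sup>+x. indicator S x * indicator E x \<partial>hausdorff_measure k)"
    unfolding hausdorff_on_def using assms by (intro emeasure_density) auto
  also have "\<dots> = (\<integral>\<^sup>+x. indicator (S \<inter> E) x \<partial>hausdorff_measure k)"
    by (intro nn_integral_cong) (simp split: split_indicator)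
  also have "\<dots> = hausdorff_outer k (S \<inter> E)"
    using assms by (subst nn_integral_indicator) (auto simp: emeasure_hausdorff)
  finally show ?thesis .
qed

subsection \<open>Hausdorff measure on the base hyperplane\<close>

abbreviation last_axis :: "real^'n::{finite,wellorder}" where
  "last_axis \<equiv> axis last_index 1"

lemma linear_base_proj: "linear (base_proj :: real^'n::{finite,wellorder} \<Rightarrow> real^'n::_)"
  by (rule linearI) (auto simp: base_proj_def vec_eq_iff)

lemma base_proj_in_base [simp]: "base_proj z \<in> base_hyperplane"
  by (simp add: base_proj_def base_hyperplane_def)

lemma base_proj_base: "u \<in> base_hyperplane \<Longrightarrow> base_proj u = u"
  by (auto simp: base_proj_def base_hyperplane_def vec_eq_iff)

lemma base_proj_add: "base_proj (x + y) = base_proj x + base_proj y"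
  using linear_add[OF linear_base_proj] .

lemma base_proj_scaleR: "base_proj (c *\<^sub>R x) = c *\<^sub>R base_proj x"
  using linear_scale[OF linear_base_proj] .

lemma base_proj_last_axis [simp]: "base_proj (last_axis :: real^'n::{finite,wellorder}) = 0"
  by (auto simp: base_proj_def vec_eq_iff axis_def)

lemma base_proj_decomp: "base_proj z + (z $ last_index) *\<^sub>R last_axis = z"
  by (auto simp: base_proj_def vec_eq_iff axis_def)

lemma subspace_base: "subspace (base_hyperplane :: (real^'n::{finite,wellorder}) set)"
  by (auto simp: base_hyperplane_def subspace_def)

lemma closed_base: "closed (base_hyperplane :: (real^'n::{finite,wellorder}) set)"
  by (rule closed_subspace[OF subspace_base])

lemma base_borel [measurable]: "base_hyperplane \<in> sets borel"
  using closed_base by (rule borel_closed)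

lemma continuous_base_proj: "continuous_on S base_proj"
  using linear_base_proj by (rule linear_continuous_on[OF linear_conv_bounded_linear[THEN iffD1]])

lemma base_proj_measurable [measurable]: "base_proj \<in> borel_measurable borel"
  by (intro borel_measurable_continuous_onI continuous_base_proj)

lemma last_coord_measurable [measurable]: "(\<lambda>z::real^'n::{finite,wellorder}. z $ last_index) \<in> borel_measurable borel"
  by (intro borel_measurable_continuous_onI continuous_intros)

lemma norm_base_proj_le: "norm (base_proj z) \<le> norm z"
  by (rule norm_le_componentwise_cart) (auto simp: base_proj_def)

lemma nn_integral_lborel_translate:
  fixes f :: "'a::euclidean_space \<Rightarrow> ennreal"
  assumes [measurable]: "f \<in> borel_measurable borel"
  shows "(\<integral>\<^sup>+x. f (x + c) \<partial>lborel) = (\<integral>\<^sup>+x. f x \<partial>lborel)"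
proof -
  have "(\<integral>\<^sup>+x. f x \<partial>lborel) = (\<integral>\<^sup>+x. f x \<partial>distr lborel borel ((+) c))"
    by (simp add: lborel_distr_plus)
  also have "\<dots> = (\<integral>\<^sup>+x. f (x + c) \<partial>lborel)"
    by (subst nn_integral_distr) (auto simp: add.commute)
  finally show ?thesis by simp
qed

text \<open>Lebesgue measure on the base hyperplane is encoded as the projection of a slab of thickness one,
  because the dimension of \<open>real^'n\<close> cannot be lowered by one.\<close>

definition slab :: "(real^'n::{finite,wellorder}) set" where
  "slab = {z. 0 \<le> z $ last_index \<and> z $ last_index \<le> 1}"

definition flat_measure :: "(real^'n::{finite,wellorder}) measure" where
  "flat_measure = distr (density lborel (indicator slab)) borel base_proj"

lemma slab_measurable [measurable]: "slab \<in> sets borel"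
  unfolding slab_def by measurable

lemma sets_flat [simp, measurable_cong]: "sets flat_measure = sets borel"
  by (simp add: flat_measure_def)

lemma space_flat [simp]: "space flat_measure = UNIV"
  by (simp add: flat_measure_def)

lemma nn_integral_flat:
  assumes [measurable]: "f \<in> borel_measurable borel"
  shows "(\<integral>\<^sup>+u. f u \<partial>flat_measure) = (\<integral>\<^sup>+z. indicator slab z * f (base_proj z) \<partial>lborel)"
  unfolding flat_measure_def by (subst nn_integral_distr) (auto simp: nn_integral_density)

lemma emeasure_flat:
  assumes [measurable]: "E \<in> sets borel"
  shows "emeasure flat_measure E = emeasure lborel {z. base_proj z \<in> E \<and> z \<in> slab}"
proof -
  have "emeasure flat_measure E = (\<integral>\<^sup>+u. indicator E u \<partial>flat_measure)" by simp
  also have "\<dots> = (\<integral>\<^sup>+z. indicator slab z * indicator E (base_proj z) \<partial>lborel)"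
    by (rule nn_integral_flat) simp
  also have "\<dots> = (\<integral>\<^sup>+z. indicator {z. base_proj z \<in> E \<and> z \<in> slab} z \<partial>lborel)"
    by (intro nn_integral_cong) (auto simp: indicator_def)
  also have "\<dots> = emeasure lborel {z. base_proj z \<in> E \<and> z \<in> slab}"
    by (subst nn_integral_indicator) measurable
  finally show ?thesis .
qed

lemma AE_flat_base: "AE u in flat_measure. u \<in> base_hyperplane"
  unfolding flat_measure_def by (subst AE_distr_iff) (auto simp: AE_density)

text \<open>Fubini for the splitting of the space into the base hyperplane and the last axis. The
  thickness of the slab is absorbed by exchanging the integrals: for fixed \<open>z\<close>, the
  parameters \<open>t\<close> with \<open>z - t *\<^sub>R last_axis\<close> in the slab form an
  interval of length one.\<close>

lemma nn_integral_flat_last: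
  fixes f :: "real^'n::{finite,wellorder} \<Rightarrow> ennreal"
  assumes [measurable]: "f \<in> borel_measurable borel"
  shows "(\<integral>\<^sup>+u. \<integral>\<^sup>+t. f (u + t *\<^sub>R last_axis) \<partial>lborel \<partial>flat_measure) = (\<integral>\<^sup>+z. f z \<partial>lborel)"
proof -
  have "(\<integral>\<^sup>+u. \<integral>\<^sup>+t. f (u + t *\<^sub>R last_axis) \<partial>lborel \<partial>flat_measure) =
      (\<integral>\<^sup>+z. indicator slab z * (\<integral>\<^sup>+t. f (base_proj z + t *\<^sub>R last_axis) \<partial>lborel) \<partial>lborel)"
    by (rule nn_integral_flat) measurable
  also have "\<dots> = (\<integral>\<^sup>+z. \<integral>\<^sup>+t. indicator slab z * f (z + t *\<^sub>R last_axis) \<partial>lborel \<partial>lborel)"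
  proof (intro nn_integral_cong)
    fix z :: "real^'n::_"
    have "(\<integral>\<^sup>+t. f (base_proj z + t *\<^sub>R last_axis) \<partial>lborel) =
        (\<integral>\<^sup>+t. f (base_proj z + (t + z $ last_index) *\<^sub>R last_axis) \<partial>lborel)"
      by (subst nn_integral_lborel_translate[where f = "\<lambda>t. f (base_proj z + t *\<^sub>R last_axis)"]) simp_all
    also have "\<dots> = (\<integral>\<^sup>+t. f (z + t *\<^sub>R last_axis) \<partial>lborel)"
    proof (intro nn_integral_cong arg_cong[where f = f])
      fix t
      have "base_proj z + (t + z $ last_index) *\<^sub>R last_axis = (base_proj z + z $ last_index *\<^sub>R last_axis) + t *\<^sub>R last_axis"
        by (simp add: algebra_simps)
      then show "base_proj z + (t + z $ last_index) *\<^sub>R last_axis = z + t *\<^sub>R last_axis"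
        by (simp add: base_proj_decomp)
    qed
    finally show "indicator slab z * (\<integral>\<^sup>+t. f (base_proj z + t *\<^sub>R last_axis) \<partial>lborel) =
        (\<integral>\<^sup>+t. indicator slab z * f (z + t *\<^sub>R last_axis) \<partial>lborel)"
      by (simp add: nn_integral_cmult)
  qed
  also have "\<dots> = (\<integral>\<^sup>+t. \<integral>\<^sup>+z. indicator slab z * f (z + t *\<^sub>R last_axis) \<partial>lborel \<partial>lborel)"
    by (rule lborel_pair.Fubini') measurable
  also have "\<dots> = (\<integral>\<^sup>+t. \<integral>\<^sup>+z. indicator slab (z - t *\<^sub>R last_axis) * f z \<partial>lborel \<partial>lborel)"
  proof (rule nn_integral_cong)
    fix t :: real
    show "(\<integral>\<^sup>+z. indicator slab z * f (z + t *\<^sub>R last_axis) \<partial>lborel) =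
        (\<integral>\<^sup>+z. indicator slab (z - t *\<^sub>R last_axis) * f z \<partial>lborel)"
    proof -
      have "(\<lambda>z. indicator slab (z - t *\<^sub>R last_axis) * f z) \<in> borel_measurable borel" by measurable
      from nn_integral_lborel_translate[OF this, of "t *\<^sub>R last_axis"] show ?thesis by simp
    qed
  qed
  also have "\<dots> = (\<integral>\<^sup>+z. \<integral>\<^sup>+t. indicator slab (z - t *\<^sub>R last_axis) * f z \<partial>lborel \<partial>lborel)"
    by (rule lborel_pair.Fubini') measurable
  also have "\<dots> = (\<integral>\<^sup>+z. f z \<partial>lborel)"
  proof (intro nn_integral_cong)
    fix z :: "real^'n::_"
    have "(\<integral>\<^sup>+t. indicator slab (z - t *\<^sub>R last_axis) * f z \<partial>lborel) =
        (\<integral>\<^sup>+t. indicator {z $ last_index - 1 .. z $ last_index} t * f z \<partial>lborel)"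
      by (intro nn_integral_cong) (auto simp: slab_def indicator_def axis_def)
    also have "\<dots> = f z"
      by (simp add: nn_integral_multc)
    finally show "(\<integral>\<^sup>+t. indicator slab (z - t *\<^sub>R last_axis) * f z \<partial>lborel) = f z" .
  qed
  finally show ?thesis .
qed

lemma nn_integral_flat_translate:
  assumes [measurable]: "f \<in> borel_measurable borel" and c: "c \<in> base_hyperplane"
  shows "(\<integral>\<^sup>+u. f (u + c) \<partial>flat_measure) = (\<integral>\<^sup>+u. f u \<partial>flat_measure)"
proof -
  have "(\<integral>\<^sup>+u. f (u + c) \<partial>flat_measure) = (\<integral>\<^sup>+z. indicator slab z * f (base_proj z + c) \<partial>lborel)"
    by (rule nn_integral_flat) measurable
  also have "\<dots> = (\<integral>\<^sup>+z. indicator slab (z + c) * f (base_proj (z + c)) \<partial>lborel)"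
    using c by (intro nn_integral_cong)
      (auto simp: base_proj_add base_proj_base slab_def base_hyperplane_def indicator_def)
  also have "\<dots> = (\<integral>\<^sup>+z. indicator slab z * f (base_proj z) \<partial>lborel)"
    by (rule nn_integral_lborel_translate) measurable
  also have "\<dots> = (\<integral>\<^sup>+u. f u \<partial>flat_measure)"
    by (rule nn_integral_flat[symmetric]) measurable
  finally show ?thesis .
qed

lemma sigma_finite_flat: "sigma_finite_measure (flat_measure :: (real^'n::{finite,wellorder}) measure)"
proof
  let ?B = "\<lambda>n::nat. cball 0 (real n) :: (real^'n::_) set"
  show "\<exists>A. countable A \<and> A \<subseteq> sets (flat_measure :: (real^'n::_) measure) \<and> \<Union> A = space flat_measure \<and>
      (\<forall>a\<in>A. emeasure flat_measure a \<noteq> \<infinity>)"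
  proof (intro exI[of _ "range ?B"] conjI ballI)
    show "\<Union> (range ?B) = space flat_measure"
      using real_arch_simple by (fastforce simp: dist_norm)
    fix a assume "a \<in> range ?B"
    then obtain n where a: "a = ?B n" by auto
    have "{z. base_proj z \<in> ?B n \<and> z \<in> slab} \<subseteq> cball (0::real^'n::_) (real n + 1)"
    proof clarsimp
      fix z :: "real^'n::_" assume z: "norm (base_proj z) \<le> real n" "z \<in> slab"
      have "norm z = norm (base_proj z + z $ last_index *\<^sub>R last_axis)" by (simp add: base_proj_decomp)
      also have "\<dots> \<le> real n + 1"
        using z by (intro norm_triangle_le add_mono) (auto simp: slab_def)
      finally show "norm z \<le> real n + 1" .
    qed
    then have "emeasure lborel {z. base_proj z \<in> ?B n \<and> z \<in> slab} \<le> emeasure lborel (cball (0::real^'n::_) (real n + 1))"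
      by (rule emeasure_mono) simp
    also have "\<dots> < \<infinity>" using emeasure_lborel_cball_finite by (simp add: less_top)
    finally show "emeasure flat_measure a \<noteq> \<infinity>" by (simp add: a emeasure_flat)
  qed auto
qed

text \<open>A grid of mesh \<open>2 * r / m\<close> has \<open>m ^ k\<close> cells, where
  \<open>k\<close> is the number of free coordinates, and each cell has diameter of order
  \<open>1 / m\<close>. The powers of \<open>m\<close> cancel, so one bound serves for every
  mesh.\<close>

lemma outer_base_box_finite:
  assumes r: "r > 0"
  shows "hausdorff_outer (CARD('n) - 1) {z :: real^'n::{finite,wellorder}. z \<in> base_hyperplane \<and> (\<forall>i. \<bar>z $ i\<bar> \<le> r)} < top"
proof -
  let ?k = "CARD('n) - 1"
  let ?S = "{z :: real^'n::_. z \<in> base_hyperplane \<and> (\<forall>i. \<bar>z $ i\<bar> \<le> r)}"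
  \<comment> \<open>The sum norm bounds the diameter of a cell of side \<open>2 * r / m\<close> by
    \<open>D / m\<close>.\<close>
  define D where "D = real CARD('n) * (2 * r)"
  have "hausdorff_outer ?k ?S \<le> ennreal (unit_ball_vol (real ?k) * (D / 2) ^ ?k)"
  proof (rule outer_leI)
    fix \<delta> :: real assume \<delta>: "\<delta> > 0"
    obtain m0 where m0: "D / \<delta> < real m0" using reals_Archimedean2 by blast
    define m where "m = Suc m0"
    have m: "m > 0" "D / real m \<le> \<delta>"
      using m0 \<delta> by (auto simp: m_def field_simps)
    define I where "I = (PiE (UNIV - {last_index :: 'n}) (\<lambda>_. {..<m}))"
    define Q where "Q f = {z \<in> base_hyperplane. \<forall>i. i \<noteq> last_index \<longrightarrow>
      - r + 2 * r * real (f i) / real m \<le> z $ i \<and> z $ i \<le> - r + 2 * r * (real (f i) + 1) / real m}" for f :: "'n \<Rightarrow> nat"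
    have finI: "finite I" by (auto simp: I_def intro!: finite_PiE)
    have cardI: "card I = m ^ ?k" by (simp add: I_def card_PiE)
    have dist_Q: "dist x y \<le> D / real m" if "x \<in> Q f" "y \<in> Q f" for x y f
    proof -
      have "dist x y \<le> (\<Sum>i\<in>UNIV. \<bar>(x - y) $ i\<bar>)" unfolding dist_norm by (rule norm_le_l1_cart)
      also have "\<dots> \<le> (\<Sum>i\<in>(UNIV::'n set). 2 * r / real m)"
      proof (rule sum_mono)
        fix i :: 'n
        have "- r + 2 * r * (real (f i) + 1) / real m = (- r + 2 * r * real (f i) / real m) + 2 * r / real m"
          using m by (simp add: field_simps)
        moreover have "0 \<le> 2 * r / real m" using r by simp
        ultimately show "\<bar>(x - y) $ i\<bar> \<le> 2 * r / real m"
          using that r by (cases "i = last_index") (auto simp: Q_def base_hyperplane_def abs_le_iff, (smt (verit))+)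
      qed
      also have "\<dots> = D / real m" by (simp add: D_def)
      finally show ?thesis .
    qed
    have D0: "0 \<le> D / real m" using r by (simp add: D_def)
    have diamQ: "diameter (Q f) \<le> D / real m" for f
      by (rule diameter_leI[OF D0 dist_Q])
    have bQ: "bounded (Q f)" for f
      unfolding bounded_two_points using dist_Q by blast
    have "hausdorff_premeasure ?k \<delta> ?S \<le> (\<Sum>f\<in>I. diam_weight ?k (Q f))"
    proof (rule premeasure_finite_cover[OF finI])
      show "?S \<subseteq> (\<Union>f\<in>I. Q f)"
      proof clarsimp
        fix z :: "real^'n::_" assume z: "z \<in> base_hyperplane" "\<forall>i. \<bar>z $ i\<bar> \<le> r"
        \<comment> \<open>The minimum with \<open>m - 1\<close> assigns a coordinate equal to
          \<open>r\<close> to the last cell.\<close>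
        define f where "f = restrict (\<lambda>i. min (m - 1) (nat \<lfloor>(z $ i + r) * real m / (2 * r)\<rfloor>)) (UNIV - {last_index :: 'n})"
        have "f \<in> I" using m by (auto simp: f_def I_def)
        moreover have "z \<in> Q f"
          unfolding Q_def
        proof (intro CollectI conjI allI impI z(1))
          fix i :: 'n assume i: "i \<noteq> last_index"
          define q where "q = (z $ i + r) * real m / (2 * r)"
          have zi: "- r \<le> z $ i" "z $ i \<le> r" using z(2)[rule_format, of i] by auto
          have q: "0 \<le> q" "q \<le> real m"
          proof -
            show "0 \<le> q" using zi r by (simp add: q_def)
            have "(z $ i + r) * real m \<le> (2 * r) * real m" using zi by (intro mult_right_mono) auto
            then show "q \<le> real m" using r by (simp add: q_def field_simps)
          qed
          have z_eq: "z $ i = - r + 2 * r * q / real m" using r m by (simp add: q_def field_simps)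
          have fi: "f i = min (m - 1) (nat \<lfloor>q\<rfloor>)" using i by (simp add: f_def q_def)
          have "real (f i) \<le> real (nat \<lfloor>q\<rfloor>)" by (simp add: fi)
          also have "\<dots> \<le> q" using q by simp
          finally have 1: "real (f i) \<le> q" .
          have 2: "q \<le> real (f i) + 1"
          proof (cases "nat \<lfloor>q\<rfloor> \<le> m - 1")
            case True
            then show ?thesis using q by (simp add: fi min_def)
          next
            case False
            then show ?thesis using q m by (simp add: fi min_def of_nat_diff)
          qed
          show "- r + 2 * r * real (f i) / real m \<le> z $ i" "z $ i \<le> - r + 2 * r * (real (f i) + 1) / real m"
            unfolding z_eq using 1 2 r m by (auto intro!: divide_right_mono mult_left_mono)
        qed
        ultimately show "\<exists>f\<in>I. z \<in> Q f" by blast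
      qed
    qed (use \<delta> bQ diamQ m in \<open>auto intro: order_trans\<close>)
    also have "\<dots> \<le> (\<Sum>f\<in>I. ennreal (unit_ball_vol (real ?k) * (D / real m / 2) ^ ?k))"
    proof (rule sum_mono)
      fix f
      show "diam_weight ?k (Q f) \<le> ennreal (unit_ball_vol (real ?k) * (D / real m / 2) ^ ?k)"
        using diamQ[of f] diameter_ge_0[OF bQ[of f]]
        by (auto simp: diam_weight_def intro!: ennreal_leI mult_left_mono power_mono)
    qed
    also have "\<dots> = ennreal (real (m ^ ?k) * (unit_ball_vol (real ?k) * (D / real m / 2) ^ ?k))"
      using D0 by (simp add: cardI ennreal_of_nat_eq_real_of_nat ennreal_mult'[symmetric] del: of_nat_power)
    also have "real (m ^ ?k) * (unit_ball_vol (real ?k) * (D / real m / 2) ^ ?k) = unit_ball_vol (real ?k) * (D / 2) ^ ?k"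
      using m by (simp add: power_divide)
    finally show "hausdorff_premeasure ?k \<delta> ?S \<le> ennreal (unit_ball_vol (real ?k) * (D / 2) ^ ?k)" .
  qed
  then show ?thesis using ennreal_less_top le_less_trans by blast
qed


lemma outer_translate: "hausdorff_outer k ((\<lambda>x. x + c) ` A) = hausdorff_outer k (A :: 'a::euclidean_space set)"
  by (rule outer_isometry_image) simp

lemma outer_base_cball_finite:
  "hausdorff_outer (CARD('n) - 1) (base_hyperplane \<inter> cball (0 :: real^'n::{finite,wellorder}) r) < top"
proof -
  let ?S = "{z :: real^'n::_. z \<in> base_hyperplane \<and> (\<forall>i. \<bar>z $ i\<bar> \<le> \<bar>r\<bar> + 1)}"
  have "base_hyperplane \<inter> cball (0 :: real^'n::_) r \<subseteq> ?S"
    using component_le_norm_cart by (fastforce simp: dist_norm intro: order_trans)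
  then have "hausdorff_outer (CARD('n) - 1) (base_hyperplane \<inter> cball (0 :: real^'n::_) r) \<le> hausdorff_outer (CARD('n) - 1) ?S"
    by (rule outer_mono)
  also have "\<dots> < top" by (rule outer_base_box_finite) simp
  finally show ?thesis .
qed

abbreviation base_hausdorff :: "(real^'n::{finite,wellorder}) measure" where
  "base_hausdorff \<equiv> hausdorff_on (CARD('n) - 1) base_hyperplane"

text \<open>Permits the exchange of integrals in the uniqueness argument below.\<close>

lemma sigma_finite_base_hausdorff: "sigma_finite_measure (base_hausdorff :: (real^'n::{finite,wellorder}) measure)"
proof
  let ?B = "\<lambda>n::nat. cball 0 (real n) :: (real^'n::_) set"
  show "\<exists>A. countable A \<and> A \<subseteq> sets (base_hausdorff :: (real^'n::_) measure) \<and> \<Union> A = space base_hausdorff \<and>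
      (\<forall>a\<in>A. emeasure base_hausdorff a \<noteq> \<infinity>)"
  proof (intro exI[of _ "range ?B"] conjI ballI)
    show "\<Union> (range ?B) = space base_hausdorff"
      using real_arch_simple by (fastforce simp: dist_norm)
    fix a assume "a \<in> range ?B"
    then obtain n where a: "a = ?B n" by auto
    show "emeasure base_hausdorff a \<noteq> \<infinity>"
      using outer_base_cball_finite[where 'n = 'n, of n] by (simp add: a emeasure_hausdorff_on less_top)
  qed auto
qed

lemma nn_integral_base_hausdorff_translate:
  fixes f :: "real^'n::{finite,wellorder} \<Rightarrow> ennreal"
  assumes [measurable]: "f \<in> borel_measurable borel" and c: "c \<in> base_hyperplane"
  shows "(\<integral>\<^sup>+u. f (u + c) \<partial>base_hausdorff) = (\<integral>\<^sup>+u. f u \<partial>base_hausdorff)"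
proof -
  have "distr base_hausdorff borel (\<lambda>u. u + c) = (base_hausdorff :: (real^'n::_) measure)"
  proof (rule measure_eqI)
    fix E :: "(real^'n::_) set" assume "E \<in> sets (distr base_hausdorff borel (\<lambda>u. u + c))"
    then have E[measurable]: "E \<in> sets borel" by simp
    have vim: "(\<lambda>u. u + c) -` E \<in> sets borel"
      using measurable_sets[of "\<lambda>u. u + c" borel borel E] E by simp
    have "emeasure (distr base_hausdorff borel (\<lambda>u. u + c)) E = hausdorff_outer (CARD('n) - 1) (base_hyperplane \<inter> (\<lambda>u. u + c) -` E)"
      using vim by (subst emeasure_distr) (auto simp: emeasure_hausdorff_on)
    also have "\<dots> = hausdorff_outer (CARD('n) - 1) ((\<lambda>u. u + c) ` (base_hyperplane \<inter> (\<lambda>u. u + c) -` E))"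
      by (rule outer_translate[symmetric])
    also have "(\<lambda>u. u + c) ` (base_hyperplane \<inter> (\<lambda>u. u + c) -` E) = base_hyperplane \<inter> E"
    proof (intro equalityI subsetI)
      fix x assume "x \<in> base_hyperplane \<inter> E"
      then have "x - c \<in> base_hyperplane \<inter> (\<lambda>u. u + c) -` E" using c by (auto simp: base_hyperplane_def)
      then show "x \<in> (\<lambda>u. u + c) ` (base_hyperplane \<inter> (\<lambda>u. u + c) -` E)"
        by (intro image_eqI[of _ _ "x - c"]) auto
    qed (use c in \<open>auto simp: base_hyperplane_def\<close>)
    finally show "emeasure (distr base_hausdorff borel (\<lambda>u. u + c)) E = emeasure base_hausdorff E"
      by (simp add: emeasure_hausdorff_on)
  qed simp
  then have "(\<integral>\<^sup>+u. f u \<partial>base_hausdorff) = (\<integral>\<^sup>+u. f u \<partial>distr base_hausdorff borel (\<lambda>u. u + c))" by simp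
  also have "\<dots> = (\<integral>\<^sup>+u. f (u + c) \<partial>base_hausdorff)"
    by (subst nn_integral_distr) auto
  finally show ?thesis by simp
qed

lemma AE_base_hausdorff: "AE u in base_hausdorff. u \<in> base_hyperplane"
  unfolding hausdorff_on_def by (subst AE_density) (auto split: split_indicator)

text \<open>The constant by which the normalised Hausdorff measure differs from Lebesgue measure on a
  hyperplane. Its value (which is one) is an isodiametric statement and is never needed.\<close>

definition flat_const :: "'n::{finite,wellorder} itself \<Rightarrow> ennreal" where
  "flat_const _ = hausdorff_outer (CARD('n) - 1) {z :: real^'n::_. z \<in> base_hyperplane \<and> (\<forall>i. -1 \<le> z $ i \<and> z $ i \<le> 0)}"

text \<open>Uniqueness of translation invariant measures, by evaluating
  \<open>\<integral>\<integral> 1\<^sub>E(x) 1\<^sub>Q(y - x) d\<lambda>(y) d\<mu>(x)\<close> in both orders.\<close>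

lemma base_hausdorff_eq:
  fixes E :: "(real^'n::{finite,wellorder}) set"
  assumes E[measurable]: "E \<in> sets borel" and sub: "E \<subseteq> base_hyperplane"
  shows "hausdorff_outer (CARD('n) - 1) E = flat_const TYPE('n) * emeasure flat_measure E"
proof -
  let ?\<mu> = "base_hausdorff :: (real^'n::_) measure" and ?\<nu> = "flat_measure :: (real^'n::_) measure"
  define Q :: "(real^'n::_) set" where "Q = {z. z \<in> base_hyperplane \<and> (\<forall>i. 0 \<le> z $ i \<and> z $ i \<le> 1)}"
  have [measurable]: "Q \<in> sets borel"
  proof -
    have "Q = base_hyperplane \<inter> cbox 0 1" by (auto simp: Q_def mem_box_cart)
    then show ?thesis by simp
  qed
  interpret \<mu>: sigma_finite_measure ?\<mu> by (rule sigma_finite_base_hausdorff)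
  interpret \<nu>: sigma_finite_measure ?\<nu> by (rule sigma_finite_flat)
  interpret pair_sigma_finite ?\<mu> ?\<nu> ..
  \<comment> \<open>The slab over the unit cube of the hyperplane is the unit cube of the whole
    space.\<close>
  have Q1: "emeasure ?\<nu> Q = 1"
  proof -
    have "{z::real^'n::_. base_proj z \<in> Q \<and> z \<in> slab} = cbox 0 1"
    proof (intro equalityI subsetI)
      fix z :: "real^'n::_" assume z: "z \<in> {z. base_proj z \<in> Q \<and> z \<in> slab}"
      have "0 \<le> z $ i \<and> z $ i \<le> 1" for i
        using z by (cases "i = last_index") (auto simp: Q_def slab_def base_proj_def dest!: spec[of _ i])
      then show "z \<in> cbox 0 1" by (auto simp: mem_box_cart)
    qed (auto simp: mem_box_cart Q_def slab_def, auto simp: base_proj_def)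
    moreover have "emeasure lborel (cbox 0 1 :: (real^'n::_) set) = 1"
    proof -
      have "(1 :: real^'n::_) \<bullet> b = 1" if "b \<in> Basis" for b
        using that by (auto simp: Basis_vec_def inner_axis)
      then show ?thesis by (simp add: emeasure_lborel_cbox_eq)
    qed
    ultimately show ?thesis by (simp add: emeasure_flat)
  qed
  have "hausdorff_outer (CARD('n) - 1) E = emeasure ?\<mu> E"
    using sub by (simp add: emeasure_hausdorff_on Int_absorb1)
  also have "\<dots> = (\<integral>\<^sup>+x. indicator E x * emeasure ?\<nu> Q \<partial>?\<mu>)"
    by (simp add: Q1)
  also have "\<dots> = (\<integral>\<^sup>+x. \<integral>\<^sup>+y. indicator E x * indicator Q (y - x) \<partial>?\<nu> \<partial>?\<mu>)"
  proof (rule nn_integral_cong_AE)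
    show "AE x in ?\<mu>. indicator E x * emeasure ?\<nu> Q = (\<integral>\<^sup>+y. indicator E x * indicator Q (y - x) \<partial>?\<nu>)"
      using AE_base_hausdorff
    proof eventually_elim
      fix x :: "real^'n::_" assume "x \<in> base_hyperplane"
      then have "- x \<in> base_hyperplane" by (simp add: base_hyperplane_def)
      from nn_integral_flat_translate[OF _ this, of "indicator Q"]
      have "(\<integral>\<^sup>+y. indicator Q (y - x) \<partial>?\<nu>) = emeasure ?\<nu> Q" by simp
      then show "indicator E x * emeasure ?\<nu> Q = (\<integral>\<^sup>+y. indicator E x * indicator Q (y - x) \<partial>?\<nu>)"
        by (subst nn_integral_cmult) auto
    qed
  qed
  also have "\<dots> = (\<integral>\<^sup>+y. \<integral>\<^sup>+x. indicator E x * indicator Q (y - x) \<partial>?\<mu> \<partial>?\<nu>)"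
    by (rule Fubini'[symmetric]) measurable
  also have "\<dots> = (\<integral>\<^sup>+y. \<integral>\<^sup>+x. indicator E (x + y) * indicator Q (- x) \<partial>?\<mu> \<partial>?\<nu>)"
  proof (rule nn_integral_cong_AE)
    show "AE y in ?\<nu>. (\<integral>\<^sup>+x. indicator E x * indicator Q (y - x) \<partial>?\<mu>) = (\<integral>\<^sup>+x. indicator E (x + y) * indicator Q (- x) \<partial>?\<mu>)"
      using AE_flat_base
    proof eventually_elim
      fix y :: "real^'n::_" assume y: "y \<in> base_hyperplane"
      have "(\<lambda>x. indicator E x * indicator Q (y - x) :: ennreal) \<in> borel_measurable borel" by measurable
      from nn_integral_base_hausdorff_translate[OF this y]
      show "(\<integral>\<^sup>+x. indicator E x * indicator Q (y - x) \<partial>?\<mu>) = (\<integral>\<^sup>+x. indicator E (x + y) * indicator Q (- x) \<partial>?\<mu>)"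
        by simp
    qed
  qed
  also have "\<dots> = (\<integral>\<^sup>+x. \<integral>\<^sup>+y. indicator E (x + y) * indicator Q (- x) \<partial>?\<nu> \<partial>?\<mu>)"
    by (rule Fubini') measurable
  also have "\<dots> = (\<integral>\<^sup>+x. emeasure ?\<nu> E * indicator Q (- x) \<partial>?\<mu>)"
  proof (rule nn_integral_cong_AE)
    show "AE x in ?\<mu>. (\<integral>\<^sup>+y. indicator E (x + y) * indicator Q (- x) \<partial>?\<nu>) = emeasure ?\<nu> E * indicator Q (- x)"
      using AE_base_hausdorff
    proof eventually_elim
      fix x :: "real^'n::_" assume "x \<in> base_hyperplane"
      from nn_integral_flat_translate[OF _ this, of "indicator E"]
      have "(\<integral>\<^sup>+y. indicator E (x + y) \<partial>?\<nu>) = emeasure ?\<nu> E" by (simp add: add.commute)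
      then show "(\<integral>\<^sup>+y. indicator E (x + y) * indicator Q (- x) \<partial>?\<nu>) = emeasure ?\<nu> E * indicator Q (- x)"
        by (subst nn_integral_multc) auto
    qed
  qed
  also have "\<dots> = emeasure ?\<nu> E * (\<integral>\<^sup>+x. indicator Q (- x) \<partial>?\<mu>)"
    by (rule nn_integral_cmult) measurable
  also have "(\<integral>\<^sup>+x. indicator Q (- x) \<partial>?\<mu>) = (\<integral>\<^sup>+x. indicator (uminus -` Q) x \<partial>?\<mu>)"
    by (intro nn_integral_cong) (auto simp: indicator_def)
  \<comment> \<open>Substituting \<open>x + y\<close> for \<open>x\<close> has reflected the cube;
    this is why \<open>flat_const\<close> is defined with the cube from -1 to 0.\<close>
  also have "\<dots> = flat_const TYPE('n)"
  proof -
    have "uminus -` Q = {z :: real^'n::_. z \<in> base_hyperplane \<and> (\<forall>i. -1 \<le> z $ i \<and> z $ i \<le> 0)}" (is "_ = ?Q'")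
      by (auto simp: Q_def base_hyperplane_def)
    moreover have "uminus -` Q \<in> sets (borel :: (real^'n::_) measure)"
      using measurable_sets[of uminus "borel :: (real^'n::_) measure" borel Q] by simp
    moreover have "base_hyperplane \<inter> ?Q' = ?Q'" by auto
    ultimately show ?thesis
      by (subst nn_integral_indicator) (auto simp: emeasure_hausdorff_on flat_const_def)
  qed
  finally show ?thesis by (simp add: mult.commute)
qed

subsection \<open>Linear maps on the base hyperplane\<close>

text \<open>The change of variables formula for finite volumes, extended to the value infinity: the
  image has finite volume if and only if the integral is finite, so infinite values also occur
  together.\<close>

lemma emeasure_differentiable_image:
  fixes f :: "real^'n::{finite,wellorder} \<Rightarrow> real^'n::_"
  assumes S: "S \<in> sets lebesgue"
    and der: "\<And>x. x \<in> S \<Longrightarrow> (f has_derivative f' x) (at x within S)"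
    and inj: "inj_on f S"
  shows "emeasure lebesgue (f ` S) = (\<integral>\<^sup>+x. ennreal \<bar>det (matrix (f' x))\<bar> * indicator S x \<partial>lebesgue)"
proof -
  define g where "g x = (if x \<in> S then \<bar>det (matrix (f' x))\<bar> else 0)" for x
  have fS: "f ` S \<in> sets lebesgue"
    using S der by (intro differentiable_image_in_sets_lebesgue)
      (auto simp: differentiable_on_def differentiable_def)
  have "(\<lambda>x. \<bar>det (matrix (f' x))\<bar>) \<in> borel_measurable (lebesgue_on S)"
    using borel_measurable_det_Jacobian[OF S der] by measurable
  then have g: "g \<in> borel_measurable lebesgue"
    using S unfolding g_def by (subst borel_measurable_if) auto
  have iff: "f ` S \<in> lmeasurable \<and> measure lebesgue (f ` S) = r \<longleftrightarrow> integral\<^sup>N lebesgue g = ennreal r" if "r \<ge> 0" for r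
  proof -
    have "f ` S \<in> lmeasurable \<and> measure lebesgue (f ` S) = r \<longleftrightarrow> ((\<lambda>x. \<bar>det (matrix (f' x))\<bar>) has_integral r) S"
      by (rule has_measure_differentiable_image[OF S der inj])
    also have "\<dots> \<longleftrightarrow> (g has_integral r) UNIV"
      unfolding g_def by (rule has_integral_restrict_UNIV[symmetric])
    also have "\<dots> \<longleftrightarrow> integral\<^sup>N lebesgue g = ennreal r"
      using g that by (subst has_integral_iff_nn_integral_lebesgue) (auto simp: g_def)
    finally show ?thesis .
  qed
  have "emeasure lebesgue (f ` S) = integral\<^sup>N lebesgue g"
  proof (cases "integral\<^sup>N lebesgue g" rule: ennreal_cases)
    case (real r)
    then have "f ` S \<in> lmeasurable" "measure lebesgue (f ` S) = r" using iff[of r] by auto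
    then show ?thesis using real by (simp add: emeasure_eq_measure2)
  next
    case top
    have "f ` S \<notin> lmeasurable"
    proof
      assume "f ` S \<in> lmeasurable"
      then have "integral\<^sup>N lebesgue g = ennreal (measure lebesgue (f ` S))"
        using iff[of "measure lebesgue (f ` S)"] by auto
      then show False using top by simp
    qed
    then have "emeasure lebesgue (f ` S) = top"
      using fS by (auto simp: fmeasurable_def less_top[symmetric])
    then show ?thesis using top by simp
  qed
  also have "\<dots> = (\<integral>\<^sup>+x. ennreal \<bar>det (matrix (f' x))\<bar> * indicator S x \<partial>lebesgue)"
    by (intro nn_integral_cong) (auto simp: g_def)
  finally show ?thesis .
qed

text \<open>The derivative of a parametrization acts on the base hyperplane only. Sending the last
  axis to a further vector \<open>v\<close> completes it to a square matrix, whose determinant is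
  the signed volume spanned by the tangent vectors and \<open>v\<close>.\<close>

definition extend_map :: "(real^'n::{finite,wellorder} \<Rightarrow> real^'n::_) \<Rightarrow> real^'n::_ \<Rightarrow> real^'n::_ \<Rightarrow> real^'n::_" where
  "extend_map A v h = A (base_proj h) + (h $ last_index) *\<^sub>R v"

text \<open>The generalised cross product of the columns of \<open>A\<close>.\<close>

definition surface_normal :: "(real^'n::{finite,wellorder} \<Rightarrow> real^'n::_) \<Rightarrow> real^'n::_" where
  "surface_normal A = (\<chi> i. det (matrix (extend_map A (axis i 1))))"

lemma linear_extend_map: "linear A \<Longrightarrow> linear (extend_map A v)"
  by (rule linearI)
    (auto simp: extend_map_def base_proj_add base_proj_scaleR linear_add linear_scale algebra_simps)

lemma extend_map_base: "u \<in> base_hyperplane \<Longrightarrow> extend_map A v u = A u"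
  by (simp add: extend_map_def base_proj_base) (simp add: base_hyperplane_def)

lemma extend_map_last_axis: "linear A \<Longrightarrow> extend_map A v last_axis = v"
  unfolding extend_map_def base_proj_last_axis by (simp add: linear_0)

lemma det_extend_map_rows:
  fixes A :: "real^'n::{finite,wellorder} \<Rightarrow> real^'n::_"
  assumes "linear A"
  shows "det (matrix (extend_map A v)) = det (\<chi> j. if j = last_index then v else A (axis j 1))"
proof -
  have "transpose (matrix (extend_map A v)) = (\<chi> j. if j = last_index then v else A (axis j 1))"
  proof -
    have "extend_map A v (axis j 1) = (if j = last_index then v else A (axis j 1))" for j
    proof (cases "j = last_index")
      case False
      then have "(axis j 1 :: real^'n::_) \<in> base_hyperplane" by (simp add: base_hyperplane_def axis_def)
      with False show ?thesis by (simp add: extend_map_base)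
    qed (use assms in \<open>simp add: extend_map_last_axis\<close>)
    then show ?thesis by (auto simp: vec_eq_iff transpose_def matrix_def)
  qed
  then show ?thesis using det_transpose[of "matrix (extend_map A v)"] by simp
qed

text \<open>The determinant is linear in the row that carries \<open>v\<close>, so expanding
  \<open>v\<close> in the coordinate basis gives an inner product.\<close>

lemma det_extend_map:
  fixes A :: "real^'n::{finite,wellorder} \<Rightarrow> real^'n::_"
  assumes A: "linear A"
  shows "det (matrix (extend_map A v)) = surface_normal A \<bullet> v"
proof -
  let ?D = "\<lambda>v. det (\<chi> j. if j = last_index then v else A (axis j 1))"
  have "?D v = ?D (\<Sum>i\<in>UNIV. (v $ i) *s axis i 1)" by (rule arg_cong[where f = ?D, OF basis_expansion[symmetric]])
  also have "\<dots> = (\<Sum>i\<in>UNIV. ?D ((v $ i) *s axis i 1))" by (rule det_linear_row_sum) simp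
  also have "\<dots> = (\<Sum>i\<in>UNIV. v $ i * ?D (axis i 1))" by (intro sum.cong refl det_row_mul)
  also have "\<dots> = surface_normal A \<bullet> v"
    by (simp add: surface_normal_def inner_vec_def det_extend_map_rows[OF A] mult.commute)
  finally show ?thesis by (simp add: det_extend_map_rows[OF A])
qed

text \<open>Completing by a vector of the image makes the matrix singular:
  \<open>last_axis - u\<close> lies in its kernel.\<close>

lemma surface_normal_orthogonal:
  assumes A: "linear A" and u: "u \<in> base_hyperplane"
  shows "surface_normal A \<bullet> A u = 0"
proof -
  have "extend_map A (A u) (last_axis - u) = 0"
    using u by (simp add: linear_diff[OF linear_extend_map[OF A]] extend_map_last_axis[OF A] extend_map_base)
  moreover have "last_axis - u \<noteq> 0"
  proof
    assume "last_axis - u = 0"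
    then have "u $ last_index = 1" by (auto simp: vec_eq_iff axis_def split: if_splits)
    then show False using u by (simp add: base_hyperplane_def)
  qed
  ultimately have "\<not> inj (extend_map A (A u))"
    using linear_injective_0[OF linear_extend_map[OF A]] by blast
  then have "det (matrix (extend_map A (A u))) = 0"
    using det_nz_iff_inj[OF linear_extend_map[OF A]] by blast
  then show ?thesis by (simp add: det_extend_map[OF A])
qed

lemma dim_base: "dim (base_hyperplane :: (real^'n::{finite,wellorder}) set) < CARD('n)"
proof -
  have "(last_axis :: real^'n::_) \<notin> base_hyperplane" by (simp add: base_hyperplane_def axis_def)
  moreover have "span base_hyperplane = (base_hyperplane :: (real^'n::_) set)"
    using subspace_base span_eq_iff by blast
  ultimately have "dim (base_hyperplane :: (real^'n::_) set) \<noteq> DIM(real^'n::_)"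
    using dim_eq_full[of "base_hyperplane :: (real^'n::_) set"] by (metis UNIV_I)
  then show ?thesis using dim_subset_UNIV[of "base_hyperplane :: (real^'n::_) set"] by simp
qed

lemma inj_extend_map:
  assumes A: "linear A" "inj_on A base_hyperplane" and v: "\<And>u. u \<in> base_hyperplane \<Longrightarrow> v \<bullet> A u = 0" "v \<noteq> 0"
  shows "inj (extend_map A v)"
  unfolding linear_injective_0[OF linear_extend_map[OF A(1)]]
proof (intro allI impI)
  fix h assume h: "extend_map A v h = 0"
  have "0 = v \<bullet> extend_map A v h" using h by simp
  also have "\<dots> = h $ last_index * (v \<bullet> v)"
    by (simp add: extend_map_def inner_add_right v(1))
  finally have h0: "h $ last_index = 0" using v(2) by simp
  then have "A (base_proj h) = A 0" using h A(1) by (simp add: extend_map_def linear_0)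
  then have "base_proj h = 0"
    using A(2) by (metis base_proj_in_base inj_onD subspace_0 subspace_base)
  then show "h = 0" using h0 base_proj_decomp[of h] by simp
qed

lemma orthogonal_vector_exists:
  fixes A :: "real^'n::{finite,wellorder} \<Rightarrow> real^'n::_"
  assumes A: "linear A"
  obtains v where "norm v = 1" "\<And>u. u \<in> base_hyperplane \<Longrightarrow> v \<bullet> A u = 0"
proof -
  have "dim (A ` base_hyperplane) \<le> dim (base_hyperplane :: (real^'n::_) set)"
    using A by (rule dim_image_le)
  then have "dim (A ` base_hyperplane) < DIM(real^'n::_)" using dim_base[where 'n = 'n] by simp
  then obtain x where x: "x \<noteq> 0" "\<And>y. y \<in> span (A ` base_hyperplane) \<Longrightarrow> orthogonal x y"
    using orthogonal_to_subspace_exists by blast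
  show ?thesis
  proof (rule that[of "x /\<^sub>R norm x"])
    show "norm (x /\<^sub>R norm x) = 1" using x by simp
    fix u :: "real^'n::_" assume "u \<in> base_hyperplane"
    then have "orthogonal x (A u)" by (intro x(2) span_base) auto
    then show "(x /\<^sub>R norm x) \<bullet> A u = 0" by (simp add: orthogonal_def)
  qed
qed

lemma surface_normal_nonzero:
  assumes A: "linear A" "inj_on A base_hyperplane"
  shows "surface_normal A \<noteq> 0"
proof -
  obtain v where v: "norm v = 1" "\<And>u. u \<in> base_hyperplane \<Longrightarrow> v \<bullet> A u = 0"
    using orthogonal_vector_exists[OF A(1)] by blast
  then have "inj (extend_map A v)" using inj_extend_map[OF A v(2)] by (metis norm_zero zero_neq_one)
  then have "det (matrix (extend_map A v)) \<noteq> 0"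
    using det_nz_iff_inj[OF linear_extend_map[OF A(1)]] by blast
  then show ?thesis by (auto simp: det_extend_map[OF A(1)])
qed

text \<open>The map completed by \<open>v\<close> is onto, so the cross product is the sum of a
  tangential vector and a multiple of \<open>v\<close>. Being orthogonal to all tangent vectors, its
  tangential part is orthogonal to itself. The vector \<open>v\<close> is fixed only up to sign,
  hence the absolute value.\<close>

lemma surface_normal_parallel:
  assumes A: "linear A" "inj_on A base_hyperplane"
    and v: "norm v = 1" "\<And>u. u \<in> base_hyperplane \<Longrightarrow> v \<bullet> A u = 0"
  shows "surface_normal A = (surface_normal A \<bullet> v) *\<^sub>R v" "\<bar>surface_normal A \<bullet> v\<bar> = norm (surface_normal A)"
proof -
  have "inj (extend_map A v)" using inj_extend_map[OF A v(2)] v(1) by (metis norm_zero zero_neq_one)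
  then have "surj (extend_map A v)"
    using linear_injective_imp_surjective[OF linear_extend_map[OF A(1)]] by blast
  then obtain h where h: "extend_map A v h = surface_normal A" by (metis surjD)
  have vv: "v \<bullet> v = 1" using v(1) by (simp add: norm_eq_1)
  define s where "s = h $ last_index"
  have eq: "surface_normal A = A (base_proj h) + s *\<^sub>R v" using h by (simp add: extend_map_def s_def)
  have "surface_normal A \<bullet> v = s"
    by (subst eq) (simp add: inner_add_left vv inner_commute[of "A _"] v(2))
  moreover have "A (base_proj h) \<bullet> A (base_proj h) = 0"
  proof -
    have "surface_normal A \<bullet> A (base_proj h) = 0" by (rule surface_normal_orthogonal[OF A(1)]) simp
    then show ?thesis by (subst (asm) eq) (simp add: inner_add_left v(2))
  qed
  ultimately show par: "surface_normal A = (surface_normal A \<bullet> v) *\<^sub>R v" using eq by simp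
  show "\<bar>surface_normal A \<bullet> v\<bar> = norm (surface_normal A)"
    by (subst (2) par) (simp add: v(1))
qed

text \<open>Only the directions of the base hyperplane are scaled, by a diagonal matrix whose last
  entry is one. In the sweep of a chart the factor \<open>c\<close> is
  \<open>a + b * t\<close>.\<close>

lemma det_extend_map_scale:
  fixes A :: "real^'n::{finite,wellorder} \<Rightarrow> real^'n::_"
  assumes A: "linear A"
  shows "det (matrix (extend_map (\<lambda>h. c *\<^sub>R A h) v)) = c ^ (CARD('n) - 1) * det (matrix (extend_map A v))"
proof -
  define D where "D h = c *\<^sub>R base_proj h + (h $ last_index) *\<^sub>R last_axis" for h :: "real^'n::_"
  have D: "linear D"
    by (rule linearI) (auto simp: D_def base_proj_add base_proj_scaleR algebra_simps)
  have "extend_map (\<lambda>h. c *\<^sub>R A h) v = extend_map A v \<circ> D"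
  proof
    fix h
    have "extend_map A v (D h) = c *\<^sub>R extend_map A v (base_proj h) + (h $ last_index) *\<^sub>R extend_map A v last_axis"
      unfolding D_def by (simp only: linear_add[OF linear_extend_map[OF A]] linear_scale[OF linear_extend_map[OF A]])
    then show "extend_map (\<lambda>h. c *\<^sub>R A h) v h = (extend_map A v \<circ> D) h"
      by (simp add: extend_map_last_axis[OF A] extend_map_base) (simp add: extend_map_def)
  qed
  then have "matrix (extend_map (\<lambda>h. c *\<^sub>R A h) v) = matrix (extend_map A v) ** matrix D"
    using matrix_compose[OF D linear_extend_map[OF A]] by simp
  moreover have "det (matrix D) = c ^ (CARD('n) - 1)"
  proof -
    have "det (matrix D) = (\<Prod>i\<in>UNIV. matrix D $ i $ i)"
      by (rule det_diagonal) (auto simp: matrix_def D_def base_proj_def axis_def)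
    also have "\<dots> = (\<Prod>i\<in>(UNIV :: 'n set). if i = last_index then 1 else c)"
      by (intro prod.cong refl) (auto simp: matrix_def D_def base_proj_def axis_def)
    also have "\<dots> = c ^ (CARD('n) - 1)"
      by (subst prod.remove[of _ last_index]) (auto simp: card_Diff_singleton)
    finally show ?thesis .
  qed
  ultimately show ?thesis by (simp add: det_mul)
qed

text \<open>A rotation \<open>T\<close> brings the image of \<open>A\<close> back to the base
  hyperplane. The completed map \<open>M\<close> then fixes the last axis, so it maps the slab over
  \<open>E\<close> onto the slab over the image of \<open>E\<close>; areas are multiplied by the
  absolute determinant of \<open>M\<close>, which is the length of the cross product.\<close>

lemma outer_linear_image:
  fixes A :: "real^'n::{finite,wellorder} \<Rightarrow> real^'n::_"
  assumes A: "linear A" "inj_on A base_hyperplane" and E: "E \<in> sets borel" "E \<subseteq> base_hyperplane"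
  shows "hausdorff_outer (CARD('n) - 1) (A ` E) =
    flat_const TYPE('n) * (ennreal (norm (surface_normal A)) * emeasure flat_measure E)"
proof -
  define \<nu> where "\<nu> = surface_normal A /\<^sub>R norm (surface_normal A)"
  have N0: "surface_normal A \<noteq> 0" by (rule surface_normal_nonzero[OF A])
  then have n\<nu>: "norm \<nu> = 1" by (simp add: \<nu>_def)
  have \<nu>A: "\<nu> \<bullet> A u = 0" if "u \<in> base_hyperplane" for u
    using surface_normal_orthogonal[OF A(1) that] by (simp add: \<nu>_def)
  have "norm \<nu> = norm (last_axis :: real^'n::_)" unfolding n\<nu> by simp
  then obtain T :: "real^'n::_ \<Rightarrow> real^'n::_" where T: "orthogonal_transformation T" "T \<nu> = last_axis"
    by (rule orthogonal_transformation_exists) (rule that)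
  have linT: "linear T" using T(1) by (rule orthogonal_transformation_linear)
  define M where "M = T \<circ> extend_map A \<nu>"
  have linM: "linear M"
    unfolding M_def by (rule linear_compose[OF linear_extend_map[OF A(1)] linT])
  have inj_ext: "inj (extend_map A \<nu>)" using inj_extend_map[OF A \<nu>A] n\<nu> by (metis norm_zero zero_neq_one)
  have injM: "inj M"
    unfolding M_def using orthogonal_transformation_inj[OF T(1)] inj_ext by (rule inj_compose)
  have detM: "\<bar>det (matrix M)\<bar> = norm (surface_normal A)"
  proof -
    have "det (matrix M) = det (matrix T) * det (matrix (extend_map A \<nu>))"
      unfolding M_def by (simp add: matrix_compose[OF linear_extend_map[OF A(1)] linT] det_mul)
    then have "\<bar>det (matrix M)\<bar> = \<bar>surface_normal A \<bullet> \<nu>\<bar>"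
      using T(1) by (simp add: abs_mult det_extend_map[OF A(1)])
    also have "\<dots> = norm (surface_normal A)" by (rule surface_normal_parallel(2)[OF A n\<nu> \<nu>A])
    finally show ?thesis .
  qed
  have Me: "M last_axis = last_axis" by (simp add: M_def extend_map_last_axis[OF A(1)] T(2))
  have Mb: "M u \<in> base_hyperplane" if "u \<in> base_hyperplane" for u
  proof -
    have "M u $ last_index = T \<nu> \<bullet> T (A u)"
      by (simp add: T(2) M_def extend_map_base[OF that] inner_axis' )
    also have "\<dots> = \<nu> \<bullet> A u" using T(1) by (simp add: orthogonal_transformation_def)
    also have "\<dots> = 0" by (rule \<nu>A[OF that])
    finally show ?thesis by (simp add: base_hyperplane_def)
  qed
  have M_decomp: "M z = M (base_proj z) + (z $ last_index) *\<^sub>R last_axis" for z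
  proof -
    have "M z = M (base_proj z + (z $ last_index) *\<^sub>R last_axis)" by (simp only: base_proj_decomp)
    also have "\<dots> = M (base_proj z) + (z $ last_index) *\<^sub>R M last_axis"
      by (simp only: linear_add[OF linM] linear_scale[OF linM])
    finally show ?thesis by (simp only: Me)
  qed
  have Mz: "base_proj (M z) = M (base_proj z)" "M z $ last_index = z $ last_index" for z
  proof -
    have Mb': "M (base_proj z) \<in> base_hyperplane" by (rule Mb) simp
    show "base_proj (M z) = M (base_proj z)"
      by (subst M_decomp) (simp add: base_proj_add base_proj_scaleR base_proj_base[OF Mb'])
    show "M z $ last_index = z $ last_index"
      by (subst M_decomp) (use Mb' in \<open>simp add: base_hyperplane_def axis_def\<close>)
  qed
  have S: "{z. base_proj z \<in> E \<and> z \<in> slab} \<in> sets borel" using E(1) by measurable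
  obtain M' where M': "linear M'" "\<And>x. M' (M x) = x" "\<And>x. M (M' x) = x"
    using linear_injective_isomorphism[OF linM injM] by blast
  have M'meas: "M' \<in> borel_measurable borel"
    using M'(1) by (intro borel_measurable_continuous_onI linear_continuous_on) (simp add: linear_conv_bounded_linear)
  have img: "M ` X = M' -` X" for X using M' by (auto simp: image_iff) (metis)+
  have ME: "M ` E \<in> sets borel"
    unfolding img using measurable_sets[OF M'meas E(1)] by simp
  have "hausdorff_outer (CARD('n) - 1) (A ` E) = hausdorff_outer (CARD('n) - 1) (T ` A ` E)"
    using T(1) by (intro outer_isometry_image[symmetric])
      (simp add: dist_norm linear_diff[OF linT, symmetric] orthogonal_transformation_norm)
  also have "T ` A ` E = M ` E"
    using E(2) by (auto simp: M_def image_image extend_map_base subset_iff intro!: image_cong)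
  also have "hausdorff_outer (CARD('n) - 1) (M ` E) = flat_const TYPE('n) * emeasure flat_measure (M ` E)"
    using ME Mb E(2) by (intro base_hausdorff_eq) auto
  also have "emeasure flat_measure (M ` E) = emeasure lborel {z. base_proj z \<in> M ` E \<and> z \<in> slab}"
    using ME by (rule emeasure_flat)
  also have "{z. base_proj z \<in> M ` E \<and> z \<in> slab} = M ` {z. base_proj z \<in> E \<and> z \<in> slab}" (is "_ = M ` ?S")
  proof (intro equalityI subsetI)
    fix z assume z: "z \<in> {z. base_proj z \<in> M ` E \<and> z \<in> slab}"
    define y where "y = M' z"
    have zy: "z = M y" by (simp add: y_def M')
    then have "M (base_proj y) \<in> M ` E" using z Mz(1)[of y] by auto
    then have "base_proj y \<in> E" using injM by (simp add: inj_image_mem_iff)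
    then show "z \<in> M ` ?S" using z zy Mz(2)[of y] by (auto simp: slab_def)
  qed (auto simp: Mz slab_def)
  also have "emeasure lborel (M ` ?S) = emeasure lebesgue (M ` ?S)"
  proof -
    have "M ` ?S \<in> sets borel"
      unfolding img using measurable_sets[OF M'meas S] by (simp only: space_borel Int_UNIV_right)
    then show ?thesis by simp
  qed
  also have "\<dots> = (\<integral>\<^sup>+x. ennreal \<bar>det (matrix M)\<bar> * indicator ?S x \<partial>lebesgue)"
  proof (rule emeasure_differentiable_image)
    show "?S \<in> sets lebesgue" using S by (intro sets_completionI_sets) simp
    show "inj_on M ?S" using injM by (rule inj_on_subset) simp
    show "(M has_derivative M) (at x within ?S)" for x
      using linM by (intro bounded_linear_imp_has_derivative) (simp add: linear_conv_bounded_linear)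
  qed
  also have "\<dots> = ennreal (norm (surface_normal A)) * emeasure lborel ?S"
    using S by (simp add: detM nn_integral_completion nn_integral_cmult)
  also have "emeasure lborel ?S = emeasure flat_measure E"
    using E(1) by (rule emeasure_flat[symmetric])
  finally show ?thesis .
qed

subsection \<open>The area formula for parametrized hypersurfaces\<close>

lemma ennreal_le_of_le_mult:
  fixes a b :: ennreal
  assumes "\<And>c. 1 < c \<Longrightarrow> a \<le> ennreal c * b"
  shows "a \<le> b"
proof (cases b rule: ennreal_cases)
  case (real r)
  have fin: "a \<le> ennreal (c * r)" if "1 < c" for c
    using assms[OF that] real that by (simp add: ennreal_mult)
  have "a \<le> ennreal (2 * r)" by (rule fin) simp
  then have "a \<noteq> top" by (auto simp: top_unique)
  then obtain s where s: "s \<ge> 0" "a = ennreal s" by (cases a rule: ennreal_cases) auto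
  have "s \<le> r"
  proof (rule field_le_mult_one_interval)
    fix z :: real assume z: "0 < z" "z < 1"
    have "s \<le> inverse z * r"
      using fin[of "inverse z"] z s real(1) by (auto simp: one_less_inverse ennreal_le_iff)
    then show "z * s \<le> r" using z by (simp add: field_simps)
  qed
  then show ?thesis using s real by (simp add: ennreal_leI)
qed simp

lemma continuous_surface_normal:
  "continuous_on S (\<lambda>A :: (real^'n::{finite,wellorder}) \<Rightarrow>\<^sub>L (real^'n::_). surface_normal (blinfun_apply A))"
proof -
  have "surface_normal (blinfun_apply A) = (\<chi> i. det (\<chi> j. if j = last_index then axis i 1 else blinfun_apply A (axis j 1)))"
    for A :: "(real^'n::_) \<Rightarrow>\<^sub>L (real^'n::_)"
    unfolding surface_normal_def
    by (subst det_extend_map_rows) (simp_all add: blinfun.bounded_linear_right bounded_linear.linear)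
  moreover have "continuous_on S (\<lambda>A :: (real^'n::_) \<Rightarrow>\<^sub>L (real^'n::_). if j = last_index then axis i 1 else blinfun_apply A (axis j 1))"
    for i j by (cases "j = last_index") (auto intro!: continuous_intros)
  ultimately show ?thesis
    unfolding det_def by (simp only: vec_lambda_beta) (intro continuous_intros; assumption?)
qed

text \<open>The passage from local to global for the area formula and for the sweep formula:
  countably many good neighbourhoods suffice by the Lindelof property, and making them disjoint
  keeps them Borel.\<close>

lemma countable_disjointed_cover:
  fixes X :: "'a::second_countable_topology set"
  assumes X: "X \<noteq> {}" and ex: "\<And>x. x \<in> X \<Longrightarrow> \<exists>T. P T \<and> x \<in> T" and op: "\<And>T. P T \<Longrightarrow> open T"
  obtains V :: "nat \<Rightarrow> 'a set" where "\<And>m. P (V m)" "\<And>m. disjointed V m \<in> sets borel"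
    "X \<subseteq> (\<Union>m. disjointed V m)"
proof -
  obtain \<F> where \<F>: "\<F> \<subseteq> Collect P" "countable \<F>" "\<Union>\<F> = \<Union> (Collect P)"
    using Lindelof[of "Collect P"] op by auto
  have cov: "X \<subseteq> \<Union>\<F>" using ex unfolding \<F>(3) by blast
  define V where "V = from_nat_into \<F>"
  have rangeV: "range V = \<F>"
    unfolding V_def using cov X \<F>(2) by (intro range_from_nat_into) auto
  have P: "P (V m)" for m using rangeV \<F>(1) by auto
  show ?thesis
  proof (rule that[OF P])
    show "disjointed V m \<in> sets borel" for m
      unfolding disjointed_def using op[OF P] by (intro sets.Diff sets.finite_UN) auto
    show "X \<subseteq> (\<Union>m. disjointed V m)" using cov rangeV by (simp add: UN_disjointed_eq)
  qed
qed

text \<open>Closedness of \<open>S\<close> makes relatively open pieces of it, such as the image of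
  the chart, Borel sets.\<close>

locale chart =
  fixes S U :: "(real^'n::{finite,wellorder}) set" and \<phi> :: "real^'n::_ \<Rightarrow> real^'n::_" and \<phi>'
  assumes C1: "C1_parametrization S U \<phi> \<phi>'" and closed_S: "closed S"
begin

lemma U_open: "openin (top_of_set base_hyperplane) U"
  using C1 by (simp add: C1_parametrization_def)

lemma U_base: "U \<subseteq> base_hyperplane"
  using openin_imp_subset[OF U_open] .

lemma U_borel [measurable]: "U \<in> sets borel"
proof -
  obtain T where "open T" "U = base_hyperplane \<inter> T" using U_open by (auto simp: openin_open)
  then show ?thesis by simp
qed

lemma image_open: "openin (top_of_set S) (\<phi> ` U)"
  using C1 by (simp add: C1_parametrization_def)

lemma image_borel [measurable]: "\<phi> ` U \<in> sets borel"
proof -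
  obtain T where "open T" "\<phi> ` U = S \<inter> T" using image_open by (auto simp: openin_open)
  then show ?thesis using closed_S by simp
qed

definition chart_inv where "chart_inv = (SOME \<psi>. homeomorphism U (\<phi> ` U) \<phi> \<psi>)"

lemma homeo: "homeomorphism U (\<phi> ` U) \<phi> chart_inv"
proof -
  have "\<exists>\<psi>. homeomorphism U (\<phi> ` U) \<phi> \<psi>" using C1 by (simp add: C1_parametrization_def)
  then show ?thesis unfolding chart_inv_def by (rule someI_ex)
qed

lemma inv_chart: "u \<in> U \<Longrightarrow> chart_inv (\<phi> u) = u"
  using homeo by (auto simp: homeomorphism_def)

lemma chart_cont: "continuous_on U \<phi>" "continuous_on (\<phi> ` U) chart_inv"
  using homeo by (auto simp: homeomorphism_def)

lemma inj_chart: "inj_on \<phi> U"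
  by (metis inj_onI inv_chart)

lemma deriv_cont: "continuous_on U \<phi>'"
  using C1 by (simp add: C1_parametrization_def)

lemma deriv:
  assumes "u \<in> U"
  shows "(\<phi> has_derivative blinfun_apply (\<phi>' u)) (at u within base_hyperplane)"
    "inj_on (blinfun_apply (\<phi>' u)) base_hyperplane"
  using C1 assms by (auto simp: C1_parametrization_def)

abbreviation normal where "normal u \<equiv> surface_normal (blinfun_apply (\<phi>' u))"

lemma linear_deriv: "linear (blinfun_apply (\<phi>' u))"
  by (simp add: blinfun.bounded_linear_right bounded_linear.linear)

lemma normal_cont: "continuous_on U (\<lambda>u. normal u)"
  using continuous_on_compose2[OF continuous_surface_normal[of UNIV] deriv_cont] by auto

lemma normal_nonzero: "u \<in> U \<Longrightarrow> normal u \<noteq> 0"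
  by (rule surface_normal_nonzero[OF linear_deriv deriv(2)])

lemma chart_image_borel:
  assumes "E \<in> sets borel" "E \<subseteq> U"
  shows "\<phi> ` E \<in> sets borel"
proof -
  have "chart_inv -` E \<inter> space (restrict_space borel (\<phi> ` U)) \<in> sets (restrict_space borel (\<phi> ` U))"
    by (rule measurable_sets[OF borel_measurable_continuous_on_restrict[OF chart_cont(2)] assms(1)])
  moreover have "chart_inv -` E \<inter> space (restrict_space borel (\<phi> ` U)) = \<phi> ` E"
    using assms(2) inv_chart by (auto simp: space_restrict_space image_iff subset_iff)
  ultimately show ?thesis by (simp add: sets_restrict_space_iff)
qed

lemma normal_measurable [measurable]: "(\<lambda>u. indicator U u *\<^sub>R normal u) \<in> borel_measurable borel"
  using borel_measurable_continuous_on_indicator[OF U_borel normal_cont] .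

text \<open>The chart says nothing about the derivative off \<open>U\<close>; the indicator gives
  the density a Borel extension by zero to the whole space.\<close>

definition area_density :: "real^'n::_ \<Rightarrow> ennreal" where
  "area_density u = ennreal (norm (indicator U u *\<^sub>R normal u))"

lemma area_density_measurable [measurable]: "area_density \<in> borel_measurable borel"
  unfolding area_density_def by measurable

text \<open>Near \<open>u0\<close> the chart differs from its linearisation by a map with small
  derivative, hence with small Lipschitz constant by the mean value inequality. Since the
  linearisation stretches lengths by at least a factor \<open>m\<close>, the difference is a small
  fraction of its increments.\<close>

lemma local_bilipschitz:
  assumes u0: "u0 \<in> U" and c: "c > 1"
  obtains \<delta> where "\<delta> > 0"
    "\<And>u v. u \<in> U \<inter> ball u0 \<delta> \<Longrightarrow> v \<in> U \<inter> ball u0 \<delta> \<Longrightarrow> dist (\<phi> u) (\<phi> v) \<le> c * dist (\<phi>' u0 u) (\<phi>' u0 v)"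
    "\<And>u v. u \<in> U \<inter> ball u0 \<delta> \<Longrightarrow> v \<in> U \<inter> ball u0 \<delta> \<Longrightarrow> dist (\<phi>' u0 u) (\<phi>' u0 v) \<le> c * dist (\<phi> u) (\<phi> v)"
    "\<And>u. u \<in> U \<inter> ball u0 \<delta> \<Longrightarrow> norm (normal u) \<le> c * norm (normal u0)"
    "\<And>u. u \<in> U \<inter> ball u0 \<delta> \<Longrightarrow> norm (normal u0) \<le> c * norm (normal u)"
proof -
  let ?A = "blinfun_apply (\<phi>' u0)"
  have "?A x = 0 \<longrightarrow> x = 0" if "x \<in> base_hyperplane" for x
    using deriv(2)[OF u0] that linear_0[OF linear_deriv, of u0]
    by (metis inj_onD subspace_0 subspace_base)
  then obtain m where m: "m > 0" "\<And>x. x \<in> base_hyperplane \<Longrightarrow> m * norm x \<le> norm (?A x)"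
    using injective_imp_isometric[OF closed_base subspace_base blinfun.bounded_linear_right, of "\<phi>' u0"] by auto
  \<comment> \<open>Chosen so that both \<open>1 + \<epsilon> \<le> c\<close> and
    \<open>c * (1 - \<epsilon>) = 1\<close> hold, as the upper and the lower estimate
    require.\<close>
  define \<epsilon> where "\<epsilon> = 1 - 1 / c"
  have \<epsilon>: "0 < \<epsilon>" "1 + \<epsilon> \<le> c" "c * (1 - \<epsilon>) = 1"
  proof -
    show "0 < \<epsilon>" using c by (simp add: \<epsilon>_def)
    show "c * (1 - \<epsilon>) = 1" using c by (simp add: \<epsilon>_def)
    have "0 \<le> (c - 1)\<^sup>2 / c" using c by simp
    also have "\<dots> = c + 1 / c - 2" using c by (simp add: power2_eq_square field_simps)
    finally show "1 + \<epsilon> \<le> c" by (simp add: \<epsilon>_def)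
  qed
  obtain T where T: "open T" "U = base_hyperplane \<inter> T" using U_open by (auto simp: openin_open)
  obtain \<delta>0 where \<delta>0: "\<delta>0 > 0" "ball u0 \<delta>0 \<subseteq> T" using T u0 by (metis IntD2 openE)
  obtain \<delta>1 where \<delta>1: "\<delta>1 > 0" "\<And>u. u \<in> U \<Longrightarrow> dist u u0 < \<delta>1 \<Longrightarrow> dist (\<phi>' u) (\<phi>' u0) < \<epsilon> * m"
  proof -
    have "0 < \<epsilon> * m" using \<epsilon> m by simp
    then have "\<exists>d>0. \<forall>u\<in>U. dist u u0 < d \<longrightarrow> dist (\<phi>' u) (\<phi>' u0) < \<epsilon> * m"
      using deriv_cont u0 unfolding continuous_on_iff by simp
    then show ?thesis using that by auto
  qed
  have nc: "continuous_on U (\<lambda>u. norm (normal u))" using normal_cont by (intro continuous_intros)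
  have N0: "norm (normal u0) > 0" using normal_nonzero[OF u0] by simp
  then have N: "0 < \<epsilon> * norm (normal u0)" using \<epsilon> by simp
  obtain \<delta>2 where \<delta>2: "\<delta>2 > 0" "\<And>u. u \<in> U \<Longrightarrow> dist u u0 < \<delta>2 \<Longrightarrow> dist (norm (normal u)) (norm (normal u0)) < \<epsilon> * norm (normal u0)"
  proof -
    have "\<exists>d>0. \<forall>u\<in>U. dist u u0 < d \<longrightarrow> dist (norm (normal u)) (norm (normal u0)) < \<epsilon> * norm (normal u0)"
      using nc u0 N unfolding continuous_on_iff by simp
    then show ?thesis using that by auto
  qed
  define \<delta> where "\<delta> = min \<delta>0 (min \<delta>1 \<delta>2)"
  let ?B = "U \<inter> ball u0 \<delta>"
  \<comment> \<open>The radius does not exceed \<open>\<delta>0\<close>, so the ball meets the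
    hyperplane only inside \<open>U\<close>; this makes the domain convex for the mean value
    inequality.\<close>
  have B_eq: "?B = base_hyperplane \<inter> ball u0 \<delta>"
    using \<delta>0 T by (auto simp: \<delta>_def)
  have conv: "convex ?B"
    unfolding B_eq by (intro convex_Int convex_ball subspace_imp_convex subspace_base)
  have key: "norm ((\<phi> u - \<phi> v) - (?A u - ?A v)) \<le> \<epsilon> * norm (?A u - ?A v)" if "u \<in> ?B" "v \<in> ?B" for u v
  proof -
    have "norm ((\<phi> u - ?A u) - (\<phi> v - ?A v)) \<le> (\<epsilon> * m) * norm (u - v)"
    proof (rule differentiable_bound[OF conv _ _ that])
      fix x assume x: "x \<in> ?B"
      show "((\<lambda>u. \<phi> u - ?A u) has_derivative (\<lambda>h. \<phi>' x h - ?A h)) (at x within ?B)"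
        using x U_base
        by (intro has_derivative_diff has_derivative_subset[OF deriv(1)] bounded_linear_imp_has_derivative
            blinfun.bounded_linear_right) auto
      have "onorm (\<lambda>h. \<phi>' x h - ?A h) = norm (\<phi>' x - \<phi>' u0)"
        by (simp add: norm_blinfun.rep_eq blinfun.diff_left[abs_def, symmetric])
      also have "\<dots> \<le> \<epsilon> * m"
        using \<delta>1(2)[of x] x by (simp add: dist_norm \<delta>_def norm_minus_commute)
      finally show "onorm (\<lambda>h. \<phi>' x h - ?A h) \<le> \<epsilon> * m" .
    qed
    also have "(\<epsilon> * m) * norm (u - v) = \<epsilon> * (m * norm (u - v))" by simp
    also have "\<dots> \<le> \<epsilon> * norm (?A (u - v))"
      using that U_base \<epsilon> by (intro mult_left_mono m(2) subspace_diff[OF subspace_base]) auto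
    finally show ?thesis by (simp add: linear_diff[OF linear_deriv] algebra_simps)
  qed
  show ?thesis
  proof (rule that)
    show "\<delta> > 0" using \<delta>0 \<delta>1 \<delta>2 by (simp add: \<delta>_def)
    fix u assume u: "u \<in> ?B"
    show "dist (\<phi> u) (\<phi> v) \<le> c * dist (?A u) (?A v)" if v: "v \<in> ?B" for v
    proof -
      have "norm (\<phi> u - \<phi> v) \<le> norm (?A u - ?A v) + \<epsilon> * norm (?A u - ?A v)"
        using key[OF u v] norm_triangle_sub[of "\<phi> u - \<phi> v" "?A u - ?A v"] by linarith
      also have "\<dots> = (1 + \<epsilon>) * norm (?A u - ?A v)" by (simp add: algebra_simps)
      also have "\<dots> \<le> c * norm (?A u - ?A v)" using \<epsilon> by (intro mult_right_mono) auto
      finally show ?thesis by (simp add: dist_norm)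
    qed
    show "dist (?A u) (?A v) \<le> c * dist (\<phi> u) (\<phi> v)" if v: "v \<in> ?B" for v
    proof -
      have "norm (?A u - ?A v) - \<epsilon> * norm (?A u - ?A v) \<le> norm (\<phi> u - \<phi> v)"
        using key[OF u v] norm_triangle_sub[of "?A u - ?A v" "\<phi> u - \<phi> v"] by (simp add: norm_minus_commute)
      then have "(1 - \<epsilon>) * norm (?A u - ?A v) \<le> norm (\<phi> u - \<phi> v)" by (simp add: algebra_simps)
      then have "c * ((1 - \<epsilon>) * norm (?A u - ?A v)) \<le> c * norm (\<phi> u - \<phi> v)"
        using c by (intro mult_left_mono) auto
      then show ?thesis using \<epsilon>(3) by (simp add: dist_norm mult.assoc[symmetric])
    qed
    have d: "\<bar>norm (normal u) - norm (normal u0)\<bar> \<le> \<epsilon> * norm (normal u0)"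
      using \<delta>2(2)[of u] u by (simp add: dist_real_def \<delta>_def dist_commute)
    then have "norm (normal u) \<le> (1 + \<epsilon>) * norm (normal u0)" by (simp add: algebra_simps)
    also have "\<dots> \<le> c * norm (normal u0)" using \<epsilon> by (intro mult_right_mono) auto
    finally show "norm (normal u) \<le> c * norm (normal u0)" .
    have "(1 - \<epsilon>) * norm (normal u0) \<le> norm (normal u)" using d by (simp add: algebra_simps)
    then have "c * ((1 - \<epsilon>) * norm (normal u0)) \<le> c * norm (normal u)"
      using c by (intro mult_left_mono) auto
    then show "norm (normal u0) \<le> c * norm (normal u)" using \<epsilon>(3) by (simp add: mult.assoc[symmetric])
  qed
qed

definition chart_area :: "(real^'n::_) set \<Rightarrow> ennreal" where
  "chart_area E = flat_const TYPE('n) * (\<integral>\<^sup>+u. area_density u * indicator E u \<partial>flat_measure)"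

text \<open>The chart is compared with its linearisation at \<open>u0\<close>, for which the area is
  known. The Lipschitz constants contribute \<open>c ^ (CARD('n) - 1)\<close>, and the variation of
  the normal one further factor \<open>c\<close>.\<close>

lemma local_area:
  assumes u0: "u0 \<in> U" and c: "c > 1"
  obtains V where "open V" "u0 \<in> V"
    "\<And>E. E \<in> sets borel \<Longrightarrow> E \<subseteq> U \<inter> V \<Longrightarrow> hausdorff_outer (CARD('n) - 1) (\<phi> ` E) \<le> ennreal (c ^ CARD('n)) * chart_area E"
    "\<And>E. E \<in> sets borel \<Longrightarrow> E \<subseteq> U \<inter> V \<Longrightarrow> chart_area E \<le> ennreal (c ^ CARD('n)) * hausdorff_outer (CARD('n) - 1) (\<phi> ` E)"
proof -
  let ?k = "CARD('n) - 1" and ?A = "blinfun_apply (\<phi>' u0)" and ?\<kappa> = "flat_const TYPE('n)"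
  obtain \<delta> where \<delta>: "\<delta> > 0"
    and lip: "\<And>u v. u \<in> U \<inter> ball u0 \<delta> \<Longrightarrow> v \<in> U \<inter> ball u0 \<delta> \<Longrightarrow> dist (\<phi> u) (\<phi> v) \<le> c * dist (?A u) (?A v)"
      "\<And>u v. u \<in> U \<inter> ball u0 \<delta> \<Longrightarrow> v \<in> U \<inter> ball u0 \<delta> \<Longrightarrow> dist (?A u) (?A v) \<le> c * dist (\<phi> u) (\<phi> v)"
    and N: "\<And>u. u \<in> U \<inter> ball u0 \<delta> \<Longrightarrow> norm (normal u) \<le> c * norm (normal u0)"
      "\<And>u. u \<in> U \<inter> ball u0 \<delta> \<Longrightarrow> norm (normal u0) \<le> c * norm (normal u)"
    using local_bilipschitz[OF u0 c] by blast
  have "CARD('n) \<noteq> 0" by simp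
  then have ck: "ennreal (c ^ CARD('n)) = ennreal (c ^ ?k) * ennreal c"
    using c power_minus_mult[of "CARD('n)" c] by (simp add: ennreal_mult'[symmetric])
  show ?thesis
  proof (rule that[of "ball u0 \<delta>"])
    fix E assume E: "E \<in> sets borel" "E \<subseteq> U \<inter> ball u0 \<delta>"
    have Eb: "E \<subseteq> base_hyperplane" using E(2) U_base by auto
    have injA: "inj_on ?A E" using deriv(2)[OF u0] Eb by (rule inj_on_subset)
    have injE: "inj_on \<phi> E" using inj_chart E(2) by (auto intro: inj_on_subset)
    let ?N0 = "ennreal (norm (normal u0))"
    have HA: "hausdorff_outer ?k (?A ` E) = ?\<kappa> * (?N0 * emeasure flat_measure E)"
      by (rule outer_linear_image[OF linear_deriv deriv(2)[OF u0] E(1) Eb])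
    have 1: "?N0 * emeasure flat_measure E \<le> ennreal c * (\<integral>\<^sup>+u. area_density u * indicator E u \<partial>flat_measure)"
    proof -
      have "?N0 * emeasure flat_measure E = (\<integral>\<^sup>+u. ?N0 * indicator E u \<partial>flat_measure)"
        using E(1) by (simp add: nn_integral_cmult)
      also have "\<dots> \<le> (\<integral>\<^sup>+u. ennreal c * (area_density u * indicator E u) \<partial>flat_measure)"
      proof (rule nn_integral_mono)
        fix u
        show "?N0 * indicator E u \<le> ennreal c * (area_density u * indicator E u)"
          using N(2)[of u] E(2) c
          by (cases "u \<in> E") (auto simp: area_density_def ennreal_mult'[symmetric] subset_iff intro: ennreal_leI)
      qed
      also have "\<dots> = ennreal c * (\<integral>\<^sup>+u. area_density u * indicator E u \<partial>flat_measure)"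
        using E(1) by (intro nn_integral_cmult) auto
      finally show ?thesis .
    qed
    have 2: "(\<integral>\<^sup>+u. area_density u * indicator E u \<partial>flat_measure) \<le> ennreal c * (?N0 * emeasure flat_measure E)"
    proof -
      have "(\<integral>\<^sup>+u. area_density u * indicator E u \<partial>flat_measure) \<le> (\<integral>\<^sup>+u. (ennreal c * ?N0) * indicator E u \<partial>flat_measure)"
      proof (rule nn_integral_mono)
        fix u
        show "area_density u * indicator E u \<le> (ennreal c * ?N0) * indicator E u"
          using N(1)[of u] E(2) c
          by (cases "u \<in> E") (auto simp: area_density_def ennreal_mult'[symmetric] subset_iff intro!: ennreal_leI)
      qed
      also have "\<dots> = (ennreal c * ?N0) * emeasure flat_measure E"
        using E(1) by (simp add: nn_integral_cmult)
      finally show ?thesis by (simp add: mult.assoc)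
    qed
    have "hausdorff_outer ?k (\<phi> ` E) = hausdorff_outer ?k ((\<phi> \<circ> inv_into E ?A) ` ?A ` E)"
      using injA by (simp add: image_image inv_into_f_f cong: image_cong)
    also have "\<dots> \<le> ennreal (c ^ ?k) * hausdorff_outer ?k (?A ` E)"
      using c lip(1) E(2) injA by (intro outer_lipschitz_image) (auto simp: inv_into_f_f subset_iff)
    also have "\<dots> = ennreal (c ^ ?k) * ?\<kappa> * (?N0 * emeasure flat_measure E)" by (simp only: HA mult.assoc)
    also have "\<dots> \<le> ennreal (c ^ ?k) * ?\<kappa> * (ennreal c * (\<integral>\<^sup>+u. area_density u * indicator E u \<partial>flat_measure))"
      by (intro mult_left_mono 1) auto
    also have "\<dots> = ennreal (c ^ CARD('n)) * chart_area E" by (simp add: ck chart_area_def mult_ac)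
    finally show "hausdorff_outer ?k (\<phi> ` E) \<le> ennreal (c ^ CARD('n)) * chart_area E" .
    have "chart_area E \<le> ?\<kappa> * (ennreal c * (?N0 * emeasure flat_measure E))"
      unfolding chart_area_def by (intro mult_left_mono 2) auto
    also have "\<dots> = ennreal c * hausdorff_outer ?k (?A ` E)" by (simp only: HA mult_ac)
    also have "hausdorff_outer ?k (?A ` E) = hausdorff_outer ?k ((?A \<circ> inv_into E \<phi>) ` \<phi> ` E)"
      using injE by (simp add: image_image inv_into_f_f cong: image_cong)
    also have "ennreal c * \<dots> \<le> ennreal c * (ennreal (c ^ ?k) * hausdorff_outer ?k (\<phi> ` E))"
      using c lip(2) E(2) injE by (intro mult_left_mono outer_lipschitz_image) (auto simp: inv_into_f_f subset_iff)
    also have "\<dots> = ennreal (c ^ CARD('n)) * hausdorff_outer ?k (\<phi> ` E)" by (simp add: ck mult_ac)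
    finally show "chart_area E \<le> ennreal (c ^ CARD('n)) * hausdorff_outer ?k (\<phi> ` E)" .
  qed (use \<delta> in auto)
qed

text \<open>Both sides are countably additive, so the local estimates add up over a countable Borel
  partition with the same factor, and this factor can be brought arbitrarily close to one.\<close>

theorem outer_chart:
  assumes E: "E \<in> sets borel" "E \<subseteq> U"
  shows "hausdorff_outer (CARD('n) - 1) (\<phi> ` E) = chart_area E"
proof -
  let ?k = "CARD('n) - 1"
  have both: "hausdorff_outer ?k (\<phi> ` E) \<le> ennreal (c ^ CARD('n)) * chart_area E \<and>
      chart_area E \<le> ennreal (c ^ CARD('n)) * hausdorff_outer ?k (\<phi> ` E)" if c: "c > 1" for c
  proof (cases "U = {}")
    case True
    then show ?thesis using E unfolding chart_area_def by simp
  next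
    case False
    define good where "good V \<longleftrightarrow> open V \<and> (\<forall>E. E \<in> sets borel \<longrightarrow> E \<subseteq> U \<inter> V \<longrightarrow>
      hausdorff_outer ?k (\<phi> ` E) \<le> ennreal (c ^ CARD('n)) * chart_area E \<and>
      chart_area E \<le> ennreal (c ^ CARD('n)) * hausdorff_outer ?k (\<phi> ` E))" for V
    have "\<exists>V. good V \<and> u \<in> V" if "u \<in> U" for u
      using local_area[OF that c] unfolding good_def by metis
    moreover have "open V" if "good V" for V using that by (simp add: good_def)
    ultimately obtain V where goodV: "\<And>n. good (V n)" and dV: "\<And>n. disjointed V n \<in> sets borel"
      and cov: "U \<subseteq> (\<Union>n. disjointed V n)"
      using countable_disjointed_cover[OF False, of good] by blast
    define D where "D n = E \<inter> disjointed V n" for n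
    have D: "D n \<in> sets borel" "D n \<subseteq> U \<inter> V n" "D n \<subseteq> U" for n
      using E dV[of n] disjointed_subset[of V n] by (auto simp: D_def)
    have disj: "disjoint_family D"
      using disjoint_family_disjointed[of V] by (auto simp: D_def disjoint_family_on_def)
    have UD: "(\<Union>n. D n) = E" using E(2) cov by (auto simp: D_def)
    have H_sum: "hausdorff_outer ?k (\<phi> ` E) = (\<Sum>n. hausdorff_outer ?k (\<phi> ` D n))"
    proof -
      have "disjoint_family (\<lambda>n. \<phi> ` D n)"
        using disj D(3) inj_chart unfolding disjoint_family_on_def
        by (metis (no_types, lifting) UNIV_I image_empty inj_on_image_Int)
      then have "(\<Sum>n. emeasure (hausdorff_measure ?k) (\<phi> ` D n)) = emeasure (hausdorff_measure ?k) (\<Union>n. \<phi> ` D n)"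
        using chart_image_borel[OF D(1,3)] by (intro suminf_emeasure) auto
      moreover have "(\<Union>n. \<phi> ` D n) = \<phi> ` E" using UD by auto
      ultimately show ?thesis
        using chart_image_borel[OF D(1,3)] chart_image_borel[OF E] by (simp add: emeasure_hausdorff)
    qed
    have A_sum: "chart_area E = (\<Sum>n. chart_area (D n))"
    proof -
      have "(\<integral>\<^sup>+u. area_density u * indicator E u \<partial>flat_measure) = emeasure (density flat_measure area_density) E"
        using E by (subst emeasure_density) auto
      also have "\<dots> = (\<Sum>n. emeasure (density flat_measure area_density) (D n))"
        using UD disj D by (subst suminf_emeasure) auto
      also have "\<dots> = (\<Sum>n. \<integral>\<^sup>+u. area_density u * indicator (D n) u \<partial>flat_measure)"
        using D by (intro suminf_cong, subst emeasure_density) auto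
      finally show ?thesis by (simp add: chart_area_def)
    qed
    have Dn: "hausdorff_outer ?k (\<phi> ` D n) \<le> ennreal (c ^ CARD('n)) * chart_area (D n)"
      "chart_area (D n) \<le> ennreal (c ^ CARD('n)) * hausdorff_outer ?k (\<phi> ` D n)" for n
      using goodV[of n] D[of n] by (auto simp: good_def)
    show ?thesis
      unfolding H_sum A_sum ennreal_suminf_cmult[symmetric] by (intro conjI suminf_le Dn) auto
  qed
  have root: "\<exists>r>1. r ^ CARD('n) \<le> c" if "c > 1" for c :: real
  proof (intro exI[of _ "root (CARD('n)) c"] conjI)
    show "root (CARD('n)) c > 1" using that by simp
    show "root (CARD('n)) c ^ CARD('n) \<le> c" using that by simp
  qed
  show ?thesis
  proof (rule antisym; rule ennreal_le_of_le_mult)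
    fix c :: real assume "c > 1"
    then obtain r where r: "r > 1" "r ^ CARD('n) \<le> c" using root by blast
    show "hausdorff_outer ?k (\<phi> ` E) \<le> ennreal c * chart_area E"
      using both[OF r(1)] r(2) by (meson ennreal_leI mult_right_mono order_trans zero_le)
    show "chart_area E \<le> ennreal c * hausdorff_outer ?k (\<phi> ` E)"
      using both[OF r(1)] r(2) by (meson ennreal_leI mult_right_mono order_trans zero_le)
  qed
qed

end

subsection \<open>Sweeping out volume by a hypersurface\<close>

text \<open>Refers to every chart at \<open>x\<close>, so that the property can be used in whichever
  chart a computation takes place. At a point without a chart it only says that \<open>v\<close> is
  a unit vector.\<close>

definition is_normal :: "(real^'n::{finite,wellorder}) set \<Rightarrow> real^'n::_ \<Rightarrow> real^'n::_ \<Rightarrow> bool" where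
  "is_normal S x v \<longleftrightarrow> norm v = 1 \<and> (\<forall>U \<phi> \<phi>' u. C1_parametrization S U \<phi> \<phi>' \<longrightarrow> u \<in> U \<longrightarrow> \<phi> u = x \<longrightarrow>
    (\<forall>h\<in>base_hyperplane. v \<bullet> blinfun_apply (\<phi>' u) h = 0))"

text \<open>Covers both motions that occur: \<open>sweep 1 0 0 w\<close> takes \<open>(y, t)\<close>
  to \<open>y + t *\<^sub>R w\<close>, and \<open>sweep 0 1 x (- x)\<close> takes it to
  \<open>x + t *\<^sub>R (y - x)\<close>.\<close>

definition sweep :: "real \<Rightarrow> real \<Rightarrow> 'a::real_vector \<Rightarrow> 'a \<Rightarrow> 'a \<times> real \<Rightarrow> 'a" where
  "sweep a b p q = (\<lambda>(y, t). (a + b * t) *\<^sub>R y + p + t *\<^sub>R q)"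

lemma sweep_measurable [measurable]:
  "sweep a b p q \<in> borel_measurable (borel \<Otimes>\<^sub>M (borel :: real measure) :: ('a::euclidean_space \<times> real) measure)"
  unfolding sweep_def split_beta by measurable

context chart
begin

text \<open>Splits the Jacobian of a sweep into the area density of the chart and the cosine with
  the unit normal.\<close>

lemma normal_inner:
  assumes u: "u \<in> U" and v: "is_normal S (\<phi> u) v"
  shows "\<bar>normal u \<bullet> w\<bar> = norm (normal u) * \<bar>w \<bullet> v\<bar>"
proof -
  have "norm v = 1" "\<And>h. h \<in> base_hyperplane \<Longrightarrow> v \<bullet> blinfun_apply (\<phi>' u) h = 0"
    using v u C1 unfolding is_normal_def by auto
  note par = surface_normal_parallel[OF linear_deriv deriv(2)[OF u] this]
  have "normal u \<bullet> w = (normal u \<bullet> v) * (v \<bullet> w)"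
    using arg_cong[OF par(1), of "\<lambda>x. x \<bullet> w"] by (simp only: inner_scaleR_left)
  then show ?thesis using par(2) by (simp add: abs_mult inner_commute)
qed

definition chart_map where "chart_map u = indicator U u *\<^sub>R \<phi> u"

lemma chart_map_measurable [measurable]: "chart_map \<in> borel_measurable borel"
  unfolding chart_map_def[abs_def] using borel_measurable_continuous_on_indicator[OF U_borel chart_cont(1)] .

lemma area_density_zero: "u \<notin> U \<Longrightarrow> area_density u = 0"
  by (simp add: area_density_def)

lemma image_subset: "\<phi> ` U \<subseteq> S"
  using openin_imp_subset[OF image_open] .

text \<open>The area formula for sets states that two Borel measures coincide; equality of their
  integrals is the form needed for densities.\<close>

lemma nn_integral_image:
  assumes [measurable]: "g \<in> borel_measurable borel"
  shows "(\<integral>\<^sup>+y. indicator (\<phi> ` U) y * g y \<partial>hausdorff_on (CARD('n) - 1) S) =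
    flat_const TYPE('n) * (\<integral>\<^sup>+u. area_density u * g (chart_map u) \<partial>flat_measure)"
proof -
  let ?\<kappa> = "flat_const TYPE('n)"
  let ?M = "density (hausdorff_on (CARD('n) - 1) S) (indicator (\<phi> ` U))"
  let ?N = "distr (density flat_measure (\<lambda>u. ?\<kappa> * area_density u)) borel chart_map"
  have "?M = ?N"
  proof (rule measure_eqI)
    fix Y assume "Y \<in> sets ?M"
    then have Y[measurable]: "Y \<in> sets borel" by simp
    define E where "E = U \<inter> chart_map -` Y"
    have vim: "chart_map -` Y \<in> sets borel"
      using measurable_sets[OF chart_map_measurable Y] by simp
    have E: "E \<in> sets borel" "E \<subseteq> U" using vim by (auto simp: E_def)
    have "emeasure ?M Y = (\<integral>\<^sup>+y. indicator (\<phi> ` U) y * indicator Y y \<partial>hausdorff_on (CARD('n) - 1) S)"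
      by (intro emeasure_density) auto
    also have "\<dots> = (\<integral>\<^sup>+y. indicator (\<phi> ` U \<inter> Y) y \<partial>hausdorff_on (CARD('n) - 1) S)"
      by (intro nn_integral_cong) (simp split: split_indicator)
    also have "\<dots> = emeasure (hausdorff_on (CARD('n) - 1) S) (\<phi> ` U \<inter> Y)"
      by (intro nn_integral_indicator) simp
    also have "\<dots> = hausdorff_outer (CARD('n) - 1) (S \<inter> (\<phi> ` U \<inter> Y))"
      using closed_S by (intro emeasure_hausdorff_on) auto
    also have "S \<inter> (\<phi> ` U \<inter> Y) = \<phi> ` E"
      using image_subset by (auto simp: E_def chart_map_def)
    also have "hausdorff_outer (CARD('n) - 1) (\<phi> ` E) = chart_area E"
      by (rule outer_chart[OF E])
    also have "\<dots> = (\<integral>\<^sup>+u. (?\<kappa> * area_density u) * indicator E u \<partial>flat_measure)"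
      unfolding chart_area_def using E by (subst nn_integral_cmult[symmetric]) (auto simp: mult.assoc)
    also have "\<dots> = (\<integral>\<^sup>+u. (?\<kappa> * area_density u) * indicator (chart_map -` Y) u \<partial>flat_measure)"
      by (intro nn_integral_cong) (auto simp: E_def area_density_zero split: split_indicator)
    also have "\<dots> = emeasure ?N Y"
      using vim by (subst emeasure_distr) (auto simp: emeasure_density)
    finally show "emeasure ?M Y = emeasure ?N Y" .
  qed simp
  have "(\<integral>\<^sup>+y. indicator (\<phi> ` U) y * g y \<partial>hausdorff_on (CARD('n) - 1) S) = (\<integral>\<^sup>+y. g y \<partial>?M)"
    by (subst nn_integral_density) auto
  also have "\<dots> = (\<integral>\<^sup>+y. g y \<partial>?N)" by (simp only: \<open>?M = ?N\<close>)
  also have "\<dots> = (\<integral>\<^sup>+u. ?\<kappa> * area_density u * g (chart_map u) \<partial>flat_measure)"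
    by (subst nn_integral_distr) (auto simp: nn_integral_density)
  also have "\<dots> = ?\<kappa> * (\<integral>\<^sup>+u. area_density u * g (chart_map u) \<partial>flat_measure)"
    by (subst nn_integral_cmult[symmetric]) (auto simp: mult.assoc)
  finally show ?thesis .
qed

text \<open>The sweep of a chart is a map between spaces of equal dimension, so the change of variables
  formula of the library applies to it.\<close>

lemma emeasure_sweep_chart:
  assumes E: "E \<in> sets (borel \<Otimes>\<^sub>M borel)" "E \<subseteq> U \<times> UNIV"
    and pos: "\<And>u t. (u, t) \<in> E \<Longrightarrow> a + b * t > 0"
    and inj: "inj_on (\<lambda>(u, t). sweep a b p q (\<phi> u, t)) E"
  shows "(\<lambda>(u, t). sweep a b p q (\<phi> u, t)) ` E \<in> sets lebesgue"
    "emeasure lebesgue ((\<lambda>(u, t). sweep a b p q (\<phi> u, t)) ` E) =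
      (\<integral>\<^sup>+u. \<integral>\<^sup>+t. indicator E (u, t) * ennreal (\<bar>a + b * t\<bar> ^ (CARD('n) - 1) *
        \<bar>(indicator U u *\<^sub>R normal u) \<bullet> (b *\<^sub>R chart_map u + q)\<bar>) \<partial>lborel \<partial>flat_measure)"
proof -
  \<comment> \<open>Decodes a point \<open>u + t *\<^sub>R last_axis\<close> into the pair
    \<open>(u, t)\<close>; with pairs encoded in this way, the sweep has a domain of the same
    dimension as its range.\<close>
  define sp :: "real^'n::_ \<Rightarrow> (real^'n::_) \<times> real" where "sp z = (base_proj z, z $ last_index)" for z
  have sp_meas [measurable]: "sp \<in> borel \<rightarrow>\<^sub>M borel \<Otimes>\<^sub>M borel" unfolding sp_def by measurable
  define S' where "S' = sp -` E"
  define g where "g z = sweep a b p q (\<phi> (base_proj z), z $ last_index)" for z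
  define J where "J u t = ennreal (\<bar>a + b * t\<bar> ^ (CARD('n) - 1) *
        \<bar>(indicator U u *\<^sub>R normal u) \<bullet> (b *\<^sub>R chart_map u + q)\<bar>)" for u t
  have J_meas [measurable]: "(\<lambda>(u, t). J u t) \<in> borel_measurable (borel \<Otimes>\<^sub>M borel)"
    unfolding J_def split_beta by measurable
  have E_meas [measurable]: "E \<in> sets (borel \<Otimes>\<^sub>M borel)" by (rule E(1))
  have S': "S' \<in> sets borel"
    using measurable_sets[OF sp_meas E(1)] by (simp add: S'_def)
  then have S'_leb: "S' \<in> sets lebesgue" by simp
  \<comment> \<open>The base directions are stretched by \<open>a + b * t\<close>, and the
    derivative in \<open>t\<close> is \<open>b *\<^sub>R \<phi> u + q\<close>. So the derivative is
    an instance of \<open>extend_map\<close>, whose determinant is known.\<close>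
  define g' where "g' z = extend_map (\<lambda>h. (a + b * z $ last_index) *\<^sub>R blinfun_apply (\<phi>' (base_proj z)) h)
      (b *\<^sub>R \<phi> (base_proj z) + q)" for z
  have der: "(g has_derivative g' z) (at z within S')" if "z \<in> S'" for z
  proof -
    have u: "base_proj z \<in> U" using that E(2) by (auto simp: S'_def sp_def)
    have bp: "(base_proj has_derivative base_proj) (at z)"
      using linear_base_proj by (intro bounded_linear_imp_has_derivative) (simp add: linear_conv_bounded_linear)
    \<comment> \<open>Differentiability of \<open>\<phi>\<close> is relative to the hyperplane; this
      suffices for the chain rule because \<open>base_proj\<close> maps into it.\<close>
    have "(\<phi> has_derivative blinfun_apply (\<phi>' (base_proj z))) (at (base_proj z) within range base_proj)"
      by (rule has_derivative_subset[OF deriv(1)[OF u]]) auto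
    from has_derivative_in_compose[OF bp this]
    have 1: "((\<lambda>z. \<phi> (base_proj z)) has_derivative (\<lambda>h. blinfun_apply (\<phi>' (base_proj z)) (base_proj h))) (at z)"
      by simp
    have 2: "((\<lambda>z. z $ last_index) has_derivative (\<lambda>h. h $ last_index)) (at z)"
      by (intro bounded_linear_imp_has_derivative bounded_linear_vec_nth)
    have "(g has_derivative (\<lambda>h. (a + b * z $ last_index) *\<^sub>R blinfun_apply (\<phi>' (base_proj z)) (base_proj h) +
        (b * h $ last_index) *\<^sub>R \<phi> (base_proj z) + (h $ last_index) *\<^sub>R q)) (at z)"
      unfolding g_def sweep_def prod.case
      by (auto intro!: derivative_eq_intros 1 2)
    then have "(g has_derivative g' z) (at z)"
      by (simp add: g'_def extend_map_def[abs_def] algebra_simps)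
    then show ?thesis by (rule has_derivative_at_withinI)
  qed
  have img: "g ` S' = (\<lambda>(u, t). sweep a b p q (\<phi> u, t)) ` E"
  proof (intro equalityI subsetI)
    fix w assume "w \<in> (\<lambda>(u, t). sweep a b p q (\<phi> u, t)) ` E"
    then obtain u t where ut: "(u, t) \<in> E" "w = sweep a b p q (\<phi> u, t)" by auto
    have ub: "u \<in> base_hyperplane" using ut E(2) U_base by auto
    define z where "z = u + t *\<^sub>R last_axis"
    have "sp z = (u, t)"
    proof -
      have "base_proj z = u" using ub by (simp add: z_def base_proj_add base_proj_scaleR base_proj_base)
      moreover have "z $ last_index = t" using ub by (simp add: z_def base_hyperplane_def axis_def)
      ultimately show ?thesis by (simp add: sp_def)
    qed
    then show "w \<in> g ` S'" using ut by (intro image_eqI[of _ _ z]) (auto simp: g_def S'_def sp_def)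
  qed (auto simp: g_def S'_def sp_def)
  have injg: "inj_on g S'"
  proof (rule inj_onI)
    fix x y assume xy: "x \<in> S'" "y \<in> S'" "g x = g y"
    have "sp x = sp y"
      using inj_onD[OF inj, of "sp x" "sp y"] xy by (auto simp: S'_def sp_def g_def)
    then show "x = y" by (metis base_proj_decomp prod.inject sp_def)
  qed
  have det: "ennreal \<bar>det (matrix (g' z))\<bar> = J (base_proj z) (z $ last_index)" if "z \<in> S'" for z
  proof -
    have u: "base_proj z \<in> U" using that E(2) by (auto simp: S'_def sp_def)
    show ?thesis
      using u by (simp add: g'_def det_extend_map_scale[OF linear_deriv] det_extend_map[OF linear_deriv]
          J_def chart_map_def abs_mult power_abs)
  qed
  show "(\<lambda>(u, t). sweep a b p q (\<phi> u, t)) ` E \<in> sets lebesgue"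
    unfolding img[symmetric] using S'_leb der
    by (intro differentiable_image_in_sets_lebesgue) (auto simp: differentiable_on_def differentiable_def)
  have "emeasure lebesgue (g ` S') = (\<integral>\<^sup>+z. ennreal \<bar>det (matrix (g' z))\<bar> * indicator S' z \<partial>lebesgue)"
    by (rule emeasure_differentiable_image[OF S'_leb der injg])
  also have "\<dots> = (\<integral>\<^sup>+z. indicator E (sp z) * J (base_proj z) (z $ last_index) \<partial>lebesgue)"
    by (intro nn_integral_cong) (auto simp: det S'_def split: split_indicator)
  also have "\<dots> = (\<integral>\<^sup>+z. indicator E (sp z) * J (base_proj z) (z $ last_index) \<partial>lborel)"
    by (rule nn_integral_completion)
  also have "\<dots> = (\<integral>\<^sup>+u. \<integral>\<^sup>+t. indicator E (sp (u + t *\<^sub>R last_axis)) *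
      J (base_proj (u + t *\<^sub>R last_axis)) ((u + t *\<^sub>R last_axis) $ last_index) \<partial>lborel \<partial>flat_measure)"
    by (rule nn_integral_flat_last[symmetric]) measurable
  also have "\<dots> = (\<integral>\<^sup>+u. \<integral>\<^sup>+t. indicator E (u, t) * J u t \<partial>lborel \<partial>flat_measure)"
  proof (rule nn_integral_cong_AE)
    show "AE u in flat_measure. (\<integral>\<^sup>+t. indicator E (sp (u + t *\<^sub>R last_axis)) *
      J (base_proj (u + t *\<^sub>R last_axis)) ((u + t *\<^sub>R last_axis) $ last_index) \<partial>lborel) =
      (\<integral>\<^sup>+t. indicator E (u, t) * J u t \<partial>lborel)"
      using AE_flat_base
    proof eventually_elim
      fix u :: "real^'n::_" assume u: "u \<in> base_hyperplane"
      have 1: "base_proj (u + t *\<^sub>R last_axis) = u" for t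
        using u by (simp add: base_proj_add base_proj_scaleR base_proj_base)
      have 2: "(u + t *\<^sub>R last_axis) $ last_index = t" for t
        using u by (simp add: base_hyperplane_def axis_def)
      show "(\<integral>\<^sup>+t. indicator E (sp (u + t *\<^sub>R last_axis)) *
          J (base_proj (u + t *\<^sub>R last_axis)) ((u + t *\<^sub>R last_axis) $ last_index) \<partial>lborel) =
          (\<integral>\<^sup>+t. indicator E (u, t) * J u t \<partial>lborel)"
        unfolding sp_def 1 2 ..
    qed
  qed
  finally show "emeasure lebesgue ((\<lambda>(u, t). sweep a b p q (\<phi> u, t)) ` E) =
      (\<integral>\<^sup>+u. \<integral>\<^sup>+t. indicator E (u, t) * ennreal (\<bar>a + b * t\<bar> ^ (CARD('n) - 1) *
        \<bar>(indicator U u *\<^sub>R normal u) \<bullet> (b *\<^sub>R chart_map u + q)\<bar>) \<partial>lborel \<partial>flat_measure)"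
    unfolding img J_def .
qed

end

locale hypersurface =
  fixes S R :: "(real^'n::{finite,wellorder}) set" and n :: "real^'n::_ \<Rightarrow> real^'n::_"
  assumes closed_S: "closed S" and R_open: "openin (top_of_set S) R"
    and charts: "\<And>x. x \<in> R \<Longrightarrow> \<exists>U \<phi> \<phi>'. C1_parametrization S U \<phi> \<phi>' \<and> x \<in> \<phi> ` U"
    and n: "\<And>x. x \<in> R \<Longrightarrow> is_normal S x (n x)"
    and finite_S: "hausdorff_outer (CARD('n) - 1) S < top"
begin

abbreviation \<sigma> :: "(real^'n::_) measure" where "\<sigma> \<equiv> hausdorff_on (CARD('n) - 1) S"

lemma R_sub: "R \<subseteq> S"
  using openin_imp_subset[OF R_open] .

lemma S_borel [measurable]: "S \<in> sets borel"
  using closed_S by simp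

lemma R_borel [measurable]: "R \<in> sets borel"
proof -
  obtain T where "open T" "R = S \<inter> T" using R_open by (auto simp: openin_open)
  then show ?thesis by simp
qed

lemma finite_sigma: "finite_measure \<sigma>"
  by (rule finite_measureI) (use finite_S in \<open>simp add: emeasure_hausdorff_on\<close>)

text \<open>The sign of \<open>n\<close> may jump from point to point, but inside a chart the
  absolute value equals \<open>\<bar>normal u \<bullet> v\<bar> / norm (normal u)\<close>, which is
  continuous.\<close>

lemma abs_inner_normal_continuous: "continuous_on (R \<times> UNIV) (\<lambda>(y, v). \<bar>v \<bullet> n y\<bar>)"
proof (rule continuous_on_eq_continuous_within[THEN iffD2], rule ballI)
  fix z assume z: "z \<in> R \<times> (UNIV :: (real^'n::_) set)"
  obtain x v where xv: "z = (x, v)" "x \<in> R" using z by auto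
  obtain U \<phi> \<phi>' where c: "C1_parametrization S U \<phi> \<phi>'" "x \<in> \<phi> ` U" using charts[OF xv(2)] by blast
  interpret chart S U \<phi> \<phi>' by unfold_locales (use c closed_S in auto)
  obtain T where T: "open T" "\<phi> ` U = S \<inter> T" using image_open by (auto simp: openin_open)
  let ?A = "(R \<inter> T) \<times> (UNIV :: (real^'n::_) set)"
  have A: "R \<inter> T \<subseteq> \<phi> ` U" using R_sub T by auto
  have "continuous_on ?A (\<lambda>(y, v). \<bar>normal (chart_inv y) \<bullet> v\<bar> / norm (normal (chart_inv y)))"
  proof -
    have "continuous_on (\<phi> ` U) (\<lambda>y. normal (chart_inv y))"
      by (rule continuous_on_compose2[OF normal_cont chart_cont(2)]) (use inv_chart in auto)
    then have "continuous_on ?A (\<lambda>z. normal (chart_inv (fst z)))"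
      by (rule continuous_on_compose2) (use A in \<open>auto intro!: continuous_intros\<close>)
    moreover have "normal (chart_inv (fst z)) \<noteq> 0" if "z \<in> ?A" for z
      using that A inv_chart normal_nonzero by fastforce
    ultimately show ?thesis
      unfolding split_beta by (intro continuous_intros) auto
  qed
  moreover have "(case z of (y, v) \<Rightarrow> \<bar>normal (chart_inv y) \<bullet> v\<bar> / norm (normal (chart_inv y))) = (case z of (y, v) \<Rightarrow> \<bar>v \<bullet> n y\<bar>)"
    if "z \<in> ?A" for z
  proof -
    obtain y v where y: "z = (y, v)" "y \<in> R" "y \<in> \<phi> ` U" using \<open>z \<in> ?A\<close> A by auto
    then obtain u where u: "u \<in> U" "y = \<phi> u" by auto
    then show ?thesis
      using normal_inner[OF u(1), of "n y" v] n[OF y(2)] normal_nonzero[OF u(1)] y(1) by (simp add: inv_chart)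
  qed
  ultimately have cont: "continuous_on ?A (\<lambda>(y, v). \<bar>v \<bullet> n y\<bar>)"
    using continuous_on_cong[of ?A ?A "\<lambda>(y, v). \<bar>normal (chart_inv y) \<bullet> v\<bar> / norm (normal (chart_inv y))"] by blast
  have "z \<in> ?A" using xv c(2) T by auto
  then have "continuous (at z within ?A) (\<lambda>(y, v). \<bar>v \<bullet> n y\<bar>)"
    using cont continuous_on_eq_continuous_within by blast
  moreover have "at z within (R \<times> UNIV) = at z within ?A"
  proof (rule at_within_nhd)
    show "z \<in> T \<times> UNIV" "open (T \<times> (UNIV :: (real^'n::_) set))"
      using \<open>z \<in> ?A\<close> T by (auto intro: open_Times)
  qed auto
  ultimately show "continuous (at z within R \<times> UNIV) (\<lambda>(y, v). \<bar>v \<bullet> n y\<bar>)" by simp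
qed

lemma abs_inner_normal_measurable [measurable]:
  "(\<lambda>(y, v). indicator R y * \<bar>v \<bullet> n y\<bar> :: real) \<in> borel_measurable (borel \<Otimes>\<^sub>M borel)"
proof -
  have "R \<times> (UNIV :: (real^'n::_) set) \<in> sets borel"
    unfolding borel_prod[symmetric] by (intro pair_measureI) auto
  from borel_measurable_continuous_on_indicator[OF this abs_inner_normal_continuous]
  have "(\<lambda>z. indicator (R \<times> UNIV) z *\<^sub>R (case z of (y, v) \<Rightarrow> \<bar>v \<bullet> n y\<bar>)) \<in> borel_measurable (borel :: ((real^'n::_) \<times> (real^'n::_)) measure)" .
  also have "(\<lambda>z. indicator (R \<times> UNIV) z *\<^sub>R (case z of (y, v) \<Rightarrow> \<bar>v \<bullet> n y\<bar>)) =
      (\<lambda>(y, v). indicator R y * \<bar>v \<bullet> n y\<bar> :: real)"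
    by (auto simp: indicator_def fun_eq_iff)
  finally show ?thesis by (simp add: borel_prod)
qed

text \<open>The Jacobian of the sweep with respect to area times length, written without a chart.
  Being a Jacobian, it does not involve the translation \<open>p\<close>.\<close>

definition sweep_jac :: "real \<Rightarrow> real \<Rightarrow> real^'n::_ \<Rightarrow> real^'n::_ \<Rightarrow> real \<Rightarrow> ennreal" where
  "sweep_jac a b q y t = ennreal (\<bar>a + b * t\<bar> ^ (CARD('n) - 1) * (indicator R y * \<bar>(b *\<^sub>R y + q) \<bullet> n y\<bar>))"

lemma sweep_jac_measurable [measurable]:
  "(\<lambda>(y, t). sweep_jac a b q y t) \<in> borel_measurable (borel \<Otimes>\<^sub>M borel)"
proof -
  have "(\<lambda>y. indicator R y * \<bar>(b *\<^sub>R y + q) \<bullet> n y\<bar> :: real) \<in> borel_measurable borel"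
    using measurable_compose[OF _ abs_inner_normal_measurable, of "\<lambda>y. (y, b *\<^sub>R y + q)" borel] by simp
  then show ?thesis unfolding sweep_jac_def split_beta by measurable
qed

text \<open>In a chart, area contributes the factor \<open>norm (normal u)\<close>. By
  \<open>normal_inner\<close>, this factor times the cosine in \<open>sweep_jac\<close> is the inner
  product in the determinant of the swept chart.\<close>

lemma emeasure_sweep_local:
  assumes c: "C1_parametrization S U \<phi> \<phi>'"
    and E: "E \<in> sets (borel \<Otimes>\<^sub>M borel)" "E \<subseteq> (R \<inter> \<phi> ` U) \<times> UNIV"
    and pos: "\<And>y t. (y, t) \<in> E \<Longrightarrow> a + b * t > 0"
    and inj: "inj_on (sweep a b p q) E"
  shows "sweep a b p q ` E \<in> sets lebesgue"
    "(\<integral>\<^sup>+y. \<integral>\<^sup>+t. indicator E (y, t) * sweep_jac a b q y t \<partial>lborel \<partial>\<sigma>) =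
      flat_const TYPE('n) * emeasure lebesgue (sweep a b p q ` E)"
proof -
  interpret chart S U \<phi> \<phi>' by unfold_locales (use c closed_S in auto)
  have E_meas [measurable]: "E \<in> sets (borel \<Otimes>\<^sub>M borel)" by (rule E(1))
  define D where "D = {(u, t). u \<in> U \<and> (chart_map u, t) \<in> E}"
  have "D = (\<lambda>(u, t). (chart_map u, t)) -` E \<inter> (U \<times> UNIV)" by (auto simp: D_def)
  moreover have "(\<lambda>(u, t). (chart_map u, t)) -` E \<in> sets (borel \<Otimes>\<^sub>M borel)"
    using measurable_sets[of "\<lambda>(u, t). (chart_map u, t)" "borel \<Otimes>\<^sub>M borel" "borel \<Otimes>\<^sub>M borel" E] E(1)
    by (simp add: space_pair_measure)
  moreover have "U \<times> (UNIV :: real set) \<in> sets (borel \<Otimes>\<^sub>M borel)" by (intro pair_measureI) auto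
  ultimately have D: "D \<in> sets (borel \<Otimes>\<^sub>M borel)" by auto
  have DU: "D \<subseteq> U \<times> UNIV" by (auto simp: D_def)
  have D_iff: "(u, t) \<in> D \<longleftrightarrow> u \<in> U \<and> (\<phi> u, t) \<in> E" for u t
    by (auto simp: D_def chart_map_def)
  have img: "(\<lambda>(u, t). sweep a b p q (\<phi> u, t)) ` D = sweep a b p q ` E"
  proof (intro equalityI subsetI)
    fix w assume "w \<in> sweep a b p q ` E"
    then obtain y t where yt: "(y, t) \<in> E" "w = sweep a b p q (y, t)" by auto
    then obtain u where "u \<in> U" "y = \<phi> u" using E(2) by auto
    then show "w \<in> (\<lambda>(u, t). sweep a b p q (\<phi> u, t)) ` D" using yt by (force simp: D_iff)
  qed (auto simp: D_iff)
  have injD: "inj_on (\<lambda>(u, t). sweep a b p q (\<phi> u, t)) D"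
  proof (rule inj_onI)
    fix x y assume xy: "x \<in> D" "y \<in> D" "(case x of (u, t) \<Rightarrow> sweep a b p q (\<phi> u, t)) = (case y of (u, t) \<Rightarrow> sweep a b p q (\<phi> u, t))"
    obtain u s v t where eq: "x = (u, s)" "y = (v, t)" by (metis surj_pair)
    have "(\<phi> u, s) = (\<phi> v, t)" by (rule inj_onD[OF inj]) (use xy in \<open>auto simp: eq D_iff\<close>)
    moreover have "u \<in> U" "v \<in> U" using xy by (auto simp: eq D_iff)
    ultimately show "x = y" using inj_chart by (auto simp: eq dest: inj_onD)
  qed
  have posD: "a + b * t > 0" if "(u, t) \<in> D" for u t using that pos by (auto simp: D_iff)
  note sw = emeasure_sweep_chart[OF D DU posD injD, unfolded img]
  show "sweep a b p q ` E \<in> sets lebesgue" by (rule sw(1))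
  have inner_meas: "(\<lambda>y. \<integral>\<^sup>+t. indicator E (y, t) * sweep_jac a b q y t \<partial>lborel) \<in> borel_measurable borel"
    by measurable
  have "(\<integral>\<^sup>+y. \<integral>\<^sup>+t. indicator E (y, t) * sweep_jac a b q y t \<partial>lborel \<partial>\<sigma>) =
      (\<integral>\<^sup>+y. indicator (\<phi> ` U) y * (\<integral>\<^sup>+t. indicator E (y, t) * sweep_jac a b q y t \<partial>lborel) \<partial>\<sigma>)"
  proof (intro nn_integral_cong)
    fix y
    have "indicator E (y, t) = (0 :: ennreal)" if "y \<notin> \<phi> ` U" for t
      using that E(2) by (auto simp: indicator_def)
    then show "(\<integral>\<^sup>+t. indicator E (y, t) * sweep_jac a b q y t \<partial>lborel) =
        indicator (\<phi> ` U) y * (\<integral>\<^sup>+t. indicator E (y, t) * sweep_jac a b q y t \<partial>lborel)"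
      by (cases "y \<in> \<phi> ` U") auto
  qed
  also have "\<dots> = flat_const TYPE('n) * (\<integral>\<^sup>+u. area_density u *
      (\<integral>\<^sup>+t. indicator E (chart_map u, t) * sweep_jac a b q (chart_map u) t \<partial>lborel) \<partial>flat_measure)"
    by (rule nn_integral_image[OF inner_meas])
  also have "(\<integral>\<^sup>+u. area_density u *
      (\<integral>\<^sup>+t. indicator E (chart_map u, t) * sweep_jac a b q (chart_map u) t \<partial>lborel) \<partial>flat_measure) =
      (\<integral>\<^sup>+u. \<integral>\<^sup>+t. indicator D (u, t) * ennreal (\<bar>a + b * t\<bar> ^ (CARD('n) - 1) *
        \<bar>(indicator U u *\<^sub>R normal u) \<bullet> (b *\<^sub>R chart_map u + q)\<bar>) \<partial>lborel \<partial>flat_measure)"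
  proof (intro nn_integral_cong)
    fix u
    have "area_density u * (\<integral>\<^sup>+t. indicator E (chart_map u, t) * sweep_jac a b q (chart_map u) t \<partial>lborel) =
        (\<integral>\<^sup>+t. area_density u * (indicator E (chart_map u, t) * sweep_jac a b q (chart_map u) t) \<partial>lborel)"
      by (subst nn_integral_cmult) auto
    also have "\<dots> = (\<integral>\<^sup>+t. indicator D (u, t) * ennreal (\<bar>a + b * t\<bar> ^ (CARD('n) - 1) *
        \<bar>(indicator U u *\<^sub>R normal u) \<bullet> (b *\<^sub>R chart_map u + q)\<bar>) \<partial>lborel)"
    proof (intro nn_integral_cong)
      fix t
      show "area_density u * (indicator E (chart_map u, t) * sweep_jac a b q (chart_map u) t) =
          indicator D (u, t) * ennreal (\<bar>a + b * t\<bar> ^ (CARD('n) - 1) *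
          \<bar>(indicator U u *\<^sub>R normal u) \<bullet> (b *\<^sub>R chart_map u + q)\<bar>)"
      proof (cases "(u, t) \<in> D")
        case True
        then have u: "u \<in> U" "(\<phi> u, t) \<in> E" "\<phi> u \<in> R" using E(2) by (auto simp: D_iff)
        have "\<bar>normal u \<bullet> (b *\<^sub>R \<phi> u + q)\<bar> = norm (normal u) * \<bar>(b *\<^sub>R \<phi> u + q) \<bullet> n (\<phi> u)\<bar>"
          by (rule normal_inner[OF u(1) n[OF u(3)]])
        then show ?thesis
          using True u by (simp add: area_density_def sweep_jac_def chart_map_def ennreal_mult'[symmetric] mult_ac)
      next
        case False
        then have "u \<notin> U \<or> (chart_map u, t) \<notin> E" by (auto simp: D_def)
        then show ?thesis using False by (auto simp: area_density_zero)
      qed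
    qed
    finally show "area_density u * (\<integral>\<^sup>+t. indicator E (chart_map u, t) * sweep_jac a b q (chart_map u) t \<partial>lborel) =
        (\<integral>\<^sup>+t. indicator D (u, t) * ennreal (\<bar>a + b * t\<bar> ^ (CARD('n) - 1) *
        \<bar>(indicator U u *\<^sub>R normal u) \<bullet> (b *\<^sub>R chart_map u + q)\<bar>) \<partial>lborel)" .
  qed
  also have "\<dots> = emeasure lebesgue (sweep a b p q ` E)" by (rule sw(2)[symmetric])
  finally show "(\<integral>\<^sup>+y. \<integral>\<^sup>+t. indicator E (y, t) * sweep_jac a b q y t \<partial>lborel \<partial>\<sigma>) =
      flat_const TYPE('n) * emeasure lebesgue (sweep a b p q ` E)" .
qed

text \<open>The set is cut into countably many pieces that each lie over a single chart; global
  injectivity keeps their images disjoint, so the volumes add up.\<close>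

lemma emeasure_sweep:
  assumes E: "E \<in> sets (borel \<Otimes>\<^sub>M borel)" "E \<subseteq> R \<times> UNIV"
    and pos: "\<And>y t. (y, t) \<in> E \<Longrightarrow> a + b * t > 0"
    and inj: "inj_on (sweep a b p q) E"
  shows "sweep a b p q ` E \<in> sets lebesgue"
    "(\<integral>\<^sup>+y. \<integral>\<^sup>+t. indicator E (y, t) * sweep_jac a b q y t \<partial>lborel \<partial>\<sigma>) =
      flat_const TYPE('n) * emeasure lebesgue (sweep a b p q ` E)"
proof -
  have "sweep a b p q ` E \<in> sets lebesgue \<and>
    (\<integral>\<^sup>+y. \<integral>\<^sup>+t. indicator E (y, t) * sweep_jac a b q y t \<partial>lborel \<partial>\<sigma>) =
      flat_const TYPE('n) * emeasure lebesgue (sweep a b p q ` E)"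
  proof (cases "R = {}")
    case True
    then show ?thesis using E by auto
  next
    case False
    define good where "good T \<longleftrightarrow> open T \<and> (\<exists>U \<phi> \<phi>'. C1_parametrization S U \<phi> \<phi>' \<and> S \<inter> T \<subseteq> \<phi> ` U)" for T
    have "\<exists>T. good T \<and> x \<in> T" if "x \<in> R" for x
    proof -
      obtain U \<phi> \<phi>' where c: "C1_parametrization S U \<phi> \<phi>'" "x \<in> \<phi> ` U" using charts[OF \<open>x \<in> R\<close>] by blast
      then obtain T where "open T" "\<phi> ` U = S \<inter> T" by (auto simp: C1_parametrization_def openin_open)
      then show ?thesis using c unfolding good_def by blast
    qed
    moreover have "open T" if "good T" for T using that by (simp add: good_def)
    ultimately obtain V where goodV: "\<And>m. good (V m)" and dV: "\<And>m. disjointed V m \<in> sets borel"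
      and cov: "R \<subseteq> (\<Union>m. disjointed V m)"
      using countable_disjointed_cover[OF False, of good] by blast
    define D where "D m = E \<inter> (disjointed V m \<times> UNIV)" for m
    have DE: "D m \<subseteq> E" for m by (auto simp: D_def)
    have D [measurable]: "D m \<in> sets (borel \<Otimes>\<^sub>M borel)" for m
      unfolding D_def using E(1) dV[of m] by (intro sets.Int pair_measureI) auto
    have disj: "disjoint_family D"
      using disjoint_family_disjointed[of V] by (fastforce simp: D_def disjoint_family_on_def)
    have UD: "(\<Union>m. D m) = E" using E(2) cov by (auto simp: D_def)
    have loc: "sweep a b p q ` D m \<in> sets lebesgue"
      "(\<integral>\<^sup>+y. \<integral>\<^sup>+t. indicator (D m) (y, t) * sweep_jac a b q y t \<partial>lborel \<partial>\<sigma>) =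
        flat_const TYPE('n) * emeasure lebesgue (sweep a b p q ` D m)" for m
    proof -
      obtain U \<phi> \<phi>' where c: "C1_parametrization S U \<phi> \<phi>'" "S \<inter> V m \<subseteq> \<phi> ` U"
        using goodV[of m] unfolding good_def by blast
      have sub: "D m \<subseteq> (R \<inter> \<phi> ` U) \<times> UNIV"
        using E(2) R_sub c(2) disjointed_subset[of V m] unfolding D_def by fast
      have inj': "inj_on (sweep a b p q) (D m)" using inj DE by (rule inj_on_subset)
      note l = emeasure_sweep_local[OF c(1) D sub _ inj']
      show "sweep a b p q ` D m \<in> sets lebesgue" by (rule l(1)) (use pos DE in auto)
      show "(\<integral>\<^sup>+y. \<integral>\<^sup>+t. indicator (D m) (y, t) * sweep_jac a b q y t \<partial>lborel \<partial>\<sigma>) =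
        flat_const TYPE('n) * emeasure lebesgue (sweep a b p q ` D m)" by (rule l(2)) (use pos DE in auto)
    qed
    have img: "sweep a b p q ` E = (\<Union>m. sweep a b p q ` D m)" using UD by auto
    have "(\<integral>\<^sup>+y. \<integral>\<^sup>+t. indicator E (y, t) * sweep_jac a b q y t \<partial>lborel \<partial>\<sigma>) =
        (\<integral>\<^sup>+y. \<integral>\<^sup>+t. (\<Sum>m. indicator (D m) (y, t) * sweep_jac a b q y t) \<partial>lborel \<partial>\<sigma>)"
      using suminf_indicator[OF disj] by (simp add: UD)
    also have "\<dots> = (\<integral>\<^sup>+y. (\<Sum>m. \<integral>\<^sup>+t. indicator (D m) (y, t) * sweep_jac a b q y t \<partial>lborel) \<partial>\<sigma>)"
      by (intro nn_integral_cong nn_integral_suminf) measurable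
    also have "\<dots> = (\<Sum>m. \<integral>\<^sup>+y. \<integral>\<^sup>+t. indicator (D m) (y, t) * sweep_jac a b q y t \<partial>lborel \<partial>\<sigma>)"
      by (intro nn_integral_suminf) measurable
    also have "\<dots> = (\<Sum>m. flat_const TYPE('n) * emeasure lebesgue (sweep a b p q ` D m))"
      by (simp only: loc(2))
    also have "\<dots> = flat_const TYPE('n) * (\<Sum>m. emeasure lebesgue (sweep a b p q ` D m))" by simp
    also have "(\<Sum>m. emeasure lebesgue (sweep a b p q ` D m)) = emeasure lebesgue (\<Union>m. sweep a b p q ` D m)"
    proof (rule suminf_emeasure)
      show "range (\<lambda>m. sweep a b p q ` D m) \<subseteq> sets lebesgue" using loc(1) by auto
      show "disjoint_family (\<lambda>m. sweep a b p q ` D m)"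
        unfolding disjoint_family_on_def
      proof (intro ballI impI)
        fix i j :: nat assume "i \<noteq> j"
        then have "D i \<inter> D j = {}" using disj by (auto simp: disjoint_family_on_def)
        moreover have "sweep a b p q ` D i \<inter> sweep a b p q ` D j = sweep a b p q ` (D i \<inter> D j)"
          by (rule inj_on_image_Int[OF inj DE DE, symmetric])
        ultimately show "sweep a b p q ` D i \<inter> sweep a b p q ` D j = {}" by simp
      qed
    qed
    finally show ?thesis using loc(1) by (auto simp: img)
  qed
  then show "sweep a b p q ` E \<in> sets lebesgue"
    "(\<integral>\<^sup>+y. \<integral>\<^sup>+t. indicator E (y, t) * sweep_jac a b q y t \<partial>lborel \<partial>\<sigma>) =
      flat_const TYPE('n) * emeasure lebesgue (sweep a b p q ` E)" by auto
qed

text \<open>The swept set is only known to be Lebesgue measurable. The Borel set \<open>W\<close>,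
  which differs from it by a null set, makes the statement one about Borel measures.\<close>

theorem nn_integral_sweep:
  assumes E: "E \<in> sets (borel \<Otimes>\<^sub>M borel)" "E \<subseteq> R \<times> UNIV"
    and pos: "\<And>y t. (y, t) \<in> E \<Longrightarrow> a + b * t > 0"
    and inj: "inj_on (sweep a b p q) E"
    and W: "W \<in> sets borel" "sweep a b p q ` E \<subseteq> W" "negligible (W - sweep a b p q ` E)"
    and f [measurable]: "f \<in> borel_measurable borel"
  shows "(\<integral>\<^sup>+y. \<integral>\<^sup>+t. indicator E (y, t) * sweep_jac a b q y t * f (sweep a b p q (y, t)) \<partial>lborel \<partial>\<sigma>) =
      flat_const TYPE('n) * (\<integral>\<^sup>+z. indicator W z * f z \<partial>lborel)"
proof -
  let ?\<kappa> = "flat_const TYPE('n)" and ?\<Psi> = "sweep a b p q"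
  have E_meas [measurable]: "E \<in> sets (borel \<Otimes>\<^sub>M borel)" by (rule E(1))
  have W_meas [measurable]: "W \<in> sets borel" by (rule W(1))
  define h where "h = (\<lambda>(y, t). indicator E (y, t) * sweep_jac a b q y t)"
  have h_meas [measurable]: "h \<in> borel_measurable (borel \<Otimes>\<^sub>M borel)" unfolding h_def by measurable
  have h' [measurable]: "h \<in> borel_measurable (\<sigma> \<Otimes>\<^sub>M lborel)"
  proof -
    have "sets (\<sigma> \<Otimes>\<^sub>M lborel) = sets (borel \<Otimes>\<^sub>M (borel :: real measure))" by (intro sets_pair_measure_cong) auto
    then show ?thesis using h_meas measurable_cong_sets by blast
  qed
  have \<Psi>' [measurable]: "?\<Psi> \<in> borel_measurable (\<sigma> \<Otimes>\<^sub>M lborel)"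
  proof -
    have "sets (\<sigma> \<Otimes>\<^sub>M lborel) = sets (borel \<Otimes>\<^sub>M (borel :: real measure))" by (intro sets_pair_measure_cong) auto
    then show ?thesis using sweep_measurable measurable_cong_sets by blast
  qed
  let ?M = "distr (density (\<sigma> \<Otimes>\<^sub>M lborel) h) borel ?\<Psi>" and ?N = "density lborel (\<lambda>z. ?\<kappa> * indicator W z)"
  have "?M = ?N"
  proof (rule measure_eqI)
    fix A assume "A \<in> sets ?M"
    then have A [measurable]: "A \<in> sets borel" by simp
    define E' where "E' = E \<inter> ?\<Psi> -` A"
    have vim: "?\<Psi> -` A \<in> sets (borel \<Otimes>\<^sub>M borel)"
      using measurable_sets[OF sweep_measurable A, of a b p q] by (simp add: space_pair_measure)
    have E': "E' \<in> sets (borel \<Otimes>\<^sub>M borel)" "E' \<subseteq> R \<times> UNIV" using E vim by (auto simp: E'_def)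
    have E'_meas [measurable]: "E' \<in> sets (borel \<Otimes>\<^sub>M borel)" by (rule E'(1))
    have injE': "inj_on ?\<Psi> E'" using inj by (rule inj_on_subset) (auto simp: E'_def)
    note sw = emeasure_sweep[OF E' _ injE']
    have posE': "a + b * t > 0" if "(y, t) \<in> E'" for y t using that pos by (auto simp: E'_def)
    have vim': "?\<Psi> -` A \<inter> space (\<sigma> \<Otimes>\<^sub>M lborel) \<in> sets (\<sigma> \<Otimes>\<^sub>M lborel)"
      by (rule measurable_sets[OF \<Psi>' A])
    have "emeasure ?M A = (\<integral>\<^sup>+z. h z * indicator (?\<Psi> -` A \<inter> space (\<sigma> \<Otimes>\<^sub>M lborel)) z \<partial>(\<sigma> \<Otimes>\<^sub>M lborel))"
      using vim' by (subst emeasure_distr) (auto simp: emeasure_density)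
    also have "\<dots> = (\<integral>\<^sup>+z. h z * indicator A (?\<Psi> z) \<partial>(\<sigma> \<Otimes>\<^sub>M lborel))"
      by (intro nn_integral_cong) (auto simp: space_pair_measure split: split_indicator)
    also have "\<dots> = (\<integral>\<^sup>+y. \<integral>\<^sup>+t. h (y, t) * indicator A (?\<Psi> (y, t)) \<partial>lborel \<partial>\<sigma>)"
      by (rule lborel.nn_integral_fst[symmetric]) measurable
    also have "\<dots> = (\<integral>\<^sup>+y. \<integral>\<^sup>+t. indicator E' (y, t) * sweep_jac a b q y t \<partial>lborel \<partial>\<sigma>)"
      by (intro nn_integral_cong) (auto simp: h_def E'_def split: split_indicator)
    also have "\<dots> = ?\<kappa> * emeasure lebesgue (?\<Psi> ` E')" by (rule sw(2)) (rule posE')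
    also have "emeasure lebesgue (?\<Psi> ` E') = emeasure lebesgue (W \<inter> A)"
    proof (rule emeasure_eq_AE)
      have null: "W - ?\<Psi> ` E \<in> null_sets lebesgue" using W(3) by (simp add: negligible_iff_null_sets)
      show "AE x in lebesgue. (x \<in> ?\<Psi> ` E') = (x \<in> W \<inter> A)"
        using AE_not_in[OF null] by eventually_elim (use W(2) in \<open>auto simp: E'_def\<close>)
      show "?\<Psi> ` E' \<in> sets lebesgue" by (rule sw(1)) (rule posE')
    qed auto
    also have "emeasure lebesgue (W \<inter> A) = (\<integral>\<^sup>+z. indicator (W \<inter> A) z \<partial>lborel)" by simp
    also have "\<dots> = (\<integral>\<^sup>+z. indicator W z * indicator A z \<partial>lborel)"
      by (intro nn_integral_cong) (simp split: split_indicator)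
    also have "?\<kappa> * \<dots> = (\<integral>\<^sup>+z. ?\<kappa> * indicator W z * indicator A z \<partial>lborel)"
      by (subst nn_integral_cmult[symmetric]) (auto simp: mult.assoc)
    also have "\<dots> = emeasure ?N A" by (subst emeasure_density) auto
    finally show "emeasure ?M A = emeasure ?N A" .
  qed simp
  have "(\<integral>\<^sup>+y. \<integral>\<^sup>+t. indicator E (y, t) * sweep_jac a b q y t * f (?\<Psi> (y, t)) \<partial>lborel \<partial>\<sigma>) =
      (\<integral>\<^sup>+y. \<integral>\<^sup>+t. h (y, t) * f (?\<Psi> (y, t)) \<partial>lborel \<partial>\<sigma>)" by (simp add: h_def)
  also have "\<dots> = (\<integral>\<^sup>+z. h z * f (?\<Psi> z) \<partial>(\<sigma> \<Otimes>\<^sub>M lborel))"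
    by (rule lborel.nn_integral_fst) measurable
  also have "\<dots> = (\<integral>\<^sup>+z. f z \<partial>?M)"
    by (subst nn_integral_distr) (auto simp: nn_integral_density)
  also have "\<dots> = (\<integral>\<^sup>+z. f z \<partial>?N)" by (simp only: \<open>?M = ?N\<close>)
  also have "\<dots> = ?\<kappa> * (\<integral>\<^sup>+z. indicator W z * f z \<partial>lborel)"
    by (subst nn_integral_density) (auto simp: nn_integral_cmult mult.assoc)
  finally show ?thesis .
qed

end

subsection \<open>Boundary points of a domain\<close>

text \<open>Near \<open>x\<close> the surface stays in a thin double wedge around its tangent plane.
  Points of \<open>S\<close> close to \<open>x\<close> have parameters close to \<open>u\<close>,
  because the chart covers a relative neighbourhood and its inverse is continuous; so
  differentiability at \<open>u\<close> controls all of them.\<close>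

lemma chart_flat:
  assumes S: "closed S" and c: "C1_parametrization S U \<phi> \<phi>'" "u \<in> U" "\<phi> u = x"
    and v: "norm v = 1" "\<And>h. h \<in> base_hyperplane \<Longrightarrow> v \<bullet> blinfun_apply (\<phi>' u) h = 0" and e: "e > 0"
  obtains \<delta> where "\<delta> > 0" "\<And>y. y \<in> S \<Longrightarrow> dist y x < \<delta> \<Longrightarrow> \<bar>(y - x) \<bullet> v\<bar> \<le> e * norm (y - x)"
proof -
  interpret chart S U \<phi> \<phi>' by unfold_locales (use c S in auto)
  let ?A = "blinfun_apply (\<phi>' u)"
  have "?A z = 0 \<longrightarrow> z = 0" if "z \<in> base_hyperplane" for z
    using deriv(2)[OF c(2)] that linear_0[OF linear_deriv, of u]
    by (metis inj_onD subspace_0 subspace_base)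
  then obtain m where m: "m > 0" "\<And>z. z \<in> base_hyperplane \<Longrightarrow> m * norm z \<le> norm (?A z)"
    using injective_imp_isometric[OF closed_base subspace_base blinfun.bounded_linear_right, of "\<phi>' u"] by auto
  \<comment> \<open>The bound \<open>m / 2\<close> keeps \<open>norm (z - u)\<close> comparable to
    \<open>norm (y - x)\<close>; the bound \<open>e * m / 2\<close> then produces the required slope
    \<open>e\<close>.\<close>
  define \<eta> where "\<eta> = min (m / 2) (e * m / 2)"
  have \<eta>: "\<eta> > 0" "\<eta> \<le> m / 2" "\<eta> \<le> e * m / 2" using m e by (auto simp: \<eta>_def)
  obtain d where d: "d > 0" "\<And>z. z \<in> base_hyperplane \<Longrightarrow> norm (z - u) < d \<Longrightarrow>
      norm (\<phi> z - \<phi> u - ?A (z - u)) \<le> \<eta> * norm (z - u)"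
    using deriv(1)[OF c(2)] \<eta>(1) unfolding has_derivative_within_alt by blast
  obtain T where T: "open T" "\<phi> ` U = S \<inter> T" using image_open by (auto simp: openin_open)
  have xU: "x \<in> \<phi> ` U" using c by auto
  then obtain d1 where d1: "d1 > 0" "ball x d1 \<subseteq> T" using T by (metis IntD2 openE)
  have "\<exists>d2>0. \<forall>y\<in>\<phi> ` U. dist y x < d2 \<longrightarrow> dist (chart_inv y) (chart_inv x) < d"
    using chart_cont(2) xU d(1) unfolding continuous_on_iff by blast
  then obtain d2 where d2: "d2 > 0" "\<And>y. y \<in> \<phi> ` U \<Longrightarrow> dist y x < d2 \<Longrightarrow> dist (chart_inv y) (chart_inv x) < d"
    by auto
  show ?thesis
  proof (rule that[of "min d1 d2"])
    show "min d1 d2 > 0" using d1 d2 by simp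
    fix y assume y: "y \<in> S" "dist y x < min d1 d2"
    have "y \<in> T" using d1 y by (auto simp: dist_commute subset_iff)
    then have yU: "y \<in> \<phi> ` U" using T y by auto
    then obtain z where z: "z \<in> U" "y = \<phi> z" by auto
    have "dist (chart_inv y) (chart_inv x) < d" using d2(2)[OF yU] y by simp
    then have "norm (z - u) < d" using z c by (auto simp: dist_norm inv_chart)
    then have r: "norm (y - x - ?A (z - u)) \<le> \<eta> * norm (z - u)"
      using d(2)[of z] z c(3) U_base by auto
    have zu: "z - u \<in> base_hyperplane" using z(1) c(2) U_base subspace_diff[OF subspace_base] by auto
    have "m * norm (z - u) \<le> norm (?A (z - u))" by (rule m(2)[OF zu])
    also have "\<dots> \<le> norm (y - x) + \<eta> * norm (z - u)"
      using r norm_triangle_sub[of "?A (z - u)" "y - x"] by (simp add: norm_minus_commute)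
    also have "\<dots> \<le> norm (y - x) + m / 2 * norm (z - u)"
      using \<eta> by (intro add_left_mono mult_right_mono) auto
    finally have h: "m / 2 * norm (z - u) \<le> norm (y - x)" by (simp add: field_simps)
    have "(y - x) \<bullet> v = (y - x - ?A (z - u)) \<bullet> v"
      using v(2)[OF zu] by (simp add: inner_diff_left inner_commute[of "?A (z - u)"])
    also have "\<bar>\<dots>\<bar> \<le> norm (y - x - ?A (z - u)) * norm v" by (rule Cauchy_Schwarz_ineq2)
    also have "\<dots> \<le> \<eta> * norm (z - u)" using r v(1) by simp
    also have "\<dots> \<le> e * m / 2 * norm (z - u)" using \<eta> by (intro mult_right_mono) auto
    also have "\<dots> = e * (m / 2 * norm (z - u))" by simp
    also have "\<dots> \<le> e * norm (y - x)" using h e by (intro mult_left_mono) auto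
    finally show "\<bar>(y - x) \<bullet> v\<bar> \<le> e * norm (y - x)" .
  qed
qed

text \<open>The normal direction belongs to the surface and not to the chart: moving along
  \<open>s *\<^sub>R h\<close> in the second chart gives points of \<open>S\<close>, and the
  flatness seen in the first chart forces their first order displacement to be orthogonal to
  \<open>v\<close>.\<close>

lemma chart_normal_is_normal:
  assumes S: "closed S" and c: "C1_parametrization S U \<phi> \<phi>'" "u \<in> U" "\<phi> u = x"
    and v: "norm v = 1" "\<And>h. h \<in> base_hyperplane \<Longrightarrow> v \<bullet> blinfun_apply (\<phi>' u) h = 0"
  shows "is_normal S x v"
  unfolding is_normal_def
proof (intro conjI allI impI ballI v(1))
  fix U2 \<phi>2 \<phi>2' u2 h
  assume c2: "C1_parametrization S U2 \<phi>2 \<phi>2'" "u2 \<in> U2" "\<phi>2 u2 = x" and h: "h \<in> (base_hyperplane :: (real^'a::_) set)"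
  interpret c2: chart S U2 \<phi>2 \<phi>2' by unfold_locales (use c2 S in auto)
  let ?A = "blinfun_apply (\<phi>2' u2)"
  have bound: "\<bar>v \<bullet> ?A h\<bar> \<le> e * (norm (?A h) + 2 * norm h)" if e: "0 < e" "e < 1" for e
  proof -
    obtain \<delta> where \<delta>: "\<delta> > 0" "\<And>y. y \<in> S \<Longrightarrow> dist y x < \<delta> \<Longrightarrow> \<bar>(y - x) \<bullet> v\<bar> \<le> e * norm (y - x)"
      using chart_flat[OF S c v e(1)] by blast
    obtain d where d: "d > 0" "\<And>z. z \<in> base_hyperplane \<Longrightarrow> norm (z - u2) < d \<Longrightarrow>
      norm (\<phi>2 z - \<phi>2 u2 - ?A (z - u2)) \<le> e * norm (z - u2)"
      using c2.deriv(1)[OF c2(2)] e(1) unfolding has_derivative_within_alt by blast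
    obtain T where T: "open T" "U2 = base_hyperplane \<inter> T" using c2.U_open by (auto simp: openin_open)
    obtain d1 where d1: "d1 > 0" "ball u2 d1 \<subseteq> T" using T c2(2) by (metis IntD2 openE)
    \<comment> \<open>Small enough for the moved parameter to stay in the second chart and in the
      range of its linear approximation, and for the image point to stay where the flatness estimate
      holds.\<close>
    define s where "s = min (min (d / 2) (d1 / 2) / (norm h + 1)) (\<delta> / 2 / (norm (?A h) + norm h + 1))"
    have den: "norm h + 1 > 0" "norm (?A h) + norm h + 1 > 0"
      by (simp_all add: add_nonneg_pos)
    have s: "s > 0" using den d(1) d1(1) \<delta>(1) by (simp add: s_def)
    have s1: "s * (norm h + 1) \<le> min (d / 2) (d1 / 2)"
    proof -
      have "s \<le> min (d / 2) (d1 / 2) / (norm h + 1)" by (simp add: s_def)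
      then show ?thesis using den(1) by (simp add: pos_le_divide_eq)
    qed
    have s2: "s * (norm (?A h) + norm h + 1) \<le> \<delta> / 2"
    proof -
      have "s \<le> \<delta> / 2 / (norm (?A h) + norm h + 1)" by (simp add: s_def)
      then show ?thesis using den(2) by (simp only: pos_le_divide_eq)
    qed
    have sh: "s * norm h < d" "s * norm h < d1"
      using s1 s d(1) d1(1) by (auto simp: algebra_simps)
    define z where "z = u2 + s *\<^sub>R h"
    have zb: "z \<in> base_hyperplane"
      unfolding z_def using h c2(2) c2.U_base
      by (auto intro!: subspace_add[OF subspace_base] subspace_scale[OF subspace_base])
    have "z \<in> ball u2 d1" using sh s by (simp add: z_def dist_norm)
    then have zU: "z \<in> U2" using zb T d1 by auto
    define y where "y = \<phi>2 z"
    have y: "y \<in> S" using zU c2.image_subset by (auto simp: y_def)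
    have "norm (\<phi>2 z - \<phi>2 u2 - ?A (z - u2)) \<le> e * norm (z - u2)"
      by (rule d(2)[OF zb]) (use sh s in \<open>simp add: z_def\<close>)
    then have r: "norm (y - x - s *\<^sub>R ?A h) \<le> e * (s * norm h)"
      using s by (simp add: y_def c2(3) z_def linear_scale[OF c2.linear_deriv])
    have "norm (y - x) \<le> norm (s *\<^sub>R ?A h) + norm (y - x - s *\<^sub>R ?A h)" by (rule norm_triangle_sub)
    also have "\<dots> \<le> s * norm (?A h) + e * (s * norm h)" using r s by simp
    finally have n1: "norm (y - x) \<le> s * norm (?A h) + e * (s * norm h)" .
    also have "\<dots> \<le> s * norm (?A h) + 1 * (s * norm h)" using e s by (intro add_left_mono mult_right_mono) auto
    also have "\<dots> < \<delta>" using s2 s \<delta>(1) by (simp add: algebra_simps)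
    finally have "\<bar>(y - x) \<bullet> v\<bar> \<le> e * norm (y - x)" using \<delta>(2)[OF y] by (simp add: dist_norm)
    also have "\<dots> \<le> e * (s * norm (?A h) + e * (s * norm h))" using n1 e by (intro mult_left_mono) auto
    also have "\<dots> \<le> e * (s * norm (?A h) + 1 * (s * norm h))"
      using e s by (intro mult_left_mono add_left_mono mult_right_mono) auto
    finally have b1: "\<bar>(y - x) \<bullet> v\<bar> \<le> e * (s * norm (?A h) + s * norm h)" by simp
    have "\<bar>(y - x - s *\<^sub>R ?A h) \<bullet> v\<bar> \<le> norm (y - x - s *\<^sub>R ?A h) * norm v" by (rule Cauchy_Schwarz_ineq2)
    then have b2: "\<bar>(y - x) \<bullet> v - s * (?A h \<bullet> v)\<bar> \<le> e * (s * norm h)"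
      using r v(1) by (simp add: inner_diff_left)
    have "s * \<bar>?A h \<bullet> v\<bar> = \<bar>s * (?A h \<bullet> v)\<bar>" using s by (simp add: abs_mult)
    also have "\<dots> \<le> e * (s * norm (?A h) + s * norm h) + e * (s * norm h)" using b1 b2 by linarith
    also have "\<dots> = s * (e * (norm (?A h) + 2 * norm h))" by (simp add: algebra_simps)
    finally show ?thesis using s by (simp add: inner_commute)
  qed
  have "\<bar>v \<bullet> ?A h\<bar> \<le> 0"
  proof (rule field_le_epsilon)
    fix e :: real assume e: "e > 0"
    define K where "K = norm (?A h) + 2 * norm h + 1"
    have K: "K > 0" by (simp add: K_def add_nonneg_pos)
    define c where "c = min (1/2) (e / K)"
    have "0 < c" "c < 1" using e K by (auto simp: c_def)
    then have "\<bar>v \<bullet> ?A h\<bar> \<le> c * (norm (?A h) + 2 * norm h)" by (rule bound)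
    also have "\<dots> \<le> c * K" using \<open>0 < c\<close> by (intro mult_left_mono) (auto simp: K_def)
    also have "\<dots> \<le> e / K * K" using K by (intro mult_right_mono) (auto simp: c_def)
    also have "\<dots> = e" using K by simp
    finally show "\<bar>v \<bullet> ?A h\<bar> \<le> 0 + e" by simp
  qed
  then show "v \<bullet> ?A h = 0" by simp
qed

section \<open>Lipschitz boundaries: finite area, and the two sides at a boundary point\<close>

lemma lipschitz_graph:
  fixes D :: "(real^'n::{finite,wellorder}) set"
  assumes "lipschitz_boundary D" "x \<in> frontier D"
  obtains T \<epsilon> f L where "orthogonal_transformation (T :: real^'n::_ \<Rightarrow> real^'n::_)" "\<epsilon> > 0"
    "L-lipschitz_on base_hyperplane f" "f 0 = (0::real)"
    "\<And>y. y \<in> ball x \<epsilon> \<Longrightarrow> y \<in> D \<longleftrightarrow> T (y - x) $ last_index > f (base_proj (T (y - x)))"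
proof -
  obtain \<epsilon> I f L where I: "\<epsilon> > 0" "affine_isometry I" "I x = 0" "L-lipschitz_on base_hyperplane f" "f 0 = (0::real)"
    and img: "I ` (D \<inter> ball x \<epsilon>) = {z \<in> ball 0 \<epsilon>. z $ last_index > f (base_proj z)}"
    using assms(1)[unfolded lipschitz_boundary_def, rule_format, OF assms(2)] by (elim exE conjE) (rule that)
  obtain T b where T: "orthogonal_transformation T" "I = (\<lambda>z. T z + b)"
    using I(2) by (auto simp: affine_isometry_def)
  have linT: "linear T" using T(1) by (rule orthogonal_transformation_linear)
  have "b = - T x" using I(3) T(2) by (simp add: eq_neg_iff_add_eq_0 add.commute)
  then have Iy: "I y = T (y - x)" for y using T(2) linear_diff[OF linT, of y x] by simp
  show ?thesis
  proof (rule that[OF T(1) I(1,4,5)])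
    fix y assume y: "y \<in> ball x \<epsilon>"
    have "inj I" using orthogonal_transformation_inj[OF T(1)] by (auto simp: T(2) inj_def)
    have "y \<in> D \<longleftrightarrow> I y \<in> I ` (D \<inter> ball x \<epsilon>)" using \<open>inj I\<close> y by (auto simp: inj_image_mem_iff)
    also have "\<dots> \<longleftrightarrow> T (y - x) $ last_index > f (base_proj (T (y - x)))"
    proof -
      have "I y \<in> ball 0 \<epsilon>"
        using y orthogonal_transformation_norm[OF T(1), of "y - x"] by (simp add: Iy dist_norm norm_minus_commute)
      then show ?thesis unfolding img by (simp add: Iy)
    qed
    finally show "y \<in> D \<longleftrightarrow> T (y - x) $ last_index > f (base_proj (T (y - x)))" .
  qed
qed

text \<open>Near \<open>x\<close> the frontier is contained in the zero set of \<open>F\<close>,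
  hence up to a rigid motion in the graph of a Lipschitz function over a bounded part of the
  hyperplane.\<close>

lemma frontier_graph_finite:
  fixes D :: "(real^'n::{finite,wellorder}) set"
  assumes D: "open D" "lipschitz_boundary D" "x \<in> frontier D"
  obtains \<epsilon> where "\<epsilon> > 0" "hausdorff_outer (CARD('n) - 1) (frontier D \<inter> ball x \<epsilon>) < top"
proof -
  obtain T \<epsilon> f L where T: "orthogonal_transformation (T :: real^'n::_ \<Rightarrow> real^'n::_)" and \<epsilon>: "\<epsilon> > 0"
    and f: "L-lipschitz_on base_hyperplane f" "f 0 = (0::real)"
    and graph: "\<And>y. y \<in> ball x \<epsilon> \<Longrightarrow> y \<in> D \<longleftrightarrow> T (y - x) $ last_index > f (base_proj (T (y - x)))"
    using lipschitz_graph[OF D(2,3)] by metis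
  have linT: "linear T" using T by (rule orthogonal_transformation_linear)
  have L: "L \<ge> 0" using f(1) by (rule lipschitz_on_nonneg)
  define F where "F y = T (y - x) $ last_index - f (base_proj (T (y - x)))" for y
  have contT: "continuous_on UNIV T" using linT by (rule linear_continuous_on[OF linear_conv_bounded_linear[THEN iffD1]])
  have contT': "continuous_on UNIV (\<lambda>y. T (y - x))"
    by (rule continuous_on_compose2[OF contT]) (auto intro!: continuous_intros)
  have "continuous_on UNIV (\<lambda>y. f (base_proj (T (y - x))))"
    by (rule continuous_on_compose2[OF lipschitz_on_continuous_on[OF f(1)]
        continuous_on_compose2[OF continuous_base_proj[of UNIV] contT']]) auto
  then have contF: "continuous_on UNIV F"
    unfolding F_def using contT' by (intro continuous_intros)
  \<comment> \<open>A positive value would place \<open>y\<close> in the open set \<open>D\<close>;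
    a negative value would persist in a neighbourhood that misses \<open>D\<close>.\<close>
  have F0: "F y = 0" if y: "y \<in> frontier D" "y \<in> ball x \<epsilon>" for y
  proof -
    have "y \<notin> D" using y(1) D(1) by (simp add: frontier_def interior_open)
    then have "\<not> F y > 0" using graph[OF y(2)] by (simp add: F_def)
    moreover have "\<not> F y < 0"
    proof
      assume "F y < 0"
      have "open {z. F z < 0}" using contF by (intro open_Collect_less) auto
      then have "open ({z. F z < 0} \<inter> ball x \<epsilon>)" by auto
      moreover have "y \<in> ({z. F z < 0} \<inter> ball x \<epsilon>) \<inter> closure D" using \<open>F y < 0\<close> y by (auto simp: frontier_def)
      ultimately have "({z. F z < 0} \<inter> ball x \<epsilon>) \<inter> D \<noteq> {}" using open_Int_closure_eq_empty by blast
      then obtain z where "z \<in> D" "F z < 0" "z \<in> ball x \<epsilon>" by blast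
      then show False using graph[of z] by (simp add: F_def)
    qed
    ultimately show ?thesis by simp
  qed
  define g where "g u = u + f u *\<^sub>R (last_axis :: real^'n::_)" for u
  let ?P = "frontier D \<inter> ball x \<epsilon>" and ?k = "CARD('n) - 1"
  have sub: "(\<lambda>y. T (y - x)) ` ?P \<subseteq> g ` (base_hyperplane \<inter> cball 0 \<epsilon>)"
  proof clarsimp
    fix y assume y: "y \<in> frontier D" "dist x y < \<epsilon>"
    let ?z = "T (y - x)"
    have "F y = 0" using F0 y by simp
    then have "?z = g (base_proj ?z)"
      using base_proj_decomp[of ?z] by (simp add: g_def F_def)
    moreover have "norm (base_proj ?z) \<le> \<epsilon>"
      using norm_base_proj_le[of ?z] y T by (simp add: orthogonal_transformation_norm dist_norm norm_minus_commute)
    ultimately show "?z \<in> g ` (base_hyperplane \<inter> cball 0 \<epsilon>)"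
      by (intro image_eqI[of _ _ "base_proj ?z"]) auto
  qed
  have "hausdorff_outer ?k ?P = hausdorff_outer ?k ((\<lambda>y. T (y - x)) ` ?P)"
    by (rule outer_isometry_image[symmetric])
      (simp add: dist_norm linear_diff[OF linT, symmetric] orthogonal_transformation_norm[OF T])
  also have "\<dots> \<le> hausdorff_outer ?k (g ` (base_hyperplane \<inter> cball 0 \<epsilon>))"
    by (rule outer_mono[OF sub])
  also have "\<dots> \<le> ennreal ((1 + L) ^ ?k) * hausdorff_outer ?k (base_hyperplane \<inter> cball (0 :: real^'n::_) \<epsilon>)"
  proof (rule outer_lipschitz_image)
    fix u v :: "real^'n::_" assume uv: "u \<in> base_hyperplane \<inter> cball 0 \<epsilon>" "v \<in> base_hyperplane \<inter> cball 0 \<epsilon>"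
    have "dist (g u) (g v) = norm ((u - v) + (f u - f v) *\<^sub>R (last_axis :: real^'n::_))"
      by (simp add: g_def dist_norm algebra_simps)
    also have "\<dots> \<le> norm (u - v) + \<bar>f u - f v\<bar>"
      by (rule norm_triangle_le) simp
    also have "\<bar>f u - f v\<bar> \<le> L * dist u v"
      using lipschitz_onD[OF f(1), of u v] uv by (auto simp: dist_real_def)
    finally show "dist (g u) (g v) \<le> (1 + L) * dist u v" by (simp add: dist_norm algebra_simps)
  qed (use L in auto)
  also have "\<dots> < top"
    using outer_base_cball_finite[where 'n = 'n, of \<epsilon>] by (simp add: ennreal_mult_less_top)
  finally show ?thesis using that \<epsilon> by blast
qed

text \<open>Compactness reduces the claim to finitely many of the balls above. The boundary measure
  is thereby finite, as the Fubini arguments require.\<close>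

lemma frontier_finite:
  fixes D :: "(real^'n::{finite,wellorder}) set"
  assumes D: "open D" "lipschitz_boundary D" "bounded D"
  shows "hausdorff_outer (CARD('n) - 1) (frontier D) < top"
proof -
  let ?k = "CARD('n) - 1"
  have "\<exists>\<epsilon>>0. hausdorff_outer ?k (frontier D \<inter> ball x \<epsilon>) < top" if "x \<in> frontier D" for x
    using frontier_graph_finite[OF D(1,2) that] by blast
  then obtain \<epsilon> where \<epsilon>: "\<And>x. x \<in> frontier D \<Longrightarrow> \<epsilon> x > 0"
    "\<And>x. x \<in> frontier D \<Longrightarrow> hausdorff_outer ?k (frontier D \<inter> ball x (\<epsilon> x)) < top"
    by metis
  have "compact (frontier D)" using D(3) by (simp add: compact_frontier_bounded)
  moreover have "frontier D \<subseteq> (\<Union>x\<in>frontier D. ball x (\<epsilon> x))" using \<epsilon>(1) by force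
  ultimately obtain X where X: "X \<subseteq> frontier D" "finite X" "frontier D \<subseteq> (\<Union>x\<in>X. ball x (\<epsilon> x))"
    using compactE_image[of "frontier D" "frontier D" "\<lambda>x. ball x (\<epsilon> x)"] by blast
  have "hausdorff_outer ?k (\<Union>x\<in>Y. frontier D \<inter> ball x (\<epsilon> x)) < top" if "finite Y" "Y \<subseteq> frontier D" for Y
    using that
  proof (induction Y)
    case (insert x Y)
    have "hausdorff_outer ?k (\<Union>x\<in>insert x Y. frontier D \<inter> ball x (\<epsilon> x)) \<le>
        hausdorff_outer ?k (frontier D \<inter> ball x (\<epsilon> x)) + hausdorff_outer ?k (\<Union>x\<in>Y. frontier D \<inter> ball x (\<epsilon> x))"
      by (simp only: UN_insert outer_Un_le)
    also have "\<dots> < top" using insert \<epsilon>(2)[of x] by (simp add: ennreal_add_less_top)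
    finally show ?case .
  qed simp
  moreover have "(\<Union>x\<in>X. frontier D \<inter> ball x (\<epsilon> x)) = frontier D" using X by auto
  ultimately show ?thesis using X(1,2) by metis
qed

text \<open>All directions between \<open>w0\<close> and \<open>w\<close> leave the tangent plane
  with a slope bounded below, so by flatness the segment from \<open>x + t *\<^sub>R w0\<close> to
  \<open>x + t *\<^sub>R w\<close> avoids the frontier for small \<open>t\<close>. A connected set
  that avoids the frontier lies entirely inside or entirely outside \<open>D\<close>.\<close>

lemma cone_same_side:
  fixes D :: "(real^'n::{finite,wellorder}) set"
  assumes c: "C1_parametrization (frontier D) U \<phi> \<phi>'" "u \<in> U" "\<phi> u = x"
    and v: "norm v = 1" "\<And>h. h \<in> base_hyperplane \<Longrightarrow> v \<bullet> blinfun_apply (\<phi>' u) h = 0"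
    and w: "w0 \<bullet> v > 0" "w \<bullet> v > 0"
  obtains \<delta> where "\<delta> > 0" "\<And>t. 0 < t \<Longrightarrow> t < \<delta> \<Longrightarrow> x + t *\<^sub>R w0 \<in> D \<longleftrightarrow> x + t *\<^sub>R w \<in> D"
proof -
  define lo where "lo = min (w0 \<bullet> v) (w \<bullet> v)"
  define hi where "hi = max (norm w0) (norm w)"
  have lo: "lo > 0" using w by (simp add: lo_def)
  have "w \<noteq> 0" using w by auto
  then have hi: "hi > 0" by (simp add: hi_def less_max_iff_disj)
  have seg: "w' \<bullet> v \<ge> lo" "norm w' \<le> hi" if "w' \<in> closed_segment w0 w" for w'
  proof -
    have "closed_segment w0 w \<subseteq> {z. v \<bullet> z \<ge> lo}"
      by (intro closed_segment_subset convex_halfspace_ge) (auto simp: lo_def inner_commute)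
    then show "w' \<bullet> v \<ge> lo" using that by (auto simp: inner_commute)
    have "closed_segment w0 w \<subseteq> cball 0 hi"
      by (intro closed_segment_subset) (auto simp: hi_def)
    then show "norm w' \<le> hi" using that by auto
  qed
  \<comment> \<open>Half of a lower bound for the slopes, which makes the flatness estimate
    contradict a frontier point on the segment.\<close>
  have "lo / (2 * hi) > 0" using lo hi by simp
  then obtain d where d: "d > 0" "\<And>y. y \<in> frontier D \<Longrightarrow> dist y x < d \<Longrightarrow> \<bar>(y - x) \<bullet> v\<bar> \<le> lo / (2 * hi) * norm (y - x)"
    using chart_flat[OF frontier_closed c v] by blast
  show ?thesis
  proof (rule that[of "d / hi"])
    show "d / hi > 0" using d hi by simp
    fix t assume t: "0 < t" "t < d / hi"
    let ?S = "(\<lambda>w'. x + t *\<^sub>R w') ` closed_segment w0 w"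
    have "?S \<inter> frontier D = {}"
    proof (rule ccontr)
      assume "?S \<inter> frontier D \<noteq> {}"
      then obtain w' where w': "w' \<in> closed_segment w0 w" "x + t *\<^sub>R w' \<in> frontier D" by auto
      have "t * norm w' \<le> t * hi" using seg(2)[OF w'(1)] t by simp
      also have "\<dots> < d" using t hi by (simp add: pos_less_divide_eq)
      finally have "dist (x + t *\<^sub>R w') x < d" using t by (simp add: dist_norm)
      from d(2)[OF w'(2) this] have "t * \<bar>w' \<bullet> v\<bar> \<le> t * (lo / (2 * hi) * norm w')"
        using t by (simp add: abs_mult mult_ac)
      then have "\<bar>w' \<bullet> v\<bar> \<le> lo / (2 * hi) * norm w'" using t(1) by (rule mult_left_le_imp_le)
      also have "\<dots> \<le> lo / (2 * hi) * hi" using seg(2)[OF w'(1)] lo hi by (intro mult_left_mono) auto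
      also have "\<dots> = lo / 2" using hi by simp
      finally show False using seg(1)[OF w'(1)] lo by simp
    qed
    moreover have "connected ?S"
      by (intro connected_continuous_image continuous_intros) simp
    ultimately have "?S \<inter> D = {} \<or> ?S - D = {}" using connected_Int_frontier by blast
    moreover have "x + t *\<^sub>R w0 \<in> ?S" "x + t *\<^sub>R w \<in> ?S" by auto
    ultimately show "x + t *\<^sub>R w0 \<in> D \<longleftrightarrow> x + t *\<^sub>R w \<in> D" by blast
  qed
qed

text \<open>The upward direction of the graph leads into \<open>D\<close> and its opposite leads out
  of it. As it might be orthogonal to the given \<open>v\<close>, it is then tilted towards
  \<open>v\<close> by an amount that keeps it steeper than the graph.\<close>

lemma lipschitz_cone:
  fixes D :: "(real^'n::{finite,wellorder}) set"
  assumes D: "lipschitz_boundary D" "x \<in> frontier D" and v: "norm v = 1"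
  obtains w \<delta> where "w \<bullet> v \<noteq> 0" "\<delta> > 0" "\<And>t. 0 < t \<Longrightarrow> t < \<delta> \<Longrightarrow> x + t *\<^sub>R w \<in> D"
    "\<And>t. 0 < t \<Longrightarrow> t < \<delta> \<Longrightarrow> x + t *\<^sub>R (- w) \<notin> D"
proof -
  obtain T \<epsilon> f L where T: "orthogonal_transformation (T :: real^'n::_ \<Rightarrow> real^'n::_)" and \<epsilon>: "\<epsilon> > 0"
    and f: "L-lipschitz_on base_hyperplane f" "f 0 = (0::real)"
    and graph: "\<And>y. y \<in> ball x \<epsilon> \<Longrightarrow> y \<in> D \<longleftrightarrow> T (y - x) $ last_index > f (base_proj (T (y - x)))"
    using lipschitz_graph[OF D] by metis
  have linT: "linear T" using T by (rule orthogonal_transformation_linear)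
  have L: "L \<ge> 0" using f(1) by (rule lipschitz_on_nonneg)
  obtain e' where e': "T e' = last_axis" using orthogonal_transformation_surj[OF T] by (metis surjD)
  \<comment> \<open>With \<open>s = 1 / (L + 2)\<close> the tilted direction has horizontal part at
    most \<open>s\<close> and vertical part at least \<open>1 - s\<close>, and
    \<open>L * s < 1 - s\<close>.\<close>
  define s where "s = (if e' \<bullet> v \<noteq> 0 then 0 else 1 / (L + 2))"
  have s: "0 \<le> s" "s * (L + 2) \<le> 1" using L by (auto simp: s_def)
  define w where "w = e' + s *\<^sub>R v"
  have "v \<bullet> v = 1" using v by (simp add: norm_eq_1)
  then have wv: "w \<bullet> v \<noteq> 0" using L by (simp add: w_def inner_add_left s_def)
  have Tw: "T w = last_axis + s *\<^sub>R T v" by (simp add: w_def linear_add[OF linT] linear_scale[OF linT] e')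
  have nTv: "norm (T v) = 1" using T v by (simp add: orthogonal_transformation_norm)
  have "L * norm (base_proj (T w)) \<le> L * s"
  proof -
    have "base_proj (T w) = s *\<^sub>R base_proj (T v)" unfolding Tw by (simp only: base_proj_add base_proj_scaleR base_proj_last_axis) simp
    then have "norm (base_proj (T w)) \<le> s" using norm_base_proj_le[of "T v"] nTv s(1) by (simp add: mult_left_le)
    then show ?thesis using L by (intro mult_left_mono) auto
  qed
  moreover have "T w $ last_index \<ge> 1 - s"
  proof -
    have "\<bar>T v $ last_index\<bar> \<le> 1" using component_le_norm_cart[of "T v" last_index] nTv by simp
    then have "s * (- 1) \<le> s * (T v $ last_index)" using s(1) by (intro mult_left_mono) auto
    then show ?thesis by (simp add: Tw)
  qed
  moreover have "L * s < 1 - s"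
    using s L by (cases "s = 0") (auto simp: algebra_simps)
  ultimately have cone: "T w $ last_index > L * norm (base_proj (T w))" by linarith
  have fbound: "\<bar>f (base_proj (t *\<^sub>R T w))\<bar> \<le> \<bar>t\<bar> * (L * norm (base_proj (T w)))" for t
    using lipschitz_onD[OF f(1) base_proj_in_base[of "t *\<^sub>R T w"] subspace_0[OF subspace_base]] f(2)
    by (simp add: dist_norm base_proj_scaleR mult_ac)
  have near: "x + t *\<^sub>R w \<in> ball x \<epsilon>" if "\<bar>t\<bar> < \<epsilon> / (norm w + 1)" for t
  proof -
    have "\<bar>t\<bar> * (norm w + 1) < \<epsilon>" using that by (simp add: pos_less_divide_eq add_nonneg_pos)
    then have "\<bar>t\<bar> * norm w < \<epsilon>" by (simp add: algebra_simps)
    then show ?thesis by (simp add: dist_norm)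
  qed
  show ?thesis
  proof (rule that[OF wv, of "\<epsilon> / (norm w + 1)"])
    show "\<epsilon> / (norm w + 1) > 0" using \<epsilon> by (simp add: add_nonneg_pos)
    fix t assume t: "0 < t" "t < \<epsilon> / (norm w + 1)"
    have c: "t * (L * norm (base_proj (T w))) < t * (T w $ last_index)" using cone t by simp
    show "x + t *\<^sub>R w \<in> D"
    proof -
      have "\<bar>f (base_proj (t *\<^sub>R T w))\<bar> \<le> t * (L * norm (base_proj (T w)))" using fbound[of t] t by simp
      then have "f (base_proj (t *\<^sub>R T w)) < t * (T w $ last_index)" using c by linarith
      then show ?thesis using graph[OF near[of t]] t by (simp add: linear_scale[OF linT])
    qed
    have "x + (- t) *\<^sub>R w \<notin> D"
    proof -
      have "\<bar>f (base_proj ((- t) *\<^sub>R T w))\<bar> \<le> t * (L * norm (base_proj (T w)))" using fbound[of "- t"] t by simp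
      then have "\<not> f (base_proj ((- t) *\<^sub>R T w)) < - (t * (T w $ last_index))" using c by linarith
      moreover have "T (x + (- t) *\<^sub>R w - x) = (- t) *\<^sub>R T w"
        by (simp only: add_diff_cancel_left' linear_scale[OF linT])
      ultimately show ?thesis using graph[OF near[of "- t"]] t by simp
    qed
    then show "x + t *\<^sub>R (- w) \<notin> D" by simp
  qed
qed

text \<open>A chart determines the unit normal up to sign. The Lipschitz condition supplies one
  direction that leads inside while its opposite leads outside, which selects the sign;
  \<open>cone_same_side\<close> extends this to all directions that are not tangential. So the
  description in \<open>inner_normal\<close> has exactly one solution.\<close>

lemma inner_normal_props:
  fixes D :: "(real^'n::{finite,wellorder}) set"
  assumes adm: "admissible_domain D R" and x: "x \<in> R"
  shows "is_normal (frontier D) x (inner_normal D x)"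
    "w \<bullet> inner_normal D x > 0 \<Longrightarrow> \<exists>\<delta>>0. \<forall>t. 0 < t \<and> t < \<delta> \<longrightarrow> x + t *\<^sub>R w \<in> D"
    "w \<bullet> inner_normal D x < 0 \<Longrightarrow> \<exists>\<delta>>0. \<forall>t. 0 < t \<and> t < \<delta> \<longrightarrow> x + t *\<^sub>R w \<notin> D"
proof -
  have lip: "lipschitz_boundary D" and ae: "ae_C1_boundary D R"
    using adm by (auto simp: admissible_domain_def)
  have xf: "x \<in> frontier D" using ae x openin_imp_subset by (auto simp: ae_C1_boundary_def)
  obtain U \<phi> \<phi>' u where c: "C1_parametrization (frontier D) U \<phi> \<phi>'" "u \<in> U" "\<phi> u = x"
  proof -
    obtain U \<phi> \<phi>' where "C1_parametrization (frontier D) U \<phi> \<phi>'" "x \<in> \<phi> ` U"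
      using ae x unfolding ae_C1_boundary_def by metis
    then show ?thesis using that by blast
  qed
  interpret chart "frontier D" U \<phi> \<phi>' by unfold_locales (use c in auto)
  let ?A = "blinfun_apply (\<phi>' u)"
  obtain v0 where v0: "norm v0 = 1" "\<And>h. h \<in> base_hyperplane \<Longrightarrow> v0 \<bullet> ?A h = 0"
    using orthogonal_vector_exists[OF linear_deriv] by blast
  obtain w0 \<delta>0 where w0: "w0 \<bullet> v0 \<noteq> 0" and \<delta>0: "\<delta>0 > 0" "\<And>t. 0 < t \<Longrightarrow> t < \<delta>0 \<Longrightarrow> x + t *\<^sub>R w0 \<in> D"
    "\<And>t. 0 < t \<Longrightarrow> t < \<delta>0 \<Longrightarrow> x + t *\<^sub>R (- w0) \<notin> D"
    using lipschitz_cone[OF lip xf v0(1)] by metis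
  \<comment> \<open>Oriented so that the known inward direction \<open>w0\<close> lies on its
    positive side.\<close>
  define v where "v = (if w0 \<bullet> v0 > 0 then v0 else - v0)"
  have v: "norm v = 1" "\<And>h. h \<in> base_hyperplane \<Longrightarrow> v \<bullet> ?A h = 0"
    using v0 by (auto simp: v_def)
  have w0v: "w0 \<bullet> v > 0" using w0 by (auto simp: v_def)
  have in_D: "\<exists>\<delta>>0. \<forall>t. 0 < t \<and> t < \<delta> \<longrightarrow> x + t *\<^sub>R w \<in> D" if wv: "w \<bullet> v > 0" for w
  proof -
    obtain \<delta> where "\<delta> > 0" "\<And>t. 0 < t \<Longrightarrow> t < \<delta> \<Longrightarrow> x + t *\<^sub>R w0 \<in> D \<longleftrightarrow> x + t *\<^sub>R w \<in> D"
      using cone_same_side[OF c v w0v wv] by blast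
    then show ?thesis using \<delta>0 by (intro exI[of _ "min \<delta> \<delta>0"]) auto
  qed
  have out_D: "\<exists>\<delta>>0. \<forall>t. 0 < t \<and> t < \<delta> \<longrightarrow> x + t *\<^sub>R w \<notin> D" if "w \<bullet> v < 0" for w
  proof -
    have v': "norm (- v) = 1" "\<And>h. h \<in> base_hyperplane \<Longrightarrow> (- v) \<bullet> ?A h = 0" using v by auto
    have "(- w0) \<bullet> (- v) > 0" "w \<bullet> (- v) > 0" using w0v that by auto
    then obtain \<delta> where "\<delta> > 0" "\<And>t. 0 < t \<Longrightarrow> t < \<delta> \<Longrightarrow> x + t *\<^sub>R (- w0) \<in> D \<longleftrightarrow> x + t *\<^sub>R w \<in> D"
      using cone_same_side[OF c v'] by blast
    then show ?thesis using \<delta>0 by (intro exI[of _ "min \<delta> \<delta>0"]) auto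
  qed
  have normal_v: "is_normal (frontier D) x v" by (rule chart_normal_is_normal[OF frontier_closed c v])
  have vv: "v \<bullet> v = 1" using v(1) by (simp add: norm_eq_1)
  have "inner_normal D x = v"
    unfolding inner_normal_def
  proof (rule the_equality)
    show "norm v = 1 \<and> (\<exists>U \<phi> \<phi>'. C1_parametrization (frontier D) U \<phi> \<phi>' \<and>
      (\<exists>u\<in>U. \<phi> u = x \<and> (\<forall>h\<in>base_hyperplane. v \<bullet> blinfun_apply (\<phi>' u) h = 0))) \<and>
      (\<exists>\<delta>>0. \<forall>t. 0 < t \<and> t < \<delta> \<longrightarrow> x + t *\<^sub>R v \<in> D)"
      using v c in_D[of v] vv by fastforce
    fix v2
    assume v2: "norm v2 = 1 \<and> (\<exists>U \<phi> \<phi>'. C1_parametrization (frontier D) U \<phi> \<phi>' \<and>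
      (\<exists>u\<in>U. \<phi> u = x \<and> (\<forall>h\<in>base_hyperplane. v2 \<bullet> blinfun_apply (\<phi>' u) h = 0))) \<and>
      (\<exists>\<delta>>0. \<forall>t. 0 < t \<and> t < \<delta> \<longrightarrow> x + t *\<^sub>R v2 \<in> D)"
    then obtain U2 \<phi>2 \<phi>2' u2 where c2: "C1_parametrization (frontier D) U2 \<phi>2 \<phi>2'" "u2 \<in> U2" "\<phi>2 u2 = x"
      "\<And>h. h \<in> base_hyperplane \<Longrightarrow> v2 \<bullet> blinfun_apply (\<phi>2' u2) h = 0" by blast
    have "is_normal (frontier D) x v2"
      using chart_normal_is_normal[OF frontier_closed c2(1,2,3) _ c2(4)] v2 by blast
    then have v2A: "v2 \<bullet> ?A h = 0" if "h \<in> base_hyperplane" for h using c that by (auto simp: is_normal_def)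
    obtain \<delta>2 where \<delta>2: "\<delta>2 > 0" "\<And>t. 0 < t \<Longrightarrow> t < \<delta>2 \<Longrightarrow> x + t *\<^sub>R v2 \<in> D" using v2 by blast
    have n2: "norm v2 = 1" using v2 by blast
    note p1 = surface_normal_parallel[OF linear_deriv deriv(2)[OF c(2)] v]
      and p2 = surface_normal_parallel[OF linear_deriv deriv(2)[OF c(2)] n2 v2A]
    have N: "norm (normal u) \<noteq> 0" using normal_nonzero[OF c(2)] by simp
    define a1 where "a1 = normal u \<bullet> v"
    define a2 where "a2 = normal u \<bullet> v2"
    have "a2 *\<^sub>R v2 = a1 *\<^sub>R v" using p1(1) p2(1) by (simp add: a1_def a2_def)
    moreover have "\<bar>a1\<bar> = \<bar>a2\<bar>" "a2 \<noteq> 0" using p1(2) p2(2) N by (auto simp: a1_def a2_def)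
    ultimately have "v2 = v \<or> v2 = - v"
      by (metis abs_eq_iff minus_minus scaleR_cancel_left scaleR_minus_left scaleR_minus_right)
    moreover have "v2 \<noteq> - v"
    proof
      assume "v2 = - v"
      then have "v2 \<bullet> v < 0" using vv by simp
      then obtain \<delta> where "\<delta> > 0" "\<And>t. 0 < t \<Longrightarrow> t < \<delta> \<Longrightarrow> x + t *\<^sub>R v2 \<notin> D" using out_D by blast
      moreover define t where "t = min \<delta> \<delta>2 / 2"
      ultimately have "0 < t" "t < \<delta>" "t < \<delta>2" "x + t *\<^sub>R v2 \<notin> D" using \<delta>2(1) by auto
      then show False using \<delta>2(2) by blast
    qed
    ultimately show "v2 = v" by blast
  qed
  then show "is_normal (frontier D) x (inner_normal D x)"
    "w \<bullet> inner_normal D x > 0 \<Longrightarrow> \<exists>\<delta>>0. \<forall>t. 0 < t \<and> t < \<delta> \<longrightarrow> x + t *\<^sub>R w \<in> D"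
    "w \<bullet> inner_normal D x < 0 \<Longrightarrow> \<exists>\<delta>>0. \<forall>t. 0 < t \<and> t < \<delta> \<longrightarrow> x + t *\<^sub>R w \<notin> D"
    using normal_v in_D out_D by auto
qed


locale bounded_domain =
  fixes D R :: "(real^'n::{finite,wellorder}) set"
  assumes adm: "admissible_domain D R" and bdd: "bounded D" and dim: "CARD('n) \<ge> 2"
begin

lemma open_D: "open D"
  using adm by (simp add: admissible_domain_def)

lemma D_borel [measurable]: "D \<in> sets borel"
  using open_D by simp

sublocale hypersurface "frontier D" R "inner_normal D"
proof
  show "hausdorff_outer (CARD('n) - 1) (frontier D) < top"
    using adm bdd by (intro frontier_finite) (auto simp: admissible_domain_def)
qed (use adm inner_normal_props(1) in \<open>auto simp: admissible_domain_def ae_C1_boundary_def\<close>)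

lemma frontier_notin: "x \<in> frontier D \<Longrightarrow> x \<notin> D"
  using open_D by (simp add: frontier_def interior_open)

lemma R_notin: "x \<in> R \<Longrightarrow> x \<notin> D"
  using R_sub frontier_notin by blast

lemma null_rest: "hausdorff_outer (CARD('n) - 1) (frontier D - R) = 0"
proof -
  have "frontier D - R \<in> sets borel" by measurable
  then show ?thesis
    using adm by (simp add: admissible_domain_def ae_C1_boundary_def area_def emeasure_hausdorff)
qed

lemma norm_inner_normal: "x \<in> R \<Longrightarrow> norm (inner_normal D x) = 1"
  using n by (simp add: is_normal_def)

end

subsection \<open>Exit times\<close>

definition exit_time :: "'a::real_vector set \<Rightarrow> 'a \<Rightarrow> 'a \<Rightarrow> real" where
  "exit_time G z w = (if w = 0 then 0 else Sup {t. 0 \<le> t \<and> (\<forall>s. 0 < s \<and> s \<le> t \<longrightarrow> z + s *\<^sub>R w \<in> G)})"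

lemma exit_time_zero [simp]: "exit_time G z 0 = 0"
  by (simp add: exit_time_def)

text \<open>A compact piece of a ray inside \<open>G\<close> keeps a positive distance from the
  complement, so it stays inside under small changes of base point and direction.\<close>

lemma open_all_in:
  fixes G :: "'a::euclidean_space set"
  assumes G: "open G"
  shows "open {p. \<forall>s\<in>{\<alpha>..\<beta>}. fst p + s *\<^sub>R snd p \<in> G}"
proof (rule openI)
  fix p assume p: "p \<in> {p. \<forall>s\<in>{\<alpha>..\<beta>}. fst p + s *\<^sub>R snd p \<in> G}"
  define K where "K = (\<lambda>s. fst p + s *\<^sub>R snd p) ` {\<alpha>..\<beta>}"
  have "compact K" unfolding K_def by (intro compact_continuous_image continuous_intros) auto
  moreover have "K \<subseteq> G" using p by (auto simp: K_def)
  ultimately obtain e where e: "e > 0" "(\<Union>x\<in>K. ball x e) \<subseteq> G"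
    using compact_subset_open_imp_ball_epsilon_subset[OF _ G] by blast
  define M where "M = \<bar>\<alpha>\<bar> + \<bar>\<beta>\<bar> + 1"
  have M: "M \<ge> 1" by (simp add: M_def)
  have "ball p (e / (2 * M)) \<subseteq> {p. \<forall>s\<in>{\<alpha>..\<beta>}. fst p + s *\<^sub>R snd p \<in> G}"
  proof clarsimp
    fix z w s assume d: "dist p (z, w) < e / (2 * M)" and s: "\<alpha> \<le> s" "s \<le> \<beta>"
    have d1: "norm (fst p - z) < e / (2 * M)" "norm (snd p - w) < e / (2 * M)"
      using d dist_fst_le[of p "(z, w)"] dist_snd_le[of p "(z, w)"] by (auto simp: dist_norm)
    have "dist (fst p + s *\<^sub>R snd p) (z + s *\<^sub>R w) = norm ((fst p - z) + s *\<^sub>R (snd p - w))"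
      by (simp add: dist_norm algebra_simps)
    also have "\<dots> \<le> norm (fst p - z) + \<bar>s\<bar> * norm (snd p - w)" by (rule norm_triangle_le) simp
    also have "\<dots> \<le> norm (fst p - z) + M * norm (snd p - w)"
      using s by (intro add_left_mono mult_right_mono) (auto simp: M_def)
    also have "\<dots> < e / (2 * M) + M * (e / (2 * M))"
      using d1 M by (intro add_strict_mono mult_strict_left_mono) auto
    also have "\<dots> \<le> e / 2 + e / 2"
    proof (rule add_mono)
      show "e / (2 * M) \<le> e / 2" using M e(1) by (intro divide_left_mono) auto
    qed (use M in simp)
    finally have "z + s *\<^sub>R w \<in> ball (fst p + s *\<^sub>R snd p) e" by simp
    moreover have "fst p + s *\<^sub>R snd p \<in> K" using s by (auto simp: K_def)
    ultimately show "z + s *\<^sub>R w \<in> G" using e(2) by blast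
  qed
  moreover have "e / (2 * M) > 0" using e(1) M by simp
  ultimately show "\<exists>r>0. ball p r \<subseteq> {p. \<forall>s\<in>{\<alpha>..\<beta>}. fst p + s *\<^sub>R snd p \<in> G}" by blast
qed

context bounded_domain
begin

abbreviation \<tau> where "\<tau> \<equiv> exit_time D"

lemma exit_bdd:
  assumes "w \<noteq> 0"
  shows "bdd_above {t. 0 \<le> t \<and> (\<forall>s. 0 < s \<and> s \<le> t \<longrightarrow> z + s *\<^sub>R w \<in> D)}"
proof -
  obtain B where B: "\<And>x. x \<in> D \<Longrightarrow> norm x \<le> B" using bdd by (auto simp: bounded_iff)
  show ?thesis
  proof (rule bdd_aboveI[of _ "max 0 ((B + norm z) / norm w)"])
    fix t assume t: "t \<in> {t. 0 \<le> t \<and> (\<forall>s. 0 < s \<and> s \<le> t \<longrightarrow> z + s *\<^sub>R w \<in> D)}"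
    show "t \<le> max 0 ((B + norm z) / norm w)"
    proof (cases "t = 0")
      case False
      then have "z + t *\<^sub>R w \<in> D" using t by auto
      then have "norm (t *\<^sub>R w) \<le> B + norm z"
        using B[of "z + t *\<^sub>R w"] norm_triangle_sub[of "t *\<^sub>R w" "- z"] by (simp add: add.commute)
      then show ?thesis using assms t by (simp add: pos_le_divide_eq le_max_iff_disj)
    qed simp
  qed
qed

lemma exit_geI:
  assumes "w \<noteq> 0" "\<And>s. 0 < s \<Longrightarrow> s < t \<Longrightarrow> z + s *\<^sub>R w \<in> D"
  shows "t \<le> \<tau> z w"
proof (rule dense_le)
  fix r assume r: "r < t"
  show "r \<le> \<tau> z w"
  proof (cases "r \<ge> 0")
    case True
    then show ?thesis unfolding exit_time_def using assms r by (auto intro!: cSup_upper exit_bdd)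
  next
    case False
    have "0 \<le> \<tau> z w" unfolding exit_time_def using assms(1) by (auto intro!: cSup_upper exit_bdd)
    then show ?thesis using False by simp
  qed
qed

lemma exit_nonneg: "0 \<le> \<tau> z w"
  using exit_geI[of w 0 z] by (cases "w = 0") auto

lemma exit_in:
  assumes "0 < s" "s < \<tau> z w"
  shows "z + s *\<^sub>R w \<in> D"
proof -
  have w: "w \<noteq> 0" using assms by auto
  then have "s < Sup {t. 0 \<le> t \<and> (\<forall>s. 0 < s \<and> s \<le> t \<longrightarrow> z + s *\<^sub>R w \<in> D)}"
    using assms by (simp add: exit_time_def)
  then obtain t where "s < t" "\<forall>s. 0 < s \<and> s \<le> t \<longrightarrow> z + s *\<^sub>R w \<in> D"
    by (subst (asm) less_cSup_iff) (auto simp: exit_bdd[OF w] intro!: exI[of _ 0])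
  then show ?thesis using assms by auto
qed

lemma exit_notin:
  assumes w: "w \<noteq> 0"
  shows "z + \<tau> z w *\<^sub>R w \<notin> D"
proof
  assume "z + \<tau> z w *\<^sub>R w \<in> D"
  then obtain e where e: "e > 0" "ball (z + \<tau> z w *\<^sub>R w) e \<subseteq> D" using open_D by (metis openE)
  have "\<tau> z w + e / norm w \<le> \<tau> z w"
  proof (rule exit_geI[OF w])
    fix s assume s: "0 < s" "s < \<tau> z w + e / norm w"
    show "z + s *\<^sub>R w \<in> D"
    proof (cases "s < \<tau> z w")
      case False
      then have "(s - \<tau> z w) * norm w < e" "0 \<le> s - \<tau> z w" using s w by (auto simp: field_simps)
      moreover have "dist (z + \<tau> z w *\<^sub>R w) (z + s *\<^sub>R w) = \<bar>s - \<tau> z w\<bar> * norm w"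
      proof -
        have "z + \<tau> z w *\<^sub>R w - (z + s *\<^sub>R w) = (\<tau> z w - s) *\<^sub>R w" by (simp add: algebra_simps)
        then show ?thesis by (simp add: dist_norm abs_minus_commute)
      qed
      ultimately have "z + s *\<^sub>R w \<in> ball (z + \<tau> z w *\<^sub>R w) e" by simp
      then show ?thesis using e by blast
    qed (use s exit_in in auto)
  qed
  moreover have "e / norm w > 0" using e w by simp
  ultimately show False by simp
qed

lemma exit_eqI:
  assumes "w \<noteq> 0" "t > 0" "\<And>s. 0 < s \<Longrightarrow> s < t \<Longrightarrow> z + s *\<^sub>R w \<in> D" "z + t *\<^sub>R w \<notin> D"
  shows "\<tau> z w = t"
proof (rule antisym)
  show "t \<le> \<tau> z w" by (rule exit_geI[OF assms(1,3)])
  show "\<tau> z w \<le> t" using exit_in[of t z w] assms(2,4) by (meson not_le)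
qed

lemma exit_scale:
  assumes c: "c > 0"
  shows "\<tau> z (c *\<^sub>R w) = \<tau> z w / c"
proof (cases "w = 0")
  case False
  have le: "c * \<tau> z (c *\<^sub>R w) \<le> \<tau> z w" if "c > 0" "w \<noteq> 0" for c and w
  proof (rule exit_geI[OF that(2)])
    fix s assume s: "0 < s" "s < c * \<tau> z (c *\<^sub>R w)"
    then have "z + (s / c) *\<^sub>R (c *\<^sub>R w) \<in> D" using that by (intro exit_in) (auto simp: field_simps)
    then show "z + s *\<^sub>R w \<in> D" using that by simp
  qed
  have "inverse c * \<tau> z (inverse c *\<^sub>R (c *\<^sub>R w)) \<le> \<tau> z (c *\<^sub>R w)"
    using c False by (intro le) auto
  then have "\<tau> z w / c \<le> \<tau> z (c *\<^sub>R w)" using c by (simp add: field_simps)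
  moreover have "\<tau> z (c *\<^sub>R w) \<le> \<tau> z w / c" using le[OF c False] c by (simp add: field_simps)
  ultimately show ?thesis by simp
qed simp

lemma exit_pos:
  assumes "z \<in> D" "w \<noteq> 0"
  shows "\<tau> z w > 0"
  using exit_notin[OF assms(2), of z] exit_nonneg[of z w] assms(1) by (cases "\<tau> z w = 0") auto

lemma exit_frontier:
  assumes "\<tau> z w > 0"
  shows "z + \<tau> z w *\<^sub>R w \<in> frontier D"
proof -
  have w: "w \<noteq> 0" using assms by auto
  have "z + \<tau> z w *\<^sub>R w \<in> closure D"
    unfolding closure_approachable
  proof (intro allI impI)
    fix e :: real assume e: "e > 0"
    define \<eta> where "\<eta> = min (\<tau> z w / 2) (e / (2 * norm w))"
    have \<eta>: "0 < \<eta>" "\<eta> < \<tau> z w" "\<eta> * norm w < e"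
    proof -
      show "0 < \<eta>" using assms e w by (simp add: \<eta>_def)
      show "\<eta> < \<tau> z w" using assms by (simp add: \<eta>_def min_less_iff_disj)
      have "\<eta> * norm w \<le> e / (2 * norm w) * norm w" by (intro mult_right_mono) (auto simp: \<eta>_def)
      also have "\<dots> < e" using e w by simp
      finally show "\<eta> * norm w < e" .
    qed
    have "z + (\<tau> z w - \<eta>) *\<^sub>R w \<in> D" using \<eta> by (intro exit_in) auto
    moreover have "dist (z + (\<tau> z w - \<eta>) *\<^sub>R w) (z + \<tau> z w *\<^sub>R w) < e"
      using \<eta> by (simp add: dist_norm algebra_simps)
    ultimately show "\<exists>y\<in>D. dist y (z + \<tau> z w *\<^sub>R w) < e" by blast
  qed
  then show ?thesis using exit_notin[OF w] open_D by (simp add: frontier_def interior_open)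
qed

lemma exit_shift:
  assumes z: "z \<in> D" and w: "w \<noteq> 0" and s: "- \<tau> z (- w) < s" "s < \<tau> z w"
  shows "z + s *\<^sub>R w \<in> D" "\<tau> (z + s *\<^sub>R w) w = \<tau> z w - s" "\<tau> (z + s *\<^sub>R w) (- w) = \<tau> z (- w) + s"
proof -
  have all: "z + r *\<^sub>R w \<in> D" if "- \<tau> z (- w) < r" "r < \<tau> z w" for r
  proof -
    consider "r = 0" | "r > 0" | "r < 0" by linarith
    then show ?thesis
    proof cases
      case 3
      then have "z + (- r) *\<^sub>R (- w) \<in> D" using that by (intro exit_in) auto
      then show ?thesis by simp
    qed (use that z exit_in in auto)
  qed
  show "z + s *\<^sub>R w \<in> D" using all s by blast
  show "\<tau> (z + s *\<^sub>R w) w = \<tau> z w - s"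
  proof (rule exit_eqI[OF w])
    fix r assume "0 < r" "r < \<tau> z w - s"
    then show "z + s *\<^sub>R w + r *\<^sub>R w \<in> D" using all[of "s + r"] s by (simp add: algebra_simps)
  next
    show "z + s *\<^sub>R w + (\<tau> z w - s) *\<^sub>R w \<notin> D" using exit_notin[OF w, of z] by (simp add: algebra_simps)
  qed (use s in auto)
  show "\<tau> (z + s *\<^sub>R w) (- w) = \<tau> z (- w) + s"
  proof (rule exit_eqI)
    fix r assume "0 < r" "r < \<tau> z (- w) + s"
    then show "z + s *\<^sub>R w + r *\<^sub>R (- w) \<in> D" using all[of "s - r"] s by (simp add: algebra_simps)
  next
    show "z + s *\<^sub>R w + (\<tau> z (- w) + s) *\<^sub>R (- w) \<notin> D"
      using exit_notin[of "- w" z] w by (simp add: algebra_simps)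
  qed (use s w in auto)
qed

text \<open>For \<open>c \<ge> 0\<close> and \<open>w \<noteq> 0\<close>, the exit time exceeds
  \<open>c\<close> if and only if for some rational \<open>q\<close> above \<open>c\<close> all
  pieces of the ray between the times \<open>q / (k + 1)\<close> and \<open>q\<close> lie in
  \<open>D\<close>, and these are open conditions. The time 0 is left out because the ray may start
  on the boundary.\<close>

lemma exit_measurable [measurable]: "(\<lambda>(z, w). \<tau> z w) \<in> borel_measurable (borel \<Otimes>\<^sub>M borel)"
proof -
  have "(\<lambda>p. \<tau> (fst p) (snd p)) \<in> borel_measurable (borel :: ((real^'n::_) \<times> (real^'n::_)) measure)"
  proof (rule borel_measurableI_greater)
    fix c :: real
    let ?Q = "\<lambda>q k. {p. \<forall>s\<in>{q / real (Suc k)..q}. fst p + s *\<^sub>R snd p \<in> D}"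
    have "{p. c < \<tau> (fst p) (snd p)} = (if c < 0 then UNIV else
        {p. snd p \<noteq> 0} \<inter> (\<Union>q\<in>{q\<in>\<rat>. c < q}. \<Inter>k. ?Q q k))"
    proof (cases "c < 0")
      case True
      then show ?thesis using exit_nonneg by (auto intro: less_le_trans)
    next
      case False
      have "c < \<tau> z w \<longleftrightarrow> w \<noteq> 0 \<and> (\<exists>q\<in>\<rat>. c < q \<and> (\<forall>k. \<forall>s\<in>{q / real (Suc k)..q}. z + s *\<^sub>R w \<in> D))" for z w
      proof
        assume cl: "c < \<tau> z w"
        then obtain q where q: "q \<in> \<rat>" "c < q" "q < \<tau> z w" using Rats_dense_in_real by blast
        have "z + s *\<^sub>R w \<in> D" if "s \<in> {q / real (Suc k)..q}" for s k
        proof (rule exit_in)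
          have "0 < q / real (Suc k)" using q False by simp
          then show "0 < s" using that by auto
        qed (use that q in auto)
        moreover have "w \<noteq> 0" using cl False by auto
        ultimately show "w \<noteq> 0 \<and> (\<exists>q\<in>\<rat>. c < q \<and> (\<forall>k. \<forall>s\<in>{q / real (Suc k)..q}. z + s *\<^sub>R w \<in> D))"
          using q by blast
      next
        assume "w \<noteq> 0 \<and> (\<exists>q\<in>\<rat>. c < q \<and> (\<forall>k. \<forall>s\<in>{q / real (Suc k)..q}. z + s *\<^sub>R w \<in> D))"
        then obtain q where q: "w \<noteq> 0" "c < q" "\<And>k s. s \<in> {q / real (Suc k)..q} \<Longrightarrow> z + s *\<^sub>R w \<in> D" by blast
        have "q \<le> \<tau> z w"
        proof (rule exit_geI[OF q(1)])
          fix s assume s: "0 < s" "s < q"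
          obtain k where "q / s < real k" using reals_Archimedean2 by blast
          then have "q / s \<le> real (Suc k)" by simp
          then have "q / real (Suc k) \<le> s" using s by (simp add: field_simps)
          then show "z + s *\<^sub>R w \<in> D" using s by (intro q(3)[of s k]) auto
        qed
        then show "c < \<tau> z w" using q(2) by simp
      qed
      then show ?thesis using False by auto
    qed
    moreover have "countable {q\<in>\<rat>. c < q}" by (rule countable_subset[OF _ countable_rat]) auto
    moreover have "?Q q k \<in> sets borel" for q k using open_all_in[OF open_D] by (rule borel_open)
    moreover have "open {p :: (real^'n::_) \<times> (real^'n::_). snd p \<noteq> 0}" by (intro open_Collect_neq continuous_intros)
    ultimately have "{p. c < \<tau> (fst p) (snd p)} \<in> sets borel"
      by (auto intro!: sets.Int sets.countable_UN'' sets.countable_INT)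
    then show "{p \<in> space borel. c < \<tau> (fst p) (snd p)} \<in> sets (borel :: ((real^'n::_) \<times> (real^'n::_)) measure)" by simp
  qed
  then show ?thesis by (simp add: borel_prod split_beta)
qed

lemma visible_iff: "visible D x y \<longleftrightarrow> x \<noteq> y \<and> 1 \<le> \<tau> x (y - x)"
proof -
  have seg: "open_segment x y = (\<lambda>s. x + s *\<^sub>R (y - x)) ` {0<..<1}" if "x \<noteq> y"
    using that by (force simp: in_segment algebra_simps image_iff)
  show ?thesis
  proof (cases "x = y")
    case False
    have "open_segment x y \<subseteq> D \<longleftrightarrow> 1 \<le> \<tau> x (y - x)"
    proof
      assume "open_segment x y \<subseteq> D"
      then show "1 \<le> \<tau> x (y - x)" using False by (intro exit_geI) (auto simp: seg)
    next
      assume "1 \<le> \<tau> x (y - x)"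
      then show "open_segment x y \<subseteq> D" using False exit_in[of _ x "y - x"] by (auto simp: seg)
    qed
    then show ?thesis using False by (simp add: visible_def)
  qed (simp add: visible_def)
qed

lemma visible_exit:
  assumes "visible D x y" "y \<notin> D"
  shows "\<tau> x (y - x) = 1"
proof -
  have "x \<noteq> y" "1 \<le> \<tau> x (y - x)" using assms(1) by (auto simp: visible_iff)
  moreover have "\<tau> x (y - x) \<le> 1"
  proof (rule ccontr)
    assume "\<not> ?thesis"
    then have "x + 1 *\<^sub>R (y - x) \<in> D" by (intro exit_in) auto
    then show False using assms(2) by simp
  qed
  ultimately show ?thesis by simp
qed

lemma visible_sym: "visible D x y \<longleftrightarrow> visible D y x"
  by (auto simp: visible_def open_segment_commute)

section \<open>Normals, exit times and exceptional boundary points\<close>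

lemma normal_pos_exit: "x \<in> R \<Longrightarrow> w \<bullet> inner_normal D x > 0 \<Longrightarrow> \<tau> x w > 0"
proof -
  assume x: "x \<in> R" and w: "w \<bullet> inner_normal D x > 0"
  obtain \<delta> where \<delta>: "\<delta> > 0" "\<And>t. 0 < t \<Longrightarrow> t < \<delta> \<Longrightarrow> x + t *\<^sub>R w \<in> D"
    using inner_normal_props(2)[OF adm x w] by blast
  have "w \<noteq> 0" using w by auto
  then have "\<delta> \<le> \<tau> x w" using \<delta>(2) by (intro exit_geI) auto
  then show ?thesis using \<delta>(1) by simp
qed

lemma exit_normal_nonneg: "x \<in> R \<Longrightarrow> \<tau> x w > 0 \<Longrightarrow> w \<bullet> inner_normal D x \<ge> 0"
proof (rule ccontr)
  assume x: "x \<in> R" and t: "\<tau> x w > 0" and "\<not> w \<bullet> inner_normal D x \<ge> 0"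
  then obtain \<delta> where \<delta>: "\<delta> > 0" "\<And>t. 0 < t \<Longrightarrow> t < \<delta> \<Longrightarrow> x + t *\<^sub>R w \<notin> D"
    using inner_normal_props(3)[OF adm x, of w] by auto
  define s where "s = min \<delta> (\<tau> x w) / 2"
  have "0 < s" "s < \<delta>" "s < \<tau> x w" using \<delta>(1) t by (auto simp: s_def)
  then show False using \<delta>(2) exit_in by blast
qed

text \<open>The normal does not decide whether a tangential ray enters \<open>D\<close>, but for
  such a ray both sides vanish. The right-hand side leads to measurability, since only the absolute
  inner product and the exit time occur in it.\<close>

lemma normal_pos_part: "x \<in> R \<Longrightarrow> max 0 (w \<bullet> inner_normal D x) = \<bar>w \<bullet> inner_normal D x\<bar> * of_bool (\<tau> x w > 0)"
  using normal_pos_exit[of x w] exit_normal_nonneg[of x w] by (cases "w \<bullet> inner_normal D x" "0::real" rule: linorder_cases) auto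

definition npos :: "real^'n::_ \<Rightarrow> real^'n::_ \<Rightarrow> real" where
  "npos x w = indicator R x * max 0 (w \<bullet> inner_normal D x)"

lemma npos_eq: "npos x w = indicator R x * \<bar>w \<bullet> inner_normal D x\<bar> * of_bool (\<tau> x w > 0)"
  using normal_pos_part[of x w] by (auto simp: npos_def indicator_def)

lemma npos_measurable [measurable]: "(\<lambda>(x, w). npos x w) \<in> borel_measurable (borel \<Otimes>\<^sub>M borel)"
proof -
  have "(\<lambda>p. (case p of (x, w) \<Rightarrow> indicator R x * \<bar>w \<bullet> inner_normal D x\<bar>) * of_bool ((case p of (x, w) \<Rightarrow> \<tau> x w) > 0))
      \<in> borel_measurable (borel \<Otimes>\<^sub>M borel)"
    by measurable
  then show ?thesis by (simp add: npos_eq split_beta)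
qed

text \<open>Each bounded piece is a tube over a set of area zero. This disposes of the points of
  \<open>D\<close> whose chord in direction \<open>w\<close> starts at an exceptional boundary
  point.\<close>

lemma negligible_rest_translates:
  "negligible {x + t *\<^sub>R w | x t. x \<in> frontier D - R}"
proof -
  let ?Z = "frontier D - R"
  have "negligible ((\<lambda>(x, t). x + t *\<^sub>R w) ` (?Z \<times> {- real (Suc N)..real (Suc N)}))" for N
  proof (rule negligible_null_tube[OF _ _ null_rest])
    fix x y s t
    have "dist (x + s *\<^sub>R w) (y + t *\<^sub>R w) = norm ((x - y) + (s - t) *\<^sub>R w)"
      by (simp add: dist_norm algebra_simps)
    also have "\<dots> \<le> dist x y + \<bar>s - t\<bar> * norm w"
      unfolding dist_norm by (rule norm_triangle_le) simp
    also have "\<dots> \<le> (1 + norm w) * dist x y + (1 + norm w) * \<bar>s - t\<bar>"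
      by (intro add_mono) (auto simp: algebra_simps)
    finally show "dist (x + s *\<^sub>R w) (y + t *\<^sub>R w) \<le> (1 + norm w) * (dist x y + \<bar>s - t\<bar>)"
      by (simp add: distrib_left)
  qed (use dim in \<open>auto simp: add_pos_nonneg\<close>)
  then have "negligible (\<Union>N. (\<lambda>(x, t). x + t *\<^sub>R w) ` (?Z \<times> {- real (Suc N)..real (Suc N)}))"
    by (intro negligible_countable_Union) auto
  moreover have "{x + t *\<^sub>R w | x t. x \<in> ?Z} \<subseteq> (\<Union>N. (\<lambda>(x, t). x + t *\<^sub>R w) ` (?Z \<times> {- real (Suc N)..real (Suc N)}))"
  proof clarify
    fix x t assume x: "x \<in> frontier D" "x \<notin> R"
    obtain N where "\<bar>t\<bar> < real N" using reals_Archimedean2 by blast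
    then have "(x, t) \<in> ?Z \<times> {- real (Suc N)..real (Suc N)}" using x by auto
    then show "x + t *\<^sub>R w \<in> (\<Union>N. (\<lambda>(x, t). x + t *\<^sub>R w) ` (?Z \<times> {- real (Suc N)..real (Suc N)}))" by force
  qed
  ultimately show ?thesis by (rule negligible_subset)
qed

text \<open>The counterpart for rays from \<open>x\<close>; boundedness of the frontier makes the
  cone map Lipschitz on bounded parameter ranges.\<close>

lemma negligible_rest_cone:
  "negligible {x + t *\<^sub>R (y - x) | y t. y \<in> frontier D - R}"
proof -
  let ?Z = "frontier D - R"
  obtain B where B: "B > 0" "\<And>y. y \<in> frontier D \<Longrightarrow> norm y \<le> B"
    using bounded_subset[OF bounded_closure[OF bdd], of "frontier D"] by (auto simp: bounded_pos frontier_def)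
  have "negligible ((\<lambda>(y, t). x + t *\<^sub>R (y - x)) ` (?Z \<times> {- real (Suc N)..real (Suc N)}))" for N
  proof (rule negligible_null_tube[OF _ _ null_rest, where L = "real (Suc N) + B + norm x"])
    fix y z s t assume yz: "y \<in> ?Z" "z \<in> ?Z" and st: "\<bar>s\<bar> \<le> real (Suc N)" "\<bar>t\<bar> \<le> real (Suc N)"
    have "dist (x + s *\<^sub>R (y - x)) (x + t *\<^sub>R (z - x)) = norm (s *\<^sub>R (y - z) + (s - t) *\<^sub>R (z - x))"
      by (simp add: dist_norm algebra_simps)
    also have "\<dots> \<le> \<bar>s\<bar> * dist y z + \<bar>s - t\<bar> * norm (z - x)"
      unfolding dist_norm by (rule norm_triangle_le) simp
    also have "norm (z - x) \<le> B + norm x" using B(2)[of z] yz norm_triangle_ineq4[of z x] by simp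
    also have "\<bar>s\<bar> * dist y z + \<bar>s - t\<bar> * (B + norm x) \<le>
        (real (Suc N) + B + norm x) * dist y z + (real (Suc N) + B + norm x) * \<bar>s - t\<bar>"
    proof (rule add_mono)
      have "\<bar>s\<bar> \<le> real (Suc N) + B + norm x" using st(1) B(1) norm_ge_zero[of x] by linarith
      then show "\<bar>s\<bar> * dist y z \<le> (real (Suc N) + B + norm x) * dist y z" by (rule mult_right_mono) simp
      have "\<bar>s - t\<bar> * (B + norm x) \<le> \<bar>s - t\<bar> * (real (Suc N) + B + norm x)" by (intro mult_left_mono) auto
      then show "\<bar>s - t\<bar> * (B + norm x) \<le> (real (Suc N) + B + norm x) * \<bar>s - t\<bar>" by (simp only: mult.commute)
    qed
    finally show "dist (x + s *\<^sub>R (y - x)) (x + t *\<^sub>R (z - x)) \<le> (real (Suc N) + B + norm x) * (dist y z + \<bar>s - t\<bar>)"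
      by (simp add: distrib_left mult_left_mono)
  qed (use dim B(1) in \<open>auto simp: add_pos_nonneg\<close>)
  then have "negligible (\<Union>N. (\<lambda>(y, t). x + t *\<^sub>R (y - x)) ` (?Z \<times> {- real (Suc N)..real (Suc N)}))"
    by (intro negligible_countable_Union) auto
  moreover have "{x + t *\<^sub>R (y - x) | y t. y \<in> ?Z} \<subseteq> (\<Union>N. (\<lambda>(y, t). x + t *\<^sub>R (y - x)) ` (?Z \<times> {- real (Suc N)..real (Suc N)}))"
  proof clarify
    fix y t assume y: "y \<in> frontier D" "y \<notin> R"
    obtain N where "\<bar>t\<bar> < real N" using reals_Archimedean2 by blast
    then have "(y, t) \<in> ?Z \<times> {- real (Suc N)..real (Suc N)}" using y by auto
    then show "x + t *\<^sub>R (y - x) \<in> (\<Union>N. (\<lambda>(y, t). x + t *\<^sub>R (y - x)) ` (?Z \<times> {- real (Suc N)..real (Suc N)}))" by force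
  qed
  ultimately show ?thesis by (rule negligible_subset)
qed

end

subsection \<open>Chords and directions\<close>

definition chord_ends :: "'a::real_vector set \<Rightarrow> 'a \<Rightarrow> 'a \<Rightarrow> 'a \<times> 'a" where
  "chord_ends G w z = (z - exit_time G z (- w) *\<^sub>R w, z + exit_time G z w *\<^sub>R w)"

text \<open>Measured in units of \<open>norm w\<close>, because directions are not normalised. In
  these units the reciprocal integrates to one over the parameter interval of a chord.\<close>

definition chord_length :: "'a::real_vector set \<Rightarrow> 'a \<Rightarrow> 'a \<Rightarrow> real" where
  "chord_length G w z = exit_time G z (- w) + exit_time G z w"

lemma ball_measurable [measurable]: "ball (a :: 'a::euclidean_space) r \<in> sets borel"
  by simp

lemma nn_integral_power_interval:
  assumes "0 \<le> c"
  shows "(\<integral>\<^sup>+t. indicator {0<..<c} t * ennreal (t ^ m) \<partial>lborel) = ennreal (c ^ Suc m / real (Suc m))"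
proof -
  have "(\<integral>\<^sup>+t. indicator {0<..<c} t * ennreal (t ^ m) \<partial>lborel) = (\<integral>\<^sup>+t. ennreal (t ^ m) * indicator {0..c} t \<partial>lborel)"
  proof (rule nn_integral_cong_AE)
    show "AE t in lborel. indicator {0<..<c} t * ennreal (t ^ m) = ennreal (t ^ m) * indicator {0..c} t"
      using AE_lborel_singleton[of 0] AE_lborel_singleton[of c]
      by eventually_elim (auto simp: indicator_def)
  qed
  also have "\<dots> = ennreal (c ^ Suc m / real (Suc m) - 0 ^ Suc m / real (Suc m))"
  proof (rule nn_integral_FTC_Icc[where F = "\<lambda>t. t ^ Suc m / real (Suc m)"])
    fix x :: real
    show "((\<lambda>t. t ^ Suc m / real (Suc m)) has_real_derivative x ^ m) (at x)"
      using DERIV_cdivide[OF DERIV_pow[of "Suc m" x], of "real (Suc m)"] by (simp del: of_nat_Suc power_Suc)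
  qed (use assms in auto)
  finally show ?thesis by simp
qed

text \<open>Up to a constant, the total mass of the kernel seen from a boundary point with inner
  normal \<open>v\<close>.\<close>

definition half_ball_moment :: "'a::euclidean_space \<Rightarrow> ennreal" where
  "half_ball_moment v = (\<integral>\<^sup>+w. indicator (ball 0 1) w * ennreal (max 0 (w \<bullet> v)) \<partial>lborel)"

text \<open>A rotation that takes \<open>u\<close> to \<open>v\<close> preserves the ball and
  Lebesgue measure.\<close>

lemma half_ball_moment_eq:
  fixes u v :: "real^'n::{finite,wellorder}"
  assumes "norm u = 1" "norm v = 1"
  shows "half_ball_moment u = half_ball_moment v"
proof -
  have "norm u = norm v" using assms by simp
  then obtain T :: "real^'n::_ \<Rightarrow> real^'n::_" where T: "orthogonal_transformation T" "T u = v"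
    by (rule orthogonal_transformation_exists) (rule that)
  have linT: "linear T" using T(1) by (rule orthogonal_transformation_linear)
  have T_meas [measurable]: "T \<in> borel_measurable borel"
    using linT by (intro borel_measurable_continuous_onI linear_continuous_on) (simp add: linear_conv_bounded_linear)
  have "distr lborel borel T = (lborel :: (real^'n::_) measure)"
  proof (rule measure_eqI)
    fix A assume "A \<in> sets (distr lborel borel T)"
    then have A [measurable]: "A \<in> sets borel" by simp
    have vim: "T -` A \<in> sets borel" using measurable_sets[OF T_meas A] by simp
    have "emeasure lborel A = emeasure lebesgue (T ` (T -` A))"
      using orthogonal_transformation_surj[OF T(1)] A by (simp add: surj_image_vimage_eq)
    also have "\<dots> = (\<integral>\<^sup>+x. ennreal \<bar>det (matrix T)\<bar> * indicator (T -` A) x \<partial>lebesgue)"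
    proof (rule emeasure_differentiable_image)
      show "T -` A \<in> sets lebesgue" using vim by simp
      show "inj_on T (T -` A)" using orthogonal_transformation_inj[OF T(1)] by (rule inj_on_subset) simp
      show "(T has_derivative T) (at x within T -` A)" for x
        using linT by (intro bounded_linear_imp_has_derivative) (simp add: linear_conv_bounded_linear)
    qed
    also have "\<dots> = emeasure lborel (T -` A)" using T(1) vim by (simp add: nn_integral_completion)
    also have "\<dots> = emeasure (distr lborel borel T) A" using vim by (subst emeasure_distr) auto
    finally show "emeasure (distr lborel borel T) A = emeasure lborel A" by simp
  qed simp
  then have "half_ball_moment v = (\<integral>\<^sup>+w. indicator (ball 0 1) w * ennreal (max 0 (w \<bullet> v)) \<partial>distr lborel borel T)"
    by (simp add: half_ball_moment_def)
  also have "\<dots> = (\<integral>\<^sup>+w. indicator (ball 0 1) (T w) * ennreal (max 0 (T w \<bullet> v)) \<partial>lborel)"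
    by (rule nn_integral_distr) simp_all
  also have "\<dots> = half_ball_moment u"
    unfolding half_ball_moment_def
  proof (intro nn_integral_cong)
    fix w :: "real^'n::_"
    have "T w \<bullet> v = w \<bullet> u" using T by (auto simp: orthogonal_transformation_def)
    moreover have "norm (T w) = norm w" using T(1) by (rule orthogonal_transformation_norm)
    ultimately show "indicator (ball 0 1) (T w) * ennreal (max 0 (T w \<bullet> v)) = indicator (ball 0 1) w * ennreal (max 0 (w \<bullet> u))"
      by (simp add: indicator_def)
  qed
  finally show ?thesis by simp
qed

text \<open>The factor \<open>CARD('n) + 1\<close> undoes the integration of
  \<open>t ^ CARD('n)\<close> in the radial substitution, and \<open>flat_const\<close> comes from
  the sweep formula. The value does not depend on the domain.\<close>

definition dir_const :: "'n::{finite,wellorder} itself \<Rightarrow> ennreal" where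
  "dir_const _ = ennreal (gamma_const TYPE('n)) * of_nat (CARD('n) + 1) * flat_const TYPE('n)"

lemma inner_visible_le:
  assumes "bounded_domain D R" "x \<in> R" "visible D x y"
  shows "0 \<le> (y - x) \<bullet> inner_normal D x"
proof -
  interpret bounded_domain D R by fact
  have "\<tau> x (y - x) > 0" using assms(3) by (simp add: visible_iff)
  then show ?thesis using exit_normal_nonneg[OF assms(2)] by blast
qed

context bounded_domain
begin

text \<open>Moving the boundary points along \<open>w\<close> until the ray leaves \<open>D\<close>
  hits almost every point of \<open>D\<close> exactly once, namely from its entry point. The
  integrand on the right is constant along a chord, and the reciprocal length reduces the integral
  along the chord to the value of \<open>F\<close> at its ends.\<close>

lemma nn_integral_entry:
  assumes w: "w \<noteq> 0" and F [measurable]: "F \<in> borel_measurable (borel \<Otimes>\<^sub>M borel)"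
  shows "(\<integral>\<^sup>+x. ennreal (npos x w) * F (x, x + \<tau> x w *\<^sub>R w) \<partial>\<sigma>) =
    flat_const TYPE('n) * (\<integral>\<^sup>+z. indicator D z * (F (chord_ends D w z) * ennreal (1 / chord_length D w z)) \<partial>lborel)"
proof -
  define E where "E = {(x, t). x \<in> R \<and> 0 < t \<and> t < \<tau> x w}"
  define f where "f z = F (chord_ends D w z) * ennreal (1 / chord_length D w z)" for z
  have \<tau>_meas [measurable]: "(\<lambda>x. \<tau> x v) \<in> borel_measurable borel" for v
    using measurable_compose[OF _ exit_measurable, of "\<lambda>x. (x, v)" borel] by simp
  have f_meas [measurable]: "f \<in> borel_measurable borel"
    unfolding f_def chord_ends_def chord_length_def by measurable
  have E: "E \<in> sets (borel \<Otimes>\<^sub>M borel)"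
  proof -
    have "{p \<in> space (borel \<Otimes>\<^sub>M borel). fst p \<in> R \<and> 0 < snd p \<and> snd p < \<tau> (fst p) w} \<in> sets (borel \<Otimes>\<^sub>M (borel :: real measure))"
      by measurable
    also have "{p \<in> space (borel \<Otimes>\<^sub>M borel). fst p \<in> R \<and> 0 < snd p \<and> snd p < \<tau> (fst p) w} = E"
      by (auto simp: E_def space_pair_measure)
    finally show ?thesis .
  qed
  have entry: "\<tau> (x + t *\<^sub>R w) (- w) = t" "\<tau> (x + t *\<^sub>R w) w = \<tau> x w - t" "x + t *\<^sub>R w \<in> D"
    if "(x, t) \<in> E" for x t
  proof -
    have x: "x \<in> R" "0 < t" "t < \<tau> x w" using that by (auto simp: E_def)
    show "\<tau> (x + t *\<^sub>R w) (- w) = t"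
    proof (rule exit_eqI)
      fix s assume s: "0 < s" "s < t"
      then have "x + (t - s) *\<^sub>R w \<in> D" using x by (intro exit_in) auto
      then show "x + t *\<^sub>R w + s *\<^sub>R (- w) \<in> D" by (simp add: algebra_simps)
    next
      show "x + t *\<^sub>R w + t *\<^sub>R (- w) \<notin> D" using R_notin[OF x(1)] by simp
    qed (use w x in auto)
    show "\<tau> (x + t *\<^sub>R w) w = \<tau> x w - t"
    proof (rule exit_eqI)
      fix s assume s: "0 < s" "s < \<tau> x w - t"
      then have "x + (t + s) *\<^sub>R w \<in> D" using x by (intro exit_in) auto
      then show "x + t *\<^sub>R w + s *\<^sub>R w \<in> D" by (simp add: algebra_simps)
    next
      show "x + t *\<^sub>R w + (\<tau> x w - t) *\<^sub>R w \<notin> D" using exit_notin[OF w, of x] by (simp add: algebra_simps)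
    qed (use w x in auto)
    show "x + t *\<^sub>R w \<in> D" using x by (intro exit_in)
  qed
  have sw: "sweep 1 0 0 w (x, t) = x + t *\<^sub>R w" for x t by (simp add: sweep_def)
  have inj: "inj_on (sweep 1 0 0 w) E"
  proof (rule inj_onI, clarify)
    fix x s y t assume xy: "(x, s) \<in> E" "(y, t) \<in> E" "sweep 1 0 0 w (x, s) = sweep 1 0 0 w (y, t)"
    then have eq: "x + s *\<^sub>R w = y + t *\<^sub>R w" by (simp add: sw)
    then have "s = t" using entry(1)[OF xy(1)] entry(1)[OF xy(2)] by simp
    then show "x = y \<and> s = t" using eq by simp
  qed
  have img: "sweep 1 0 0 w ` E \<subseteq> D" using entry(3) by (auto simp: sw)
  \<comment> \<open>A point of \<open>D\<close> that is not hit has its entry point outside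
    \<open>R\<close>.\<close>
  have neg: "negligible (D - sweep 1 0 0 w ` E)"
  proof (rule negligible_subset[OF negligible_rest_translates[of w]], rule subsetI)
    fix z assume z: "z \<in> D - sweep 1 0 0 w ` E"
    define x where "x = z - \<tau> z (- w) *\<^sub>R w"
    have tpos: "0 < \<tau> z (- w)" "0 < \<tau> z w" using z w by (auto intro: exit_pos)
    have xf: "x \<in> frontier D" using exit_frontier[OF tpos(1)] by (simp add: x_def)
    have zx: "z = x + \<tau> z (- w) *\<^sub>R w" by (simp add: x_def)
    have "\<tau> x w = \<tau> z (- w) + \<tau> z w"
    proof (rule exit_eqI[OF w])
      fix s assume s: "0 < s" "s < \<tau> z (- w) + \<tau> z w"
      have "z + (s - \<tau> z (- w)) *\<^sub>R w \<in> D" using z w s by (intro exit_shift(1)) auto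
      then show "x + s *\<^sub>R w \<in> D" by (simp add: x_def algebra_simps)
    next
      show "x + (\<tau> z (- w) + \<tau> z w) *\<^sub>R w \<notin> D"
        using exit_notin[OF w, of z] by (simp add: x_def algebra_simps)
    qed (use tpos in auto)
    then have "x \<in> R \<Longrightarrow> (x, \<tau> z (- w)) \<in> E" using tpos by (auto simp: E_def)
    then have "x \<notin> R" using z zx by (metis DiffD2 image_eqI sw)
    then show "z \<in> {x + t *\<^sub>R w | x t. x \<in> frontier D - R}" using xf zx by blast
  qed
  have "flat_const TYPE('n) * (\<integral>\<^sup>+z. indicator D z * f z \<partial>lborel) =
      (\<integral>\<^sup>+x. \<integral>\<^sup>+t. indicator E (x, t) * sweep_jac 1 0 w x t * f (sweep 1 0 0 w (x, t)) \<partial>lborel \<partial>\<sigma>)"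
    by (rule nn_integral_sweep[OF E _ _ inj D_borel img neg f_meas, symmetric]) (auto simp: E_def)
  also have "\<dots> = (\<integral>\<^sup>+x. ennreal (npos x w) * F (x, x + \<tau> x w *\<^sub>R w) \<partial>\<sigma>)"
  proof (intro nn_integral_cong)
    fix x
    show "(\<integral>\<^sup>+t. indicator E (x, t) * sweep_jac 1 0 w x t * f (sweep 1 0 0 w (x, t)) \<partial>lborel) =
        ennreal (npos x w) * F (x, x + \<tau> x w *\<^sub>R w)"
    proof (cases "x \<in> R \<and> \<tau> x w > 0")
      case True
      let ?c = "ennreal \<bar>w \<bullet> inner_normal D x\<bar> * (F (x, x + \<tau> x w *\<^sub>R w) * ennreal (1 / \<tau> x w))"
      have "(\<integral>\<^sup>+t. indicator E (x, t) * sweep_jac 1 0 w x t * f (sweep 1 0 0 w (x, t)) \<partial>lborel) =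
          (\<integral>\<^sup>+t. ?c * indicator {0<..<\<tau> x w} t \<partial>lborel)"
      proof (intro nn_integral_cong)
        fix t
        show "indicator E (x, t) * sweep_jac 1 0 w x t * f (sweep 1 0 0 w (x, t)) = ?c * indicator {0<..<\<tau> x w} t"
        proof (cases "(x, t) \<in> E")
          case tE: True
          have "chord_ends D w (x + t *\<^sub>R w) = (x, x + \<tau> x w *\<^sub>R w)"
            unfolding chord_ends_def entry[OF tE] by (simp add: algebra_simps)
          moreover have "chord_length D w (x + t *\<^sub>R w) = \<tau> x w" using entry[OF tE] by (simp add: chord_length_def)
          ultimately show ?thesis
            using tE by (auto simp: sw f_def sweep_jac_def E_def mult_ac)
        next
          case False
          then have "t \<notin> {0<..<\<tau> x w}" using True by (auto simp: E_def)
          then show ?thesis using False by simp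
        qed
      qed
      also have "\<dots> = ?c * ennreal (\<tau> x w)"
        using True by (subst nn_integral_cmult) (auto simp: exit_nonneg)
      also have "\<dots> = ennreal \<bar>w \<bullet> inner_normal D x\<bar> * F (x, x + \<tau> x w *\<^sub>R w) * (ennreal (1 / \<tau> x w) * ennreal (\<tau> x w))"
        by (simp add: mult_ac)
      also have "ennreal (1 / \<tau> x w) * ennreal (\<tau> x w) = 1"
        using True by (simp add: ennreal_mult'[symmetric])
      finally show ?thesis using True by (simp add: npos_eq)
    next
      case False
      then have "npos x w = 0" by (auto simp: npos_eq)
      moreover have "(x, t) \<notin> E" for t using False by (auto simp: E_def)
      ultimately show ?thesis by simp
    qed
  qed
  finally show ?thesis by (simp add: f_def)
qed

lemma chord_kernel_nonneg_factor:
  assumes "x \<in> R" "y \<in> R" "visible D x y"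
  shows "chord_kernel D R x y = gamma_const TYPE('n) *
    (((y - x) \<bullet> inner_normal D x) * \<bar>(y - x) \<bullet> inner_normal D y\<bar> / norm (x - y) ^ (CARD('n) + 1))"
proof -
  have "0 \<le> (x - y) \<bullet> inner_normal D y"
    using inner_visible_le[OF bounded_domain_axioms assms(2), of x] assms(3) visible_sym by blast
  then have "\<bar>(y - x) \<bullet> inner_normal D y\<bar> = (x - y) \<bullet> inner_normal D y"
    by (simp add: inner_diff_left)
  then show ?thesis using assms by (simp add: chord_kernel_def)
qed

text \<open>Each visible \<open>y\<close> is moved along its ray from \<open>x\<close>. With
  \<open>d = CARD('n)\<close>, the Jacobian contributes \<open>t ^ (d - 1)\<close> and the cosine at
  \<open>y\<close>, and the homogeneous weight \<open>npos\<close> contributes a further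
  \<open>t\<close> and the cosine at \<open>x\<close>. Integrating \<open>t ^ d\<close> up to the
  reciprocal distance produces the denominator of the kernel and the factor
  \<open>d + 1\<close>.\<close>

lemma nn_integral_radial:
  assumes x: "x \<in> R" and F [measurable]: "F \<in> borel_measurable (borel \<Otimes>\<^sub>M borel)"
  shows "(\<integral>\<^sup>+y. ennreal (chord_kernel D R x y) * F (x, y) \<partial>\<sigma>) =
    ennreal (gamma_const TYPE('n)) * of_nat (CARD('n) + 1) * flat_const TYPE('n) *
      (\<integral>\<^sup>+w. indicator (ball 0 1) w * (ennreal (npos x w) * F (x, x + \<tau> x w *\<^sub>R w)) \<partial>lborel)"
proof -
  let ?n = "inner_normal D" and ?d = "CARD('n)"
  define E where "E = {(y, t::real). y \<in> R \<and> visible D x y \<and> 0 < t}"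
  define h where "h w = indicator (ball 0 1) w * (ennreal (npos x w) * F (x, x + \<tau> x w *\<^sub>R w))" for w
  define f where "f z = h (z - x)" for z
  \<comment> \<open>The points seen from \<open>x\<close> in a direction that enters
    \<open>D\<close>: a Borel set that agrees with the swept cone up to a null set.\<close>
  define W where "W = {z. 0 < \<tau> x (z - x)}"
  have \<tau>_meas [measurable]: "(\<lambda>w. \<tau> x w) \<in> borel_measurable borel"
    using measurable_compose[OF _ exit_measurable, of "\<lambda>w. (x, w)" borel] by simp
  have npos_meas [measurable]: "(\<lambda>w. npos x w) \<in> borel_measurable borel"
    using measurable_compose[OF _ npos_measurable, of "\<lambda>w. (x, w)" borel] by simp
  have h_meas [measurable]: "h \<in> borel_measurable borel" unfolding h_def by measurable
  have f_meas [measurable]: "f \<in> borel_measurable borel" unfolding f_def by measurable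
  have W: "W \<in> sets borel" unfolding W_def by measurable
  have E: "E \<in> sets (borel \<Otimes>\<^sub>M borel)"
  proof -
    have "{p \<in> space (borel \<Otimes>\<^sub>M borel). fst p \<in> R \<and> (x \<noteq> fst p \<and> 1 \<le> \<tau> x (fst p - x)) \<and> 0 < snd p} \<in> sets (borel \<Otimes>\<^sub>M (borel :: real measure))"
      by measurable
    also have "{p \<in> space (borel \<Otimes>\<^sub>M borel). fst p \<in> R \<and> (x \<noteq> fst p \<and> 1 \<le> \<tau> x (fst p - x)) \<and> 0 < snd p} = E"
      by (auto simp: E_def space_pair_measure visible_iff)
    finally show ?thesis .
  qed
  have sw: "sweep 0 1 x (- x) (y, t) = x + t *\<^sub>R (y - x)" for y t by (simp add: sweep_def algebra_simps)
  \<comment> \<open>The exit time for the swept direction recovers the parameter \<open>t\<close>,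
    and with it \<open>y\<close>; injectivity follows.\<close>
  have ray: "\<tau> x (t *\<^sub>R (y - x)) = 1 / t" if "(y, t) \<in> E" for y t
    using that exit_scale[of t x "y - x"] visible_exit[of x y] R_notin by (auto simp: E_def)
  have inj: "inj_on (sweep 0 1 x (- x)) E"
  proof (rule inj_onI, clarify)
    fix y s z t assume yz: "(y, s) \<in> E" "(z, t) \<in> E" "sweep 0 1 x (- x) (y, s) = sweep 0 1 x (- x) (z, t)"
    then have eq: "s *\<^sub>R (y - x) = t *\<^sub>R (z - x)" by (simp add: sw)
    have pos: "s > 0" "t > 0" using yz by (auto simp: E_def)
    have "1 / s = 1 / t" using ray[OF yz(1)] ray[OF yz(2)] eq by simp
    then have "s = t" by simp
    then show "y = z \<and> s = t" using eq pos by simp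
  qed
  have img: "sweep 0 1 x (- x) ` E \<subseteq> W"
  proof clarify
    fix y t assume E': "(y, t) \<in> E"
    then have "t > 0" by (auto simp: E_def)
    then show "sweep 0 1 x (- x) (y, t) \<in> W" using ray[OF E'] by (simp add: W_def sw)
  qed
  have neg: "negligible (W - sweep 0 1 x (- x) ` E)"
  proof (rule negligible_subset[OF negligible_rest_cone[of x]], rule subsetI)
    fix z assume z: "z \<in> W - sweep 0 1 x (- x) ` E"
    define T where "T = \<tau> x (z - x)"
    have T: "T > 0" using z by (simp add: W_def T_def)
    define y where "y = x + T *\<^sub>R (z - x)"
    have yf: "y \<in> frontier D" using exit_frontier[of x "z - x"] T by (simp add: y_def T_def)
    have zy: "z = x + (1 / T) *\<^sub>R (y - x)" using T by (simp add: y_def)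
    have "z \<noteq> x" using T by (auto simp: T_def)
    then have "visible D x y"
      using T exit_scale[OF T, of x "z - x"] by (auto simp: visible_iff y_def T_def)
    then have "y \<in> R \<Longrightarrow> (y, 1 / T) \<in> E" using T by (simp add: E_def)
    then have "y \<notin> R" using z zy by (metis DiffD2 image_eqI sw)
    then show "z \<in> {x + t *\<^sub>R (y - x) | y t. y \<in> frontier D - R}" using yf zy by blast
  qed
  let ?C = "ennreal (gamma_const TYPE('n)) * of_nat (?d + 1)"
  have inner: "(\<integral>\<^sup>+t. indicator E (y, t) * sweep_jac 0 1 (- x) y t * f (sweep 0 1 x (- x) (y, t)) \<partial>lborel) * ?C =
      ennreal (chord_kernel D R x y) * F (x, y)" for y
  proof (cases "y \<in> R \<and> visible D x y")
    case True
    define r where "r = norm (y - x)"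
    have "x \<noteq> y" using True by (simp add: visible_def)
    then have r: "r > 0" by (simp add: r_def)
    define A where "A = \<bar>(y - x) \<bullet> ?n y\<bar>"
    define B where "B = (y - x) \<bullet> ?n x"
    have A: "A \<ge> 0" by (simp add: A_def)
    have B: "B \<ge> 0" unfolding B_def using inner_visible_le[OF bounded_domain_axioms x] True by blast
    have "(\<integral>\<^sup>+t. indicator E (y, t) * sweep_jac 0 1 (- x) y t * f (sweep 0 1 x (- x) (y, t)) \<partial>lborel) =
        (\<integral>\<^sup>+t. (ennreal (A * B) * F (x, y)) * (indicator {0<..<1 / r} t * ennreal (t ^ ?d)) \<partial>lborel)"
    proof (intro nn_integral_cong)
      fix t
      show "indicator E (y, t) * sweep_jac 0 1 (- x) y t * f (sweep 0 1 x (- x) (y, t)) =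
          (ennreal (A * B) * F (x, y)) * (indicator {0<..<1 / r} t * ennreal (t ^ ?d))"
      proof (cases "t > 0")
        case t: True
        have tE: "(y, t) \<in> E" using True t by (simp add: E_def)
        have jac: "sweep_jac 0 1 (- x) y t = ennreal (t ^ (?d - 1) * A)"
          using True t by (simp add: sweep_jac_def A_def)
        have ends: "x + \<tau> x (t *\<^sub>R (y - x)) *\<^sub>R (t *\<^sub>R (y - x)) = y" using ray[OF tE] t by simp
        have np: "npos x (t *\<^sub>R (y - x)) = t * B" using x t B by (simp add: npos_def B_def)
        \<comment> \<open>The swept direction stays in the unit ball exactly as long as
          \<open>t\<close> is below \<open>1 / r\<close>; this is the upper limit of the
          integral.\<close>
        have ball: "indicator (ball 0 1) (t *\<^sub>R (y - x)) = (indicator {0<..<1 / r} t :: ennreal)"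
        proof -
          have "norm (t *\<^sub>R (y - x)) = t * r" using t by (simp only: norm_scaleR r_def abs_of_pos)
          then show ?thesis using t r by (simp add: indicator_def pos_less_divide_eq)
        qed
        have "f (sweep 0 1 x (- x) (y, t)) = indicator {0<..<1 / r} t * (ennreal (t * B) * F (x, y))"
          unfolding f_def sw add_diff_cancel_left' h_def ends np ball ..
        then have "indicator E (y, t) * sweep_jac 0 1 (- x) y t * f (sweep 0 1 x (- x) (y, t)) =
            (ennreal (t ^ (?d - 1) * A) * ennreal (t * B)) * F (x, y) * indicator {0<..<1 / r} t"
          using tE by (simp add: jac mult_ac)
        also have "ennreal (t ^ (?d - 1) * A) * ennreal (t * B) = ennreal (A * B) * ennreal (t ^ ?d)"
        proof -
          have "t ^ (?d - 1) * t = t ^ ?d" by (rule power_minus_mult) simp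
          then have "(t ^ (?d - 1) * A) * (t * B) = (A * B) * t ^ ?d" by (metis (no_types, lifting) mult.assoc mult.commute)
          then show ?thesis using t A B by (simp add: ennreal_mult''[symmetric])
        qed
        finally show ?thesis by (simp add: mult_ac)
      next
        case False
        then have "(y, t) \<notin> E" by (simp add: E_def)
        then show ?thesis using False by simp
      qed
    qed
    also have "\<dots> = (ennreal (A * B) * F (x, y)) * ennreal ((1 / r) ^ Suc ?d / real (Suc ?d))"
      using r by (subst nn_integral_cmult) (auto simp: nn_integral_power_interval)
    finally have eq: "(\<integral>\<^sup>+t. indicator E (y, t) * sweep_jac 0 1 (- x) y t * f (sweep 0 1 x (- x) (y, t)) \<partial>lborel) =
        (ennreal (A * B) * F (x, y)) * ennreal ((1 / r) ^ Suc ?d / real (Suc ?d))" .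
    have "ennreal (chord_kernel D R x y) = ennreal (gamma_const TYPE('n) * (B * A / r ^ (?d + 1)))"
      using chord_kernel_nonneg_factor[of x y] x True by (simp add: A_def B_def r_def norm_minus_commute)
    also have "\<dots> = ennreal (gamma_const TYPE('n)) * ennreal (B * A / r ^ (?d + 1))"
      using A B r by (intro ennreal_mult'') auto
    also have "B * A / r ^ (?d + 1) = (A * B) * ((1 / r) ^ Suc ?d / real (Suc ?d)) * real (Suc ?d)"
      by (simp add: power_divide)
    also have "ennreal \<dots> = ennreal (A * B) * ennreal ((1 / r) ^ Suc ?d / real (Suc ?d)) * of_nat (?d + 1)"
    proof -
      define P where "P = (1 / r) ^ Suc ?d / real (Suc ?d)"
      have P: "P \<ge> 0" using r by (simp add: P_def)
      have "ennreal (A * B * P * real (Suc ?d)) = ennreal (A * B) * ennreal P * ennreal (real (Suc ?d))"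
        using A B P by (subst ennreal_mult, simp, simp, subst ennreal_mult) auto
      then show ?thesis unfolding P_def by (simp only: ennreal_of_nat_eq_real_of_nat Suc_eq_plus1)
    qed
    finally show ?thesis unfolding eq by (simp add: mult_ac)
  next
    case False
    then have "(y, t) \<notin> E" for t by (auto simp: E_def)
    moreover have "chord_kernel D R x y = 0" using False by (auto simp: chord_kernel_def)
    ultimately show ?thesis by simp
  qed
  have inner_meas: "(\<lambda>y. \<integral>\<^sup>+t. indicator E (y, t) * sweep_jac 0 1 (- x) y t * f (sweep 0 1 x (- x) (y, t)) \<partial>lborel) \<in> borel_measurable borel"
    using E by measurable
  have "(\<integral>\<^sup>+y. ennreal (chord_kernel D R x y) * F (x, y) \<partial>\<sigma>) =
      (\<integral>\<^sup>+y. (\<integral>\<^sup>+t. indicator E (y, t) * sweep_jac 0 1 (- x) y t * f (sweep 0 1 x (- x) (y, t)) \<partial>lborel) * ?C \<partial>\<sigma>)"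
    by (simp only: inner)
  also have "\<dots> = (\<integral>\<^sup>+y. (\<integral>\<^sup>+t. indicator E (y, t) * sweep_jac 0 1 (- x) y t * f (sweep 0 1 x (- x) (y, t)) \<partial>lborel) \<partial>\<sigma>) * ?C"
    using inner_meas by (intro nn_integral_multc) simp
  also have "(\<integral>\<^sup>+y. (\<integral>\<^sup>+t. indicator E (y, t) * sweep_jac 0 1 (- x) y t * f (sweep 0 1 x (- x) (y, t)) \<partial>lborel) \<partial>\<sigma>) =
      flat_const TYPE('n) * (\<integral>\<^sup>+z. indicator W z * f z \<partial>lborel)"
    by (rule nn_integral_sweep[OF E _ _ inj W img neg f_meas]) (auto simp: E_def)
  also have "(\<integral>\<^sup>+z. indicator W z * f z \<partial>lborel) = (\<integral>\<^sup>+z. f z \<partial>lborel)"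
  proof (intro nn_integral_cong)
    fix z
    have "z \<notin> W \<Longrightarrow> npos x (z - x) = 0" by (simp add: W_def npos_eq)
    then show "indicator W z * f z = f z" by (cases "z \<in> W") (auto simp: f_def h_def)
  qed
  also have "\<dots> = (\<integral>\<^sup>+w. h w \<partial>lborel)"
    unfolding f_def using nn_integral_lborel_translate[OF h_meas, of "- x"] by simp
  finally show ?thesis by (simp add: h_def mult_ac)
qed

lemma kernel_outside: "x \<notin> R \<Longrightarrow> chord_kernel D R x y = 0"
  by (simp add: chord_kernel_def)

lemma nn_integral_radial':
  assumes F [measurable]: "F \<in> borel_measurable (borel \<Otimes>\<^sub>M borel)"
  shows "(\<integral>\<^sup>+y. ennreal (chord_kernel D R x y) * F (x, y) \<partial>\<sigma>) =
    dir_const TYPE('n) * (\<integral>\<^sup>+w. indicator (ball 0 1) w * (ennreal (npos x w) * F (x, x + \<tau> x w *\<^sub>R w)) \<partial>lborel)"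
proof (cases "x \<in> R")
  case True
  then show ?thesis unfolding dir_const_def by (rule nn_integral_radial) (rule F)
next
  case False
  then show ?thesis by (simp add: kernel_outside npos_def)
qed

text \<open>For a fixed starting point the end point is exchanged for a direction; after Fubini, for
  a fixed direction the starting point is exchanged for a point of the domain. The constant in front
  is the same for every domain, which is what allows two domains to be compared.\<close>

theorem nn_integral_chords:
  assumes F [measurable]: "F \<in> borel_measurable (borel \<Otimes>\<^sub>M borel)"
  shows "(\<integral>\<^sup>+x. \<integral>\<^sup>+y. ennreal (chord_kernel D R x y) * F (x, y) \<partial>\<sigma> \<partial>\<sigma>) =
    dir_const TYPE('n) * flat_const TYPE('n) * (\<integral>\<^sup>+w. indicator (ball 0 1) w *
      (\<integral>\<^sup>+z. indicator D z * (F (chord_ends D w z) * ennreal (1 / chord_length D w z)) \<partial>lborel) \<partial>lborel)"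
proof -
  interpret \<sigma>: finite_measure \<sigma> by (rule finite_sigma)
  interpret pair_sigma_finite \<sigma> "lborel :: (real^'n::_) measure" ..
  define h where "h = (\<lambda>(x, w). indicator (ball 0 1) w * (ennreal (npos x w) * F (x, x + \<tau> x w *\<^sub>R w)))"
  have h_meas [measurable]: "h \<in> borel_measurable (borel \<Otimes>\<^sub>M borel)"
    unfolding h_def split_beta by measurable
  have h': "h \<in> borel_measurable (\<sigma> \<Otimes>\<^sub>M (lborel :: (real^'n::_) measure))"
  proof -
    have "sets (\<sigma> \<Otimes>\<^sub>M (lborel :: (real^'n::_) measure)) = sets (borel \<Otimes>\<^sub>M borel)" by (intro sets_pair_measure_cong) auto
    then show ?thesis using h_meas measurable_cong_sets by blast
  qed
  have "(\<integral>\<^sup>+x. \<integral>\<^sup>+y. ennreal (chord_kernel D R x y) * F (x, y) \<partial>\<sigma> \<partial>\<sigma>) =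
      (\<integral>\<^sup>+x. dir_const TYPE('n) * (\<integral>\<^sup>+w. h (x, w) \<partial>lborel) \<partial>\<sigma>)"
    by (simp only: nn_integral_radial'[OF F] h_def prod.case)
  also have "\<dots> = dir_const TYPE('n) * (\<integral>\<^sup>+x. \<integral>\<^sup>+w. h (x, w) \<partial>lborel \<partial>\<sigma>)"
    by (intro nn_integral_cmult) measurable
  also have "(\<integral>\<^sup>+x. \<integral>\<^sup>+w. h (x, w) \<partial>lborel \<partial>\<sigma>) = (\<integral>\<^sup>+w. \<integral>\<^sup>+x. h (x, w) \<partial>\<sigma> \<partial>lborel)"
    using Fubini'[of "\<lambda>x w. h (x, w)"] h' by simp
  also have "\<dots> = (\<integral>\<^sup>+w. flat_const TYPE('n) * (indicator (ball 0 1) w *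
      (\<integral>\<^sup>+z. indicator D z * (F (chord_ends D w z) * ennreal (1 / chord_length D w z)) \<partial>lborel)) \<partial>lborel)"
  proof (rule nn_integral_cong_AE)
    show "AE w in lborel. (\<integral>\<^sup>+x. h (x, w) \<partial>\<sigma>) = flat_const TYPE('n) * (indicator (ball 0 1) w *
      (\<integral>\<^sup>+z. indicator D z * (F (chord_ends D w z) * ennreal (1 / chord_length D w z)) \<partial>lborel))"
      using AE_lborel_singleton[of 0]
    proof eventually_elim
      fix w :: "real^'n::_" assume w: "w \<noteq> 0"
      have m1: "(\<lambda>x. npos x w) \<in> borel_measurable borel"
        using measurable_compose[OF _ npos_measurable, of "\<lambda>x. (x, w)" borel] by simp
      have m2: "(\<lambda>x. \<tau> x w) \<in> borel_measurable borel"
        using measurable_compose[OF _ exit_measurable, of "\<lambda>x. (x, w)" borel] by simp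
      have "(\<integral>\<^sup>+x. h (x, w) \<partial>\<sigma>) = (\<integral>\<^sup>+x. indicator (ball 0 1) w * (ennreal (npos x w) * F (x, x + \<tau> x w *\<^sub>R w)) \<partial>\<sigma>)"
        by (simp add: h_def)
      also have "\<dots> = indicator (ball 0 1) w * (\<integral>\<^sup>+x. ennreal (npos x w) * F (x, x + \<tau> x w *\<^sub>R w) \<partial>\<sigma>)"
        using m1 m2 by (intro nn_integral_cmult) measurable
      finally show "(\<integral>\<^sup>+x. h (x, w) \<partial>\<sigma>) = flat_const TYPE('n) * (indicator (ball 0 1) w *
          (\<integral>\<^sup>+z. indicator D z * (F (chord_ends D w z) * ennreal (1 / chord_length D w z)) \<partial>lborel))"
        by (simp only: nn_integral_entry[OF w F] mult.left_commute)
    qed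
  qed
  also have "\<dots> = flat_const TYPE('n) * (\<integral>\<^sup>+w. indicator (ball 0 1) w *
      (\<integral>\<^sup>+z. indicator D z * (F (chord_ends D w z) * ennreal (1 / chord_length D w z)) \<partial>lborel) \<partial>lborel)"
  proof (rule nn_integral_cmult)
    have \<tau>m: "(\<lambda>p. \<tau> (snd p) (fst p)) \<in> borel_measurable (borel \<Otimes>\<^sub>M borel)"
      "(\<lambda>p. \<tau> (snd p) (- fst p)) \<in> borel_measurable (borel \<Otimes>\<^sub>M borel)"
      using measurable_compose[OF _ exit_measurable, of "\<lambda>p. (snd p, fst p)" "borel \<Otimes>\<^sub>M borel"]
        measurable_compose[OF _ exit_measurable, of "\<lambda>p. (snd p, - fst p)" "borel \<Otimes>\<^sub>M borel"] by simp_all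
    have "(\<lambda>p. indicator D (snd p) * (F (chord_ends D (fst p) (snd p)) * ennreal (1 / chord_length D (fst p) (snd p))))
        \<in> borel_measurable (borel \<Otimes>\<^sub>M borel)"
      unfolding chord_ends_def chord_length_def using \<tau>m by measurable
    then have "(\<lambda>(w, z). indicator D z * (F (chord_ends D w z) * ennreal (1 / chord_length D w z)))
        \<in> borel_measurable (borel \<Otimes>\<^sub>M lborel)"
      by (simp add: split_beta)
    then have "(\<lambda>w. \<integral>\<^sup>+z. indicator D z * (F (chord_ends D w z) * ennreal (1 / chord_length D w z)) \<partial>lborel) \<in> borel_measurable borel"
      by (rule lborel.borel_measurable_nn_integral)
    then show "(\<lambda>w. indicator (ball 0 1) w * (\<integral>\<^sup>+z. indicator D z * (F (chord_ends D w z) * ennreal (1 / chord_length D w z)) \<partial>lborel)) \<in> borel_measurable lborel"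
      by simp
  qed
  finally show ?thesis by (simp add: mult.assoc)
qed

text \<open>For \<open>x\<close> in \<open>R\<close>, the integral over the end point depends on
  \<open>x\<close> only through the unit vector \<open>inner_normal D x\<close>, and by rotation
  invariance not even on that. The boundary outside \<open>R\<close> has area zero, so the constant
  is multiplied by the full boundary area.\<close>

theorem nn_integral_kernel:
  assumes v: "norm (v :: real^'n::_) = 1"
  shows "(\<integral>\<^sup>+x. \<integral>\<^sup>+y. ennreal (chord_kernel D R x y) \<partial>\<sigma> \<partial>\<sigma>) =
    dir_const TYPE('n) * half_ball_moment v * hausdorff_outer (CARD('n) - 1) (frontier D)"
proof -
  have "(\<integral>\<^sup>+x. \<integral>\<^sup>+y. ennreal (chord_kernel D R x y) \<partial>\<sigma> \<partial>\<sigma>) = (\<integral>\<^sup>+x. dir_const TYPE('n) * half_ball_moment v * indicator R x \<partial>\<sigma>)"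
  proof (intro nn_integral_cong)
    fix x
    have "(\<integral>\<^sup>+y. ennreal (chord_kernel D R x y) \<partial>\<sigma>) =
        dir_const TYPE('n) * (\<integral>\<^sup>+w. indicator (ball 0 1) w * ennreal (npos x w) \<partial>lborel)"
      using nn_integral_radial'[of "\<lambda>_. 1" x] by simp
    also have "(\<integral>\<^sup>+w. indicator (ball 0 1) w * ennreal (npos x w) \<partial>lborel) = half_ball_moment v * indicator R x"
    proof (cases "x \<in> R")
      case True
      then have "(\<integral>\<^sup>+w. indicator (ball 0 1) w * ennreal (npos x w) \<partial>lborel) = half_ball_moment (inner_normal D x)"
        by (simp add: npos_def half_ball_moment_def)
      also have "\<dots> = half_ball_moment v" using norm_inner_normal[OF True] v by (rule half_ball_moment_eq)
      finally show ?thesis using True by simp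
    qed (simp add: npos_def)
    finally show "(\<integral>\<^sup>+y. ennreal (chord_kernel D R x y) \<partial>\<sigma>) = dir_const TYPE('n) * half_ball_moment v * indicator R x"
      by (simp add: mult.assoc)
  qed
  also have "\<dots> = dir_const TYPE('n) * half_ball_moment v * emeasure \<sigma> R"
    by (subst nn_integral_cmult) auto
  also have "emeasure \<sigma> R = hausdorff_outer (CARD('n) - 1) (frontier D)"
  proof (rule antisym)
    show "emeasure \<sigma> R \<le> hausdorff_outer (CARD('n) - 1) (frontier D)"
      by (simp add: emeasure_hausdorff_on outer_mono)
    have "hausdorff_outer (CARD('n) - 1) (frontier D) \<le> hausdorff_outer (CARD('n) - 1) (frontier D \<inter> R \<union> (frontier D - R))"
      by (rule outer_mono) auto
    also have "\<dots> \<le> hausdorff_outer (CARD('n) - 1) (frontier D \<inter> R) + hausdorff_outer (CARD('n) - 1) (frontier D - R)"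
      by (rule outer_Un_le)
    finally show "hausdorff_outer (CARD('n) - 1) (frontier D) \<le> emeasure \<sigma> R"
      unfolding null_rest by (simp add: emeasure_hausdorff_on)
  qed
  finally show ?thesis .
qed

end

subsection \<open>Induced chords\<close>

lemma open_segment_param:
  fixes x y w :: "'a::euclidean_space"
  assumes "y - x = c *\<^sub>R w" "c > 0" "w \<noteq> 0"
  shows "open_segment x y = (\<lambda>s. x + s *\<^sub>R w) ` {0<..<c}"
proof -
  have y: "y = x + c *\<^sub>R w" using assms(1) by (simp add: algebra_simps)
  show ?thesis
  proof (intro equalityI subsetI)
    fix p assume "p \<in> open_segment x y"
    then obtain u where u: "0 < u" "u < 1" "p = (1 - u) *\<^sub>R x + u *\<^sub>R y" by (auto simp: in_segment)
    then have "p = x + (u * c) *\<^sub>R w" by (simp add: y algebra_simps)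
    moreover have "u * c \<in> {0<..<c}" using u assms(2) by simp
    ultimately show "p \<in> (\<lambda>s. x + s *\<^sub>R w) ` {0<..<c}" by blast
  next
    fix p assume "p \<in> (\<lambda>s. x + s *\<^sub>R w) ` {0<..<c}"
    then obtain s where s: "0 < s" "s < c" "p = x + s *\<^sub>R w" by auto
    have "p = (1 - s / c) *\<^sub>R x + (s / c) *\<^sub>R y"
      using assms(2) s by (simp add: y algebra_simps)
    moreover have "0 < s / c" "s / c < 1" using s assms(2) by auto
    moreover have "x \<noteq> y" using assms by (auto simp: y)
    ultimately show "p \<in> open_segment x y" by (auto simp: in_segment)
  qed
qed

context bounded_domain
begin

lemma chord_ends_shift:
  assumes z: "z \<in> D" and w: "w \<noteq> 0" and s: "- \<tau> z (- w) < s" "s < \<tau> z w"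
  shows "chord_ends D w (z + s *\<^sub>R w) = chord_ends D w z" "chord_length D w (z + s *\<^sub>R w) = chord_length D w z"
  unfolding chord_ends_def chord_length_def exit_shift[OF assms] by (simp_all add: algebra_simps)

lemma chord_length_pos: "z \<in> D \<Longrightarrow> w \<noteq> 0 \<Longrightarrow> chord_length D w z > 0"
  unfolding chord_length_def by (intro add_pos_pos exit_pos) auto

text \<open>As the end points of the segment lie outside \<open>D\<close>, a chord through an
  interior point cannot pass beyond them.\<close>

lemma chord_in_segment:
  assumes xy: "y - x = c *\<^sub>R w" "c > 0" "w \<noteq> 0" "x \<notin> D" "y \<notin> D" and s: "0 < s" "s < c" "x + s *\<^sub>R w \<in> D"
  shows "\<tau> (x + s *\<^sub>R w) (- w) \<le> s" "\<tau> (x + s *\<^sub>R w) w \<le> c - s"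
proof -
  show "\<tau> (x + s *\<^sub>R w) (- w) \<le> s"
  proof (rule ccontr)
    assume "\<not> ?thesis"
    then have "x + s *\<^sub>R w + s *\<^sub>R (- w) \<in> D" using s by (intro exit_in) auto
    then show False using xy by simp
  qed
  show "\<tau> (x + s *\<^sub>R w) w \<le> c - s"
  proof (rule ccontr)
    assume "\<not> ?thesis"
    then have "x + s *\<^sub>R w + (c - s) *\<^sub>R w \<in> D" using s by (intro exit_in) auto
    moreover have "x + s *\<^sub>R w + (c - s) *\<^sub>R w = y" using xy(1) by (simp add: algebra_simps)
    ultimately show False using xy by simp
  qed
qed

text \<open>Along the line everything is one-dimensional: the parameters of a connected subset form
  an interval, and one that reached beyond the chord would contain an exit parameter, whose point is
  not in \<open>D\<close>.\<close>

lemma chord_component: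
  assumes xy: "y - x = c *\<^sub>R w" "c > 0" "w \<noteq> 0" "x \<notin> D" "y \<notin> D" and z: "z \<in> open_segment x y \<inter> D"
    and ab: "(a, b) = chord_ends D w z"
  shows "z \<in> open_segment a b" "open_segment a b \<in> components (open_segment x y \<inter> D)"
    "b - a = chord_length D w z *\<^sub>R w"
proof -
  obtain s0 where s0: "0 < s0" "s0 < c" "z = x + s0 *\<^sub>R w"
    using z by (auto simp: open_segment_param[OF xy(1-3)])
  have zD: "z \<in> D" using z by simp
  let ?m = "\<tau> z (- w)" and ?p = "\<tau> z w"
  have pos: "?m > 0" "?p > 0" using exit_pos[OF zD] xy(3) by auto
  have le: "?m \<le> s0" "?p \<le> c - s0"
    using chord_in_segment[OF xy s0(1,2)] zD s0(3) by auto
  have a: "a = z - ?m *\<^sub>R w" and b: "b = z + ?p *\<^sub>R w" using ab by (auto simp: chord_ends_def)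
  show len: "b - a = chord_length D w z *\<^sub>R w" by (simp add: a b chord_length_def algebra_simps)
  have "open_segment a b = (\<lambda>s. a + s *\<^sub>R w) ` {0<..<chord_length D w z}"
    using open_segment_param[OF len chord_length_pos[OF zD xy(3)] xy(3)] .
  also have "\<dots> = (\<lambda>s. x + s *\<^sub>R w) ` {s0 - ?m<..<s0 + ?p}"
  proof (intro equalityI subsetI)
    fix p assume "p \<in> (\<lambda>s. a + s *\<^sub>R w) ` {0<..<chord_length D w z}"
    then obtain s where s: "0 < s" "s < ?m + ?p" "p = a + s *\<^sub>R w" by (auto simp: chord_length_def)
    then have "p = x + (s0 - ?m + s) *\<^sub>R w" by (simp add: a s0(3) algebra_simps)
    then show "p \<in> (\<lambda>s. x + s *\<^sub>R w) ` {s0 - ?m<..<s0 + ?p}" using s by (intro image_eqI) auto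
  next
    fix p assume "p \<in> (\<lambda>s. x + s *\<^sub>R w) ` {s0 - ?m<..<s0 + ?p}"
    then obtain s where s: "s0 - ?m < s" "s < s0 + ?p" "p = x + s *\<^sub>R w" by auto
    then have "p = a + (s - s0 + ?m) *\<^sub>R w" by (simp add: a s0(3) algebra_simps)
    then show "p \<in> (\<lambda>s. a + s *\<^sub>R w) ` {0<..<chord_length D w z}"
      using s by (intro image_eqI) (auto simp: chord_length_def)
  qed
  finally have seg: "open_segment a b = (\<lambda>s. x + s *\<^sub>R w) ` {s0 - ?m<..<s0 + ?p}" .
  show zseg: "z \<in> open_segment a b" unfolding seg using pos s0(3) by auto
  have sub: "open_segment a b \<subseteq> open_segment x y \<inter> D"
  proof
    fix p assume "p \<in> open_segment a b"
    then obtain s where s: "s0 - ?m < s" "s < s0 + ?p" "p = x + s *\<^sub>R w" by (auto simp: seg)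
    have "z + (s - s0) *\<^sub>R w \<in> D" using s by (intro exit_shift(1)[OF zD xy(3)]) auto
    then have "p \<in> D" using s(3) s0(3) by (simp add: algebra_simps)
    moreover have "p \<in> open_segment x y" using s le by (auto simp: open_segment_param[OF xy(1-3)])
    ultimately show "p \<in> open_segment x y \<inter> D" by blast
  qed
  have ww: "w \<bullet> w \<noteq> 0" using xy(3) by simp
  \<comment> \<open>Recovers the parameter of a point on the line by projection to \<open>w\<close>,
    so that connectedness can be used on the real line.\<close>
  define g where "g q = ((q - x) \<bullet> w) / (w \<bullet> w)" for q
  have g: "g (x + s *\<^sub>R w) = s" for s using ww by (simp add: g_def)
  have maximal: "C \<subseteq> open_segment a b" if C: "C \<subseteq> open_segment x y \<inter> D" "connected C" "z \<in> C" for C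
  proof
    fix p assume p: "p \<in> C"
    then obtain s where s: "p = x + s *\<^sub>R w" using C(1) by (auto simp: open_segment_param[OF xy(1-3)])
    have gC: "connected (g ` C)"
      unfolding g_def by (intro connected_continuous_image C(2) continuous_intros) (use ww in auto)
    have "s0 \<in> g ` C" "s \<in> g ` C" using C(3) p s0(3) s g by (metis image_eqI)+
    have no: "r \<notin> g ` C" if "x + r *\<^sub>R w \<notin> D" for r
    proof
      assume "r \<in> g ` C"
      then obtain q where q: "q \<in> C" "r = g q" by auto
      then obtain t where "q = x + t *\<^sub>R w" using C(1) by (auto simp: open_segment_param[OF xy(1-3)])
      then have "x + r *\<^sub>R w = q" using q(2) g by simp
      then show False using q(1) C(1) that by auto
    qed
    have "s0 + ?p \<notin> g ` C"
      using exit_notin[OF xy(3), of z] s0(3) by (intro no) (simp add: algebra_simps)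
    moreover have "s0 - ?m \<notin> g ` C"
      using exit_notin[of "- w" z] xy(3) s0(3) by (intro no) (simp add: algebra_simps)
    moreover have "s0 + ?p \<in> g ` C" if "s0 + ?p \<le> s"
      using connected_contains_Icc[OF gC \<open>s0 \<in> g ` C\<close> \<open>s \<in> g ` C\<close>] that pos by (auto simp: subset_iff)
    moreover have "s0 - ?m \<in> g ` C" if "s \<le> s0 - ?m"
      using connected_contains_Icc[OF gC \<open>s \<in> g ` C\<close> \<open>s0 \<in> g ` C\<close>] that pos by (auto simp: subset_iff)
    ultimately have "s0 - ?m < s" "s < s0 + ?p" by (meson not_le)+
    then show "p \<in> open_segment a b" using s by (auto simp: seg)
  qed
  show "open_segment a b \<in> components (open_segment x y \<inter> D)"
    unfolding in_components_maximal
  proof (intro conjI allI impI)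
    show "open_segment a b \<noteq> {}" using zseg by auto
    show "connected (open_segment a b)" by (rule convex_connected) simp
    fix C assume "C \<noteq> {} \<and> open_segment a b \<subseteq> C \<and> C \<subseteq> open_segment x y \<inter> D \<and> connected C"
    then show "C = open_segment a b" using maximal[of C] zseg by auto
  qed (rule sub)
qed

text \<open>Every component contains a point, and that point determines the component as the chord
  through it. An open segment determines its end points up to order, and the orientation required in
  \<open>induced_chords\<close> fixes the order.\<close>

lemma induced_chords_eq:
  assumes xy: "y - x = c *\<^sub>R w" "c > 0" "w \<noteq> 0" "x \<notin> D" "y \<notin> D"
  shows "induced_chords D x y = chord_ends D w ` (open_segment x y \<inter> D)"
proof (intro equalityI subsetI)
  fix p assume "p \<in> chord_ends D w ` (open_segment x y \<inter> D)"
  then obtain z where z: "z \<in> open_segment x y \<inter> D" "p = chord_ends D w z" by auto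
  obtain a b where ab: "(a, b) = chord_ends D w z" by (metis surj_pair)
  note cc = chord_component[OF xy z(1) ab]
  have "b - a = (chord_length D w z / c) *\<^sub>R (y - x)" using cc(3) xy(1,2) by simp
  moreover have "chord_length D w z / c > 0" using chord_length_pos[of z w] z(1) xy by auto
  ultimately show "p \<in> induced_chords D x y"
    using cc(2) z(2) ab by (auto simp: induced_chords_def intro!: exI[of _ "chord_length D w z / c"])
next
  fix p assume "p \<in> induced_chords D x y"
  then obtain a1 b1 c1 where p: "p = (a1, b1)" "open_segment a1 b1 \<in> components (open_segment x y \<inter> D)"
    "c1 > 0" "b1 - a1 = c1 *\<^sub>R (y - x)"
    by (auto simp: induced_chords_def)
  obtain z where z: "z \<in> open_segment a1 b1" using in_components_nonempty[OF p(2)] by blast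
  then have zi: "z \<in> open_segment x y \<inter> D" using in_components_subset[OF p(2)] by blast
  obtain a b where ab: "(a, b) = chord_ends D w z" by (metis surj_pair)
  note cc = chord_component[OF xy zi ab]
  have "open_segment a1 b1 = open_segment a b"
    using components_nonoverlap[OF p(2) cc(2)] z cc(1) by blast
  moreover have "a1 \<noteq> b1" using z by auto
  ultimately have "a1 = a \<and> b1 = b \<or> a1 = b \<and> b1 = a"
    by (auto simp: open_segment_eq doubleton_eq_iff)
  moreover have "\<not> (a1 = b \<and> b1 = a)"
  proof
    assume eq: "a1 = b \<and> b1 = a"
    then have "(b - a) + (b1 - a1) = 0" by simp
    then have "(chord_length D w z + c1 * c) *\<^sub>R w = 0"
      using cc(3) p(4) xy(1) by (simp add: algebra_simps)
    moreover have "chord_length D w z + c1 * c > 0"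
      using chord_length_pos[of z w] zi xy p(3) by (auto intro: add_pos_pos)
    ultimately show False using xy(3) by simp
  qed
  ultimately show "p \<in> chord_ends D w ` (open_segment x y \<inter> D)" using p(1) ab zi by auto
qed

text \<open>Each chord carries total weight one when that weight is spread uniformly over it.\<close>

lemma induced_chords_integral:
  assumes xy: "y - x = c *\<^sub>R w" "c > 0" "w \<noteq> 0" "x \<notin> D" "y \<notin> D"
  shows "(\<integral>\<^sup>+p. indicator C p \<partial>count_space (induced_chords D x y)) =
    (\<integral>\<^sup>+s. indicator {0<..<c} s * (indicator D (x + s *\<^sub>R w) * indicator C (chord_ends D w (x + s *\<^sub>R w)) *
      ennreal (1 / chord_length D w (x + s *\<^sub>R w))) \<partial>lborel)"
proof -
  let ?I = "induced_chords D x y"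
  define P where "P s = chord_ends D w (x + s *\<^sub>R w)" for s
  define g where "g s = ennreal (1 / chord_length D w (x + s *\<^sub>R w))" for s
  define Os where "Os = {s. 0 < s \<and> s < c \<and> x + s *\<^sub>R w \<in> D}"
  \<comment> \<open>The parameters that belong to one induced chord \<open>p\<close>; for different
    chords these are disjoint open intervals.\<close>
  define A where "A p = {s \<in> Os. P s = p}" for p
  have I: "?I = P ` Os"
  proof -
    have "(\<lambda>s. x + s *\<^sub>R w) ` {0<..<c} \<inter> D = (\<lambda>s. x + s *\<^sub>R w) ` Os" by (auto simp: Os_def)
    then show ?thesis
      unfolding induced_chords_eq[OF xy] open_segment_param[OF xy(1-3)] by (simp add: image_image P_def)
  qed
  have near: "{s - \<tau> (x + s *\<^sub>R w) (- w)<..<s + \<tau> (x + s *\<^sub>R w) w} \<subseteq> A (P s)"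
    "\<And>t. t \<in> {s - \<tau> (x + s *\<^sub>R w) (- w)<..<s + \<tau> (x + s *\<^sub>R w) w} \<Longrightarrow> g t = g s"
    if s: "s \<in> Os" for s
  proof -
    let ?z = "x + s *\<^sub>R w"
    have sO: "0 < s" "s < c" "?z \<in> D" using s by (auto simp: Os_def)
    note le = chord_in_segment[OF xy sO]
    have eq: "x + t *\<^sub>R w = ?z + (t - s) *\<^sub>R w" for t by (simp add: algebra_simps)
    have t: "x + t *\<^sub>R w \<in> D" "P t = P s" "g t = g s" "0 < t" "t < c"
      if t: "t \<in> {s - \<tau> ?z (- w)<..<s + \<tau> ?z w}" for t
    proof -
      have t': "- \<tau> ?z (- w) < t - s" "t - s < \<tau> ?z w" using t by auto
      show "x + t *\<^sub>R w \<in> D" unfolding eq[of t] by (rule exit_shift(1)[OF sO(3) xy(3) t'])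
      show "P t = P s" unfolding P_def eq[of t] by (rule chord_ends_shift(1)[OF sO(3) xy(3) t'])
      show "g t = g s" unfolding g_def eq[of t] chord_ends_shift(2)[OF sO(3) xy(3) t'] ..
      show "0 < t" "t < c" using t le by auto
    qed
    show "{s - \<tau> ?z (- w)<..<s + \<tau> ?z w} \<subseteq> A (P s)"
      using t by (auto simp: A_def Os_def)
    show "\<And>t. t \<in> {s - \<tau> ?z (- w)<..<s + \<tau> ?z w} \<Longrightarrow> g t = g s" using t by blast
  qed
  have A_eq: "A (P s) = {s - \<tau> (x + s *\<^sub>R w) (- w)<..<s + \<tau> (x + s *\<^sub>R w) w}" if s: "s \<in> Os" for s
  proof
    show "A (P s) \<subseteq> {s - \<tau> (x + s *\<^sub>R w) (- w)<..<s + \<tau> (x + s *\<^sub>R w) w}"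
    proof
      fix t assume "t \<in> A (P s)"
      then have t: "t \<in> Os" "P t = P s" by (auto simp: A_def)
      let ?y = "x + t *\<^sub>R w" and ?z = "x + s *\<^sub>R w"
      have "(t - \<tau> ?y (- w)) *\<^sub>R w = (s - \<tau> ?z (- w)) *\<^sub>R w" "(t + \<tau> ?y w) *\<^sub>R w = (s + \<tau> ?z w) *\<^sub>R w"
        using t(2) by (auto simp: P_def chord_ends_def algebra_simps)
      then have "t - \<tau> ?y (- w) = s - \<tau> ?z (- w)" "t + \<tau> ?y w = s + \<tau> ?z w" using xy(3) by auto
      moreover have "\<tau> ?y (- w) > 0" "\<tau> ?y w > 0" using t(1) xy(3) by (auto simp: Os_def intro: exit_pos)
      ultimately show "t \<in> {s - \<tau> ?z (- w)<..<s + \<tau> ?z w}" by auto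
    qed
  qed (rule near(1)[OF s])
  have pos: "\<tau> (x + s *\<^sub>R w) (- w) > 0" "\<tau> (x + s *\<^sub>R w) w > 0" if "s \<in> Os" for s
    using that xy(3) by (auto simp: Os_def intro: exit_pos)
  \<comment> \<open>Each chord occupies an interval of parameters and thus contains a rational one.
    Countability permits the exchange of the sum over chords with the integral.\<close>
  have countable: "countable ?I"
  proof (rule countable_subset[OF _ countable_image[OF countable_rat, of P]], rule subsetI)
    fix p assume "p \<in> ?I"
    then obtain s where s: "s \<in> Os" "p = P s" using I by auto
    have "s < s + \<tau> (x + s *\<^sub>R w) w" using pos(2)[OF s(1)] by simp
    then obtain q where q: "q \<in> \<rat>" "s < q" "q < s + \<tau> (x + s *\<^sub>R w) w" using Rats_dense_in_real by blast
    then have "q \<in> A (P s)" using pos(1)[OF s(1)] by (auto simp: A_eq[OF s(1)])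
    then have "p = P q" using s(2) by (simp add: A_def)
    then show "p \<in> P ` \<rat>" using q(1) by (rule image_eqI)
  qed
  have \<tau>_meas [measurable]: "(\<lambda>s. \<tau> (x + s *\<^sub>R w) v) \<in> borel_measurable borel" for v
    using measurable_compose[OF _ exit_measurable, of "\<lambda>s. (x + s *\<^sub>R w, v)" borel] by simp
  have g_meas [measurable]: "g \<in> borel_measurable borel" unfolding g_def chord_length_def by measurable
  have A_meas: "A p \<in> sets borel" if p: "p \<in> ?I" for p
  proof -
    obtain s where "s \<in> Os" "p = P s" using p I by auto
    then show ?thesis using A_eq by simp
  qed
  have one: "(\<integral>\<^sup>+s. indicator (A p) s * g s \<partial>lborel) = 1" if p: "p \<in> ?I" for p
  proof -
    obtain s where s: "s \<in> Os" "p = P s" using p I by auto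
    have "(\<integral>\<^sup>+t. indicator (A p) t * g t \<partial>lborel) =
        (\<integral>\<^sup>+t. g s * indicator {s - \<tau> (x + s *\<^sub>R w) (- w)<..<s + \<tau> (x + s *\<^sub>R w) w} t \<partial>lborel)"
      using near(2)[OF s(1)] by (intro nn_integral_cong) (auto simp: s(2) A_eq[OF s(1)] split: split_indicator)
    also have "\<dots> = g s * ennreal (chord_length D w (x + s *\<^sub>R w))"
      using pos[OF s(1)] by (subst nn_integral_cmult) (auto simp: chord_length_def add.commute)
    also have "\<dots> = 1"
      using pos[OF s(1)] unfolding g_def chord_length_def by (subst ennreal_mult''[symmetric]) auto
    finally show ?thesis .
  qed
  have "(\<integral>\<^sup>+p. indicator C p \<partial>count_space ?I) = (\<integral>\<^sup>+p. \<integral>\<^sup>+s. indicator C p * (indicator (A p) s * g s) \<partial>lborel \<partial>count_space ?I)"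
  proof (intro nn_integral_cong)
    fix p assume "p \<in> space (count_space ?I)"
    then have p: "p \<in> ?I" by simp
    have "(\<integral>\<^sup>+s. indicator C p * (indicator (A p) s * g s) \<partial>lborel) = indicator C p * (\<integral>\<^sup>+s. indicator (A p) s * g s \<partial>lborel)"
      using A_meas[OF p] by (intro nn_integral_cmult) simp
    then show "indicator C p = (\<integral>\<^sup>+s. indicator C p * (indicator (A p) s * g s) \<partial>lborel)"
      by (simp add: one[OF p])
  qed
  also have "\<dots> = (\<integral>\<^sup>+s. \<integral>\<^sup>+p. indicator C p * (indicator (A p) s * g s) \<partial>count_space ?I \<partial>lborel)"
    using countable A_meas by (intro nn_integral_count_space_nn_integral[symmetric]) auto
  also have "\<dots> = (\<integral>\<^sup>+s. indicator {0<..<c} s * (indicator D (x + s *\<^sub>R w) * indicator C (chord_ends D w (x + s *\<^sub>R w)) *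
      ennreal (1 / chord_length D w (x + s *\<^sub>R w))) \<partial>lborel)"
  proof (intro nn_integral_cong)
    fix s
    show "(\<integral>\<^sup>+p. indicator C p * (indicator (A p) s * g s) \<partial>count_space ?I) =
        indicator {0<..<c} s * (indicator D (x + s *\<^sub>R w) * indicator C (chord_ends D w (x + s *\<^sub>R w)) *
        ennreal (1 / chord_length D w (x + s *\<^sub>R w)))"
    proof (cases "s \<in> Os")
      case True
      then have PI: "P s \<in> ?I" using I by auto
      have "(\<integral>\<^sup>+p. indicator C p * (indicator (A p) s * g s) \<partial>count_space ?I) =
          (\<integral>\<^sup>+p. (indicator C (P s) * g s) * indicator {P s} p \<partial>count_space ?I)"
        using True by (intro nn_integral_cong) (auto simp: A_def split: split_indicator)
      also have "\<dots> = (indicator C (P s) * g s) * emeasure (count_space ?I) {P s}"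
        using PI by (intro nn_integral_cmult_indicator) auto
      also have "emeasure (count_space ?I) {P s} = 1" using PI by (subst emeasure_count_space) auto
      finally show ?thesis using True by (simp add: Os_def P_def g_def)
    next
      case False
      then have "indicator (A p) s = (0 :: ennreal)" for p by (simp add: A_def)
      moreover have "indicator {0<..<c} s * indicator D (x + s *\<^sub>R w) = (0 :: ennreal)"
        using False by (auto simp: Os_def split: split_indicator)
      ultimately show ?thesis by (simp add: mult.assoc[symmetric])
    qed
  qed
  finally show ?thesis .
qed

end


text \<open>Mass transport along the lines with direction \<open>w\<close>: every chord of the inner domain is counted
  with total weight one, whether it is spread uniformly over itself or over the chord of the outer
  domain which contains it.\<close>

lemma chord_transport:
  fixes D D' R R' :: "(real^'n::{finite,wellorder}) set"
  assumes "bounded_domain D R" "bounded_domain D' R'" and sub: "D' \<subseteq> D" and w: "w \<noteq> 0"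
    and C [measurable]: "C \<in> sets (borel \<Otimes>\<^sub>M borel)"
  shows "(\<integral>\<^sup>+z. indicator D z * ((\<integral>\<^sup>+p. indicator C p \<partial>count_space (induced_chords D' (fst (chord_ends D w z)) (snd (chord_ends D w z)))) *
      ennreal (1 / chord_length D w z)) \<partial>lborel) =
    (\<integral>\<^sup>+z. indicator D' z * (indicator C (chord_ends D' w z) * ennreal (1 / chord_length D' w z)) \<partial>lborel)"
proof -
  interpret D: bounded_domain D R by fact
  interpret D': bounded_domain D' R' by fact
  define G where "G z = indicator D' z * indicator C (chord_ends D' w z) * ennreal (1 / chord_length D' w z)" for z
  have D\<tau> [measurable]: "(\<lambda>z. D.\<tau> z v) \<in> borel_measurable borel" for v
    using measurable_compose[OF _ D.exit_measurable, of "\<lambda>z. (z, v)" borel] by simp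
  have D'\<tau> [measurable]: "(\<lambda>z. D'.\<tau> z v) \<in> borel_measurable borel" for v
    using measurable_compose[OF _ D'.exit_measurable, of "\<lambda>z. (z, v)" borel] by simp
  have G_meas [measurable]: "G \<in> borel_measurable borel"
    unfolding G_def chord_ends_def chord_length_def by measurable
  \<comment> \<open>The density with which mass at \<open>z\<close> is moved to
    \<open>z + s *\<^sub>R w\<close>: uniform over the chord of \<open>D\<close> through
    \<open>z\<close>.\<close>
  define N where "N z s = indicator D z * indicator {- D.\<tau> z (- w)<..<D.\<tau> z w} s * ennreal (1 / chord_length D w z)" for z and s :: real
  have N_meas [measurable]: "(\<lambda>(z, s). N z s) \<in> borel_measurable (borel \<Otimes>\<^sub>M borel)"
    unfolding N_def chord_length_def greaterThanLessThan_iff indicator_def of_bool_def split_beta by measurable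
  have "(\<integral>\<^sup>+z. indicator D z * ((\<integral>\<^sup>+p. indicator C p \<partial>count_space (induced_chords D' (fst (chord_ends D w z)) (snd (chord_ends D w z)))) *
      ennreal (1 / chord_length D w z)) \<partial>lborel) = (\<integral>\<^sup>+z. \<integral>\<^sup>+s. N z s * G (z + s *\<^sub>R w) \<partial>lborel \<partial>lborel)"
  proof (intro nn_integral_cong)
    fix z :: "real^'n::_"
    show "indicator D z * ((\<integral>\<^sup>+p. indicator C p \<partial>count_space (induced_chords D' (fst (chord_ends D w z)) (snd (chord_ends D w z)))) *
      ennreal (1 / chord_length D w z)) = (\<integral>\<^sup>+s. N z s * G (z + s *\<^sub>R w) \<partial>lborel)"
    proof (cases "z \<in> D")
      case True
      let ?m = "D.\<tau> z (- w)" and ?l = "chord_length D w z"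
      define x where "x = z - ?m *\<^sub>R w"
      define y where "y = z + D.\<tau> z w *\<^sub>R w"
      have ends: "chord_ends D w z = (x, y)" by (simp add: chord_ends_def x_def y_def)
      have xy: "y - x = ?l *\<^sub>R w" by (simp add: x_def y_def chord_length_def algebra_simps)
      have l: "?l > 0" by (rule D.chord_length_pos[OF True w])
      have "x \<notin> D" "y \<notin> D"
        using D.exit_notin[of "- w" z] D.exit_notin[OF w, of z] w by (auto simp: x_def y_def)
      then have xy': "x \<notin> D'" "y \<notin> D'" using sub by auto
      have "(\<integral>\<^sup>+p. indicator C p \<partial>count_space (induced_chords D' x y)) =
          (\<integral>\<^sup>+s. indicator {0<..<?l} s * G (x + s *\<^sub>R w) \<partial>lborel)"
        unfolding G_def by (rule D'.induced_chords_integral[OF xy l w xy'])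
      also have "\<dots> = (\<integral>\<^sup>+s. indicator {0<..<?l} (s + ?m) * G (x + (s + ?m) *\<^sub>R w) \<partial>lborel)"
      proof -
        have "(\<lambda>s. indicator {0<..<?l} s * G (x + s *\<^sub>R w)) \<in> borel_measurable borel" by measurable
        from nn_integral_lborel_translate[OF this, of ?m] show ?thesis by simp
      qed
      also have "\<dots> = (\<integral>\<^sup>+s. indicator {- ?m<..<D.\<tau> z w} s * G (z + s *\<^sub>R w) \<partial>lborel)"
      proof (intro nn_integral_cong)
        fix s :: real
        have "x + (s + ?m) *\<^sub>R w = z + s *\<^sub>R w" by (simp add: x_def algebra_simps)
        moreover have "indicator {0<..<?l} (s + ?m) = (indicator {- ?m<..<D.\<tau> z w} s :: ennreal)"
          by (auto simp: indicator_def chord_length_def)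
        ultimately show "indicator {0<..<?l} (s + ?m) * G (x + (s + ?m) *\<^sub>R w) = indicator {- ?m<..<D.\<tau> z w} s * G (z + s *\<^sub>R w)"
          by simp
      qed
      also have "\<dots> * ennreal (1 / ?l) = (\<integral>\<^sup>+s. indicator {- ?m<..<D.\<tau> z w} s * G (z + s *\<^sub>R w) * ennreal (1 / ?l) \<partial>lborel)"
        by (rule nn_integral_multc[symmetric]) measurable
      finally show ?thesis using True by (simp add: ends N_def mult_ac)
    qed (simp add: N_def)
  qed
  also have "\<dots> = (\<integral>\<^sup>+s. \<integral>\<^sup>+z. N z s * G (z + s *\<^sub>R w) \<partial>lborel \<partial>lborel)"
    by (rule lborel_pair.Fubini'[symmetric]) measurable
  also have "\<dots> = (\<integral>\<^sup>+s. \<integral>\<^sup>+z. N (z - s *\<^sub>R w) s * G z \<partial>lborel \<partial>lborel)"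
  proof (rule nn_integral_cong)
    fix s :: real
    have "(\<lambda>z. N (z - s *\<^sub>R w) s * G z) \<in> borel_measurable borel" by measurable
    from nn_integral_lborel_translate[OF this, of "s *\<^sub>R w"]
    show "(\<integral>\<^sup>+z. N z s * G (z + s *\<^sub>R w) \<partial>lborel) = (\<integral>\<^sup>+z. N (z - s *\<^sub>R w) s * G z \<partial>lborel)" by simp
  qed
  also have "\<dots> = (\<integral>\<^sup>+z. \<integral>\<^sup>+s. N (z - s *\<^sub>R w) s * G z \<partial>lborel \<partial>lborel)"
    by (rule lborel_pair.Fubini') measurable
  also have "\<dots> = (\<integral>\<^sup>+z. G z \<partial>lborel)"
  proof (intro nn_integral_cong)
    fix z :: "real^'n::_"
    show "(\<integral>\<^sup>+s. N (z - s *\<^sub>R w) s * G z \<partial>lborel) = G z"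
    proof (cases "z \<in> D'")
      case True
      then have z: "z \<in> D" using sub by auto
      let ?m = "D.\<tau> z (- w)" and ?p = "D.\<tau> z w"
      have pos: "?m > 0" "?p > 0" using D.exit_pos[OF z] w by auto
      \<comment> \<open>The points that send mass to \<open>z\<close> are those of the chord through
        \<open>z\<close>, and their chord is the same and has the same length; so the total density
        received at \<open>z\<close> is one as well.\<close>
      have Neq: "N (z - s *\<^sub>R w) s = ennreal (1 / chord_length D w z) * indicator {- ?p<..<?m} s" for s
      proof (cases "- ?p < s \<and> s < ?m")
        case s: True
        have s': "- ?m < - s" "- s < ?p" using s by auto
        note sh = D.exit_shift[OF z w s'] and le = D.chord_ends_shift(2)[OF z w s']
        have eq: "z - s *\<^sub>R w = z + (- s) *\<^sub>R w" by simp
        show ?thesis unfolding N_def eq le sh(2,3) using sh(1) s pos by simp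
      next
        case False
        have "\<not> (z - s *\<^sub>R w \<in> D \<and> - D.\<tau> (z - s *\<^sub>R w) (- w) < s \<and> s < D.\<tau> (z - s *\<^sub>R w) w)"
        proof
          let ?z = "z - s *\<^sub>R w"
          assume a: "?z \<in> D \<and> - D.\<tau> ?z (- w) < s \<and> s < D.\<tau> ?z w"
          note sh = D.exit_shift(2,3)[of ?z w s]
          have "?z + s *\<^sub>R w = z" by simp
          then have "?p = D.\<tau> ?z w - s" "?m = D.\<tau> ?z (- w) + s" using sh a w by auto
          moreover have "D.\<tau> ?z w > 0" "D.\<tau> ?z (- w) > 0" using D.exit_pos[of ?z] a w by auto
          ultimately show False using False by linarith
        qed
        then show ?thesis using False by (auto simp: N_def split: split_indicator)
      qed
      have "(\<integral>\<^sup>+s. N (z - s *\<^sub>R w) s * G z \<partial>lborel) =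
          (\<integral>\<^sup>+s. (G z * ennreal (1 / chord_length D w z)) * indicator {- ?p<..<?m} s \<partial>lborel)"
        by (intro nn_integral_cong) (simp add: Neq mult_ac)
      also have "\<dots> = G z * ennreal (1 / chord_length D w z) * ennreal (chord_length D w z)"
        using pos by (subst nn_integral_cmult) (auto simp: chord_length_def)
      also have "\<dots> = G z"
      proof -
        have "ennreal (1 / chord_length D w z) * ennreal (chord_length D w z) = 1"
          using D.chord_length_pos[OF z w] by (subst ennreal_mult''[symmetric]) auto
        then show ?thesis by (simp add: mult.assoc)
      qed
      finally show ?thesis .
    qed (simp add: G_def)
  qed
  finally show ?thesis by (simp add: G_def mult.assoc)
qed

subsection \<open>The random chord\<close>

lemma borel_measurable_boundary_pair:
  "f \<in> borel_measurable (borel \<Otimes>\<^sub>M borel) \<Longrightarrow> f \<in> borel_measurable (boundary_measure D \<Otimes>\<^sub>M boundary_measure D)"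
  for f :: "_ \<Rightarrow> ennreal"
proof -
  assume f: "f \<in> borel_measurable (borel \<Otimes>\<^sub>M borel)"
  have id: "(\<lambda>x. x) \<in> boundary_measure D \<rightarrow>\<^sub>M borel"
    unfolding boundary_measure_def by (rule measurable_restrict_space1) simp
  have "(\<lambda>p. (fst p, snd p)) \<in> boundary_measure D \<Otimes>\<^sub>M boundary_measure D \<rightarrow>\<^sub>M borel \<Otimes>\<^sub>M borel"
    using measurable_compose[OF measurable_fst id] measurable_compose[OF measurable_snd id] by (rule measurable_Pair)
  from measurable_compose[OF this f] show ?thesis by simp
qed

context bounded_domain
begin

lemma nn_integral_boundary:
  assumes f: "f \<in> borel_measurable borel"
  shows "(\<integral>\<^sup>+x. f x \<partial>boundary_measure D) = (\<integral>\<^sup>+x. f x \<partial>\<sigma>)"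
proof -
  have "(\<integral>\<^sup>+x. f x \<partial>boundary_measure D) = (\<integral>\<^sup>+x. f x * indicator (frontier D) x \<partial>hausdorff_measure (CARD('n) - 1))"
    unfolding boundary_measure_def by (intro nn_integral_restrict_space) simp
  also have "\<dots> = (\<integral>\<^sup>+x. f x \<partial>\<sigma>)"
    unfolding hausdorff_on_def using f by (subst nn_integral_density) (auto simp: mult.commute)
  finally show ?thesis .
qed

lemma finite_boundary: "finite_measure (boundary_measure D)"
proof (rule finite_measureI)
  have "emeasure (boundary_measure D) (space (boundary_measure D)) = hausdorff_outer (CARD('n) - 1) (frontier D)"
    unfolding boundary_measure_def
    by (subst emeasure_restrict_space) (auto simp: space_restrict_space emeasure_hausdorff)
  then show "emeasure (boundary_measure D) (space (boundary_measure D)) \<noteq> \<infinity>" using finite_S by simp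
qed

lemma nn_integral_boundary_pair:
  assumes f [measurable]: "f \<in> borel_measurable (borel \<Otimes>\<^sub>M borel)"
  shows "(\<integral>\<^sup>+p. f p \<partial>(boundary_measure D \<Otimes>\<^sub>M boundary_measure D)) = (\<integral>\<^sup>+x. \<integral>\<^sup>+y. f (x, y) \<partial>\<sigma> \<partial>\<sigma>)"
proof -
  interpret b: finite_measure "boundary_measure D" by (rule finite_boundary)
  interpret \<sigma>: finite_measure \<sigma> by (rule finite_sigma)
  have f': "f \<in> borel_measurable (borel \<Otimes>\<^sub>M \<sigma>)"
    using f sets_pair_measure_cong[OF refl sets_hausdorff_on, of borel "CARD('n) - 1" "frontier D"] measurable_cong_sets by blast
  have "(\<integral>\<^sup>+p. f p \<partial>(boundary_measure D \<Otimes>\<^sub>M boundary_measure D)) = (\<integral>\<^sup>+x. \<integral>\<^sup>+y. f (x, y) \<partial>boundary_measure D \<partial>boundary_measure D)"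
    by (rule b.nn_integral_fst[symmetric]) (rule borel_measurable_boundary_pair[OF f])
  also have "\<dots> = (\<integral>\<^sup>+x. \<integral>\<^sup>+y. f (x, y) \<partial>\<sigma> \<partial>boundary_measure D)"
    by (intro nn_integral_cong nn_integral_boundary) measurable
  also have "\<dots> = (\<integral>\<^sup>+x. \<integral>\<^sup>+y. f (x, y) \<partial>\<sigma> \<partial>\<sigma>)"
    by (intro nn_integral_boundary \<sigma>.borel_measurable_nn_integral_fst f')
  finally show ?thesis .
qed

text \<open>For visible pairs both inner products are nonnegative, so they agree with
  \<open>npos\<close>; measurability then follows from that of \<open>npos\<close> and of the exit
  time.\<close>

lemma kernel_measurable [measurable]: "(\<lambda>(x, y). chord_kernel D R x y) \<in> borel_measurable (borel \<Otimes>\<^sub>M borel)"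
proof -
  have eq: "chord_kernel D R x y = gamma_const TYPE('n) * npos x (y - x) * npos y (x - y) / norm (x - y) ^ (CARD('n) + 1)
      * of_bool (x \<noteq> y \<and> 1 \<le> \<tau> x (y - x))" for x y
  proof (cases "x \<in> R \<and> y \<in> R \<and> visible D x y")
    case True
    then have "0 \<le> (y - x) \<bullet> inner_normal D x" "0 \<le> (x - y) \<bullet> inner_normal D y"
      using inner_visible_le[OF bounded_domain_axioms] visible_sym by blast+
    then show ?thesis using True by (simp add: chord_kernel_def npos_def visible_iff)
  next
    case False
    then show ?thesis by (auto simp: chord_kernel_def npos_def visible_iff)
  qed
  have 1: "(\<lambda>p. \<tau> (fst p) (snd p - fst p)) \<in> borel_measurable (borel \<Otimes>\<^sub>M borel)"
    using measurable_compose[OF _ exit_measurable, of "\<lambda>p. (fst p, snd p - fst p)" "borel \<Otimes>\<^sub>M borel"] by simp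
  have 2: "(\<lambda>p. npos (fst p) (snd p - fst p)) \<in> borel_measurable (borel \<Otimes>\<^sub>M borel)"
    using measurable_compose[OF _ npos_measurable, of "\<lambda>p. (fst p, snd p - fst p)" "borel \<Otimes>\<^sub>M borel"] by simp
  have 3: "(\<lambda>p. npos (snd p) (fst p - snd p)) \<in> borel_measurable (borel \<Otimes>\<^sub>M borel)"
    using measurable_compose[OF _ npos_measurable, of "\<lambda>p. (snd p, fst p - snd p)" "borel \<Otimes>\<^sub>M borel"] by simp
  show ?thesis unfolding eq split_beta using 1 2 3 by measurable
qed

end

text \<open>The integral form of the sum over induced chords, for the direction \<open>y - x\<close>
  and parameters from 0 to 1. This form exhibits the sum as a Borel function of the pair of end
  points.\<close>

definition induced_count ::
  "(real^'n::{finite,wellorder}) set \<Rightarrow> ((real^'n::_) \<times> (real^'n::_)) set \<Rightarrow> (real^'n::_) \<times> (real^'n::_) \<Rightarrow> ennreal" where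
  "induced_count D' C = (\<lambda>(x, y). \<integral>\<^sup>+s. indicator {0<..<1} s * (indicator D' (x + s *\<^sub>R (y - x)) *
    indicator C (chord_ends D' (y - x) (x + s *\<^sub>R (y - x))) * ennreal (1 / chord_length D' (y - x) (x + s *\<^sub>R (y - x)))) \<partial>lborel)"

context bounded_domain
begin

lemma induced_count_measurable [measurable]:
  assumes [measurable]: "C \<in> sets (borel \<Otimes>\<^sub>M borel)"
  shows "induced_count D C \<in> borel_measurable (borel \<Otimes>\<^sub>M borel)"
proof -
  let ?B = "(borel \<Otimes>\<^sub>M borel) \<Otimes>\<^sub>M (lborel :: real measure) :: (((real^'n::_) \<times> (real^'n::_)) \<times> real) measure"
  have [measurable]: "(\<lambda>q. \<tau> (fst (fst q) + snd q *\<^sub>R (snd (fst q) - fst (fst q))) (snd (fst q) - fst (fst q))) \<in> borel_measurable ?B"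
    using measurable_compose[OF _ exit_measurable, of "\<lambda>q. (fst (fst q) + snd q *\<^sub>R (snd (fst q) - fst (fst q)), snd (fst q) - fst (fst q))" ?B]
    by simp
  have [measurable]: "(\<lambda>q. \<tau> (fst (fst q) + snd q *\<^sub>R (snd (fst q) - fst (fst q))) (- (snd (fst q) - fst (fst q)))) \<in> borel_measurable ?B"
    using measurable_compose[OF _ exit_measurable, of "\<lambda>q. (fst (fst q) + snd q *\<^sub>R (snd (fst q) - fst (fst q)), - (snd (fst q) - fst (fst q)))" ?B]
    by simp
  show ?thesis
    unfolding induced_count_def split_beta chord_ends_def chord_length_def by measurable
qed

lemma induced_count_eq:
  assumes "x \<notin> D" "y \<notin> D"
  shows "(\<integral>\<^sup>+p. indicator C p \<partial>count_space (induced_chords D x y)) = induced_count D C (x, y)"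
proof (cases "x = y")
  case True
  then have "induced_chords D x y = {}" by (auto simp: induced_chords_def)
  \<comment> \<open>Here the direction and the chord length are 0, so the reciprocal is 0 by
    convention and the integral vanishes like the empty sum.\<close>
  then show ?thesis using True by (simp add: induced_count_def chord_length_def nn_integral_empty)
next
  case False
  then show ?thesis
    unfolding induced_count_def prod.case using assms by (intro induced_chords_integral) auto
qed

end

text \<open>\<open>nn_integral_chords\<close> turns the law of the chord into an integral over
  directions and points of \<open>D\<close>, mass transport replaces these by points of
  \<open>D'\<close>, and the same formula for \<open>D'\<close> leads back to its kernel. The
  constants of the two applications are equal, so they remain unevaluated.\<close>

lemma induced_chords_expectation:
  fixes D D' R R' :: "(real^'n::{finite,wellorder}) set"
    and M :: "'w measure" and X Y :: "'w \<Rightarrow> real^'n::_"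
  assumes "bounded_domain D R" "bounded_domain D' R'" and sub: "D' \<subseteq> D"
    and chord: "random_chord M D R X Y" and C [measurable]: "C \<in> sets (borel \<Otimes>\<^sub>M borel)"
  shows "(\<integral>\<^sup>+\<omega>. (\<integral>\<^sup>+p. indicator C p \<partial>count_space (induced_chords D' (X \<omega>) (Y \<omega>))) \<partial>M) =
    inverse (area (frontier D)) * (\<integral>\<^sup>+(x, y). ennreal (chord_kernel D' R' x y) * indicator C (x, y)
      \<partial>(boundary_measure D' \<Otimes>\<^sub>M boundary_measure D'))"
proof -
  interpret D: bounded_domain D R by fact
  interpret D': bounded_domain D' R' by fact
  let ?N = "boundary_measure D \<Otimes>\<^sub>M boundary_measure D" and ?a = "inverse (area (frontier D))"
  let ?F = "induced_count D' C"
  have dist: "distributed M ?N (\<lambda>\<omega>. (X \<omega>, Y \<omega>)) (\<lambda>(x, y). ?a * ennreal (chord_kernel D R x y))"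
    using chord by (simp add: random_chord_def)
  have X: "X \<omega> \<in> frontier D" "Y \<omega> \<in> frontier D" if "\<omega> \<in> space M" for \<omega>
    using measurable_space[OF distributed_measurable[OF dist] that]
    by (auto simp: space_pair_measure boundary_measure_def space_restrict_space)
  \<comment> \<open>The end points lie on the frontier of the open set \<open>D\<close>, hence
    outside \<open>D'\<close>; the integral form of the sum over induced chords relies on
    this.\<close>
  have out: "x \<notin> D'" if "x \<in> frontier D" for x using D.frontier_notin[OF that] sub by blast
  have F_meas [measurable]: "?F \<in> borel_measurable (borel \<Otimes>\<^sub>M borel)"
    by (rule D'.induced_count_measurable[OF C])
  have KF: "(\<lambda>p. ennreal (chord_kernel D R (fst p) (snd p)) * ?F p) \<in> borel_measurable (borel \<Otimes>\<^sub>M borel)"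
    using D.kernel_measurable by (simp add: split_beta)
  have "(\<integral>\<^sup>+\<omega>. (\<integral>\<^sup>+p. indicator C p \<partial>count_space (induced_chords D' (X \<omega>) (Y \<omega>))) \<partial>M) = (\<integral>\<^sup>+\<omega>. ?F (X \<omega>, Y \<omega>) \<partial>M)"
    using X out by (intro nn_integral_cong D'.induced_count_eq) auto
  also have "\<dots> = (\<integral>\<^sup>+p. (case p of (x, y) \<Rightarrow> ?a * ennreal (chord_kernel D R x y)) * ?F p \<partial>?N)"
    by (rule distributed_nn_integral[OF dist, symmetric]) (rule borel_measurable_boundary_pair[OF F_meas])
  also have "\<dots> = (\<integral>\<^sup>+p. ?a * (ennreal (chord_kernel D R (fst p) (snd p)) * ?F p) \<partial>?N)"
    by (intro nn_integral_cong) (auto simp: mult.assoc)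
  also have "\<dots> = ?a * (\<integral>\<^sup>+p. ennreal (chord_kernel D R (fst p) (snd p)) * ?F p \<partial>?N)"
    by (intro nn_integral_cmult borel_measurable_boundary_pair KF)
  also have "(\<integral>\<^sup>+p. ennreal (chord_kernel D R (fst p) (snd p)) * ?F p \<partial>?N) =
      (\<integral>\<^sup>+x. \<integral>\<^sup>+y. ennreal (chord_kernel D R x y) * ?F (x, y) \<partial>D.\<sigma> \<partial>D.\<sigma>)"
    using D.nn_integral_boundary_pair[OF KF] by simp
  also have "\<dots> = dir_const TYPE('n) * flat_const TYPE('n) * (\<integral>\<^sup>+w. indicator (ball 0 1) w *
      (\<integral>\<^sup>+z. indicator D z * (?F (chord_ends D w z) * ennreal (1 / chord_length D w z)) \<partial>lborel) \<partial>lborel)"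
    by (rule D.nn_integral_chords[OF F_meas])
  also have "(\<integral>\<^sup>+w. indicator (ball 0 1) w *
      (\<integral>\<^sup>+z. indicator D z * (?F (chord_ends D w z) * ennreal (1 / chord_length D w z)) \<partial>lborel) \<partial>lborel) =
      (\<integral>\<^sup>+w. indicator (ball 0 1) w *
      (\<integral>\<^sup>+z. indicator D' z * (indicator C (chord_ends D' w z) * ennreal (1 / chord_length D' w z)) \<partial>lborel) \<partial>lborel)"
  proof (rule nn_integral_cong_AE)
    show "AE w in lborel. indicator (ball 0 1) w *
      (\<integral>\<^sup>+z. indicator D z * (?F (chord_ends D w z) * ennreal (1 / chord_length D w z)) \<partial>lborel) = indicator (ball 0 1) w *
      (\<integral>\<^sup>+z. indicator D' z * (indicator C (chord_ends D' w z) * ennreal (1 / chord_length D' w z)) \<partial>lborel)"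
      using AE_lborel_singleton[of 0]
    proof eventually_elim
      fix w :: "real^'n::_" assume w: "w \<noteq> 0"
      have "(\<integral>\<^sup>+z. indicator D z * (?F (chord_ends D w z) * ennreal (1 / chord_length D w z)) \<partial>lborel) =
          (\<integral>\<^sup>+z. indicator D z * ((\<integral>\<^sup>+p. indicator C p \<partial>count_space (induced_chords D' (fst (chord_ends D w z)) (snd (chord_ends D w z)))) *
          ennreal (1 / chord_length D w z)) \<partial>lborel)"
      proof (intro nn_integral_cong)
        fix z
        have "z - D.\<tau> z (- w) *\<^sub>R w \<notin> D'" "z + D.\<tau> z w *\<^sub>R w \<notin> D'"
          using D.exit_notin[OF w, of z] D.exit_notin[of "- w" z] w sub by auto
        then show "indicator D z * (?F (chord_ends D w z) * ennreal (1 / chord_length D w z)) =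
          indicator D z * ((\<integral>\<^sup>+p. indicator C p \<partial>count_space (induced_chords D' (fst (chord_ends D w z)) (snd (chord_ends D w z)))) *
          ennreal (1 / chord_length D w z))"
          by (simp add: D'.induced_count_eq chord_ends_def)
      qed
      also have "\<dots> = (\<integral>\<^sup>+z. indicator D' z * (indicator C (chord_ends D' w z) * ennreal (1 / chord_length D' w z)) \<partial>lborel)"
        by (rule chord_transport[OF assms(1,2) sub w C])
      finally show "indicator (ball 0 1) w *
        (\<integral>\<^sup>+z. indicator D z * (?F (chord_ends D w z) * ennreal (1 / chord_length D w z)) \<partial>lborel) = indicator (ball 0 1) w *
        (\<integral>\<^sup>+z. indicator D' z * (indicator C (chord_ends D' w z) * ennreal (1 / chord_length D' w z)) \<partial>lborel)"
        by simp
    qed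
  qed
  also have "dir_const TYPE('n) * flat_const TYPE('n) * \<dots> =
      (\<integral>\<^sup>+x. \<integral>\<^sup>+y. ennreal (chord_kernel D' R' x y) * indicator C (x, y) \<partial>D'.\<sigma> \<partial>D'.\<sigma>)"
    by (rule D'.nn_integral_chords[symmetric]) measurable
  also have "\<dots> = (\<integral>\<^sup>+(x, y). ennreal (chord_kernel D' R' x y) * indicator C (x, y)
      \<partial>(boundary_measure D' \<Otimes>\<^sub>M boundary_measure D'))"
  proof -
    have "(\<lambda>(x, y). ennreal (chord_kernel D' R' x y) * indicator C (x, y)) \<in> borel_measurable (borel \<Otimes>\<^sub>M borel)"
      using D'.kernel_measurable by (simp add: split_beta)
    from D'.nn_integral_boundary_pair[OF this] show ?thesis by simp
  qed
  finally show ?thesis .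
qed

theorem theorem2p8:
  fixes D D' R R' :: "(real^'n::{finite,wellorder}) set"
    and M :: "'w measure"
    and \<Xi>\<^sub>1 \<Xi>\<^sub>2 :: "'w \<Rightarrow> real^'n::_"
  assumes dim: "CARD('n) \<ge> 2"
    and D: "admissible_domain D R" "bounded D"
    and D': "admissible_domain D' R'" "D' \<subseteq> D"
    and chord: "random_chord M D R \<Xi>\<^sub>1 \<Xi>\<^sub>2"
  shows "(\<forall>C \<in> sets borel. C \<subseteq> frontier D' \<times> frontier D' \<longrightarrow>
      (\<integral>\<^sup>+\<omega>. (\<integral>\<^sup>+p. indicator C p \<partial>count_space (induced_chords D' (\<Xi>\<^sub>1 \<omega>) (\<Xi>\<^sub>2 \<omega>))) \<partial>M) =
        area (frontier D') / area (frontier D) *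
        (inverse (area (frontier D')) *
          (\<integral>\<^sup>+(x, y). ennreal (chord_kernel D' R' x y) * indicator C (x, y)
            \<partial>(boundary_measure D' \<Otimes>\<^sub>M boundary_measure D')))) \<and>
    (\<integral>\<^sup>+\<omega>. num_induced_chords D' (\<Xi>\<^sub>1 \<omega>) (\<Xi>\<^sub>2 \<omega>) \<partial>M) = area (frontier D') / area (frontier D)"
proof -
  have bd: "bounded_domain D R" "bounded_domain D' R'"
    using dim D D' bounded_subset[OF D(2) D'(2)] by (auto intro: bounded_domain.intro)
  interpret D: bounded_domain D R by (rule bd)
  interpret D': bounded_domain D' R' by (rule bd)
  let ?N = "boundary_measure D \<Otimes>\<^sub>M boundary_measure D"
  let ?N' = "boundary_measure D' \<Otimes>\<^sub>M boundary_measure D'"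
  define a where "a = area (frontier D)"
  define a' where "a' = area (frontier D')"
  \<comment> \<open>Any unit vector serves, as the half ball moment is the same for all of
    them.\<close>
  define v :: "real^'n::_" where "v = last_axis"
  define K where "K = dir_const TYPE('n) * half_ball_moment v"
  have v: "norm v = 1" by (simp add: v_def)
  have a: "a = hausdorff_outer (CARD('n) - 1) (frontier D)" "a' = hausdorff_outer (CARD('n) - 1) (frontier D')"
    by (simp_all add: a_def a'_def area_def emeasure_hausdorff)
  have fin: "a < top" "a' < top" unfolding a by (rule D.finite_S D'.finite_S)+
  have tot: "(\<integral>\<^sup>+(x, y). ennreal (chord_kernel D R x y) \<partial>?N) = K * a"
    "(\<integral>\<^sup>+(x, y). ennreal (chord_kernel D' R' x y) \<partial>?N') = K * a'"
  proof -
    have m: "(\<lambda>(x, y). ennreal (chord_kernel D R x y)) \<in> borel_measurable (borel \<Otimes>\<^sub>M borel)"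
      using D.kernel_measurable by (simp add: split_beta)
    show "(\<integral>\<^sup>+(x, y). ennreal (chord_kernel D R x y) \<partial>?N) = K * a"
      using D.nn_integral_boundary_pair[OF m] D.nn_integral_kernel[OF v] by (simp add: K_def a)
    have m': "(\<lambda>(x, y). ennreal (chord_kernel D' R' x y)) \<in> borel_measurable (borel \<Otimes>\<^sub>M borel)"
      using D'.kernel_measurable by (simp add: split_beta)
    show "(\<integral>\<^sup>+(x, y). ennreal (chord_kernel D' R' x y) \<partial>?N') = K * a'"
      using D'.nn_integral_boundary_pair[OF m'] D'.nn_integral_kernel[OF v] by (simp add: K_def a)
  qed
  \<comment> \<open>The density of the chord integrates to one; this determines the normalising constant.\<close>
  have one: "inverse a * (K * a) = 1"
  proof -
    have dist: "distributed M ?N (\<lambda>\<omega>. (\<Xi>\<^sub>1 \<omega>, \<Xi>\<^sub>2 \<omega>)) (\<lambda>(x, y). inverse a * ennreal (chord_kernel D R x y))"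
      and prob: "prob_space M"
      using chord by (simp_all add: random_chord_def a_def)
    have "1 = (\<integral>\<^sup>+\<omega>. 1 \<partial>M)" using prob_space.emeasure_space_1[OF prob] by simp
    also have "\<dots> = (\<integral>\<^sup>+p. (case p of (x, y) \<Rightarrow> inverse a * ennreal (chord_kernel D R x y)) * 1 \<partial>?N)"
      by (rule distributed_nn_integral[OF dist, symmetric]) simp
    also have "\<dots> = (\<integral>\<^sup>+p. inverse a * (case p of (x, y) \<Rightarrow> ennreal (chord_kernel D R x y)) \<partial>?N)"
      by (intro nn_integral_cong) auto
    also have "\<dots> = inverse a * (\<integral>\<^sup>+(x, y). ennreal (chord_kernel D R x y) \<partial>?N)"
      using D.kernel_measurable by (intro nn_integral_cmult borel_measurable_boundary_pair) (simp add: split_beta)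
    finally show ?thesis by (simp add: tot)
  qed
  \<comment> \<open>For \<open>a = 0\<close> the product would be 0, because infinity times 0 is 0
    in the extended reals.\<close>
  then have a0: "a \<noteq> 0" by auto
  have K1: "K = 1"
  proof -
    have "inverse a * a = 1" using a0 fin(1) ennreal_divide_self[of a] by (simp add: divide_ennreal_def mult.commute)
    then show ?thesis using one by (simp add: mult.left_commute)
  qed
  note main = induced_chords_expectation[OF bd D'(2) chord, folded a_def]
  show ?thesis
  proof (intro conjI ballI impI)
    fix C :: "((real^'n::_) \<times> (real^'n::_)) set"
    assume C: "C \<in> sets borel" "C \<subseteq> frontier D' \<times> frontier D'"
    let ?X = "\<integral>\<^sup>+(x, y). ennreal (chord_kernel D' R' x y) * indicator C (x, y) \<partial>?N'"
    \<comment> \<open>If the frontier of \<open>D'\<close> has area 0, then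
      \<open>inverse a'\<close> is infinite and cannot be cancelled. Both sides still vanish,
      because \<open>?X\<close> is at most the total kernel mass \<open>K * a'\<close>.\<close>
    have X: "a' * (inverse a' * ?X) = ?X"
    proof (cases "a' = 0")
      case True
      have "?X \<le> (\<integral>\<^sup>+(x, y). ennreal (chord_kernel D' R' x y) \<partial>?N')"
        by (intro nn_integral_mono) (auto split: split_indicator)
      then show ?thesis using True tot(2) by simp
    next
      case False
      then have "a' * inverse a' = 1" using fin(2) ennreal_divide_self[of a'] by (simp add: divide_ennreal_def)
      then show ?thesis by (simp add: mult.assoc[symmetric])
    qed
    have L: "(\<integral>\<^sup>+\<omega>. (\<integral>\<^sup>+p. indicator C p \<partial>count_space (induced_chords D' (\<Xi>\<^sub>1 \<omega>) (\<Xi>\<^sub>2 \<omega>))) \<partial>M) = inverse a * ?X"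
    proof (rule main)
      show "C \<in> sets (borel \<Otimes>\<^sub>M borel)" unfolding borel_prod by (rule C(1))
    qed
    have "a' / a * (inverse a' * ?X) = inverse a * (a' * (inverse a' * ?X))"
      by (simp only: divide_ennreal_def mult_ac)
    also have "\<dots> = inverse a * ?X" by (simp only: X)
    finally have "inverse a * ?X = a' / a * (inverse a' * ?X)" ..
    then show "(\<integral>\<^sup>+\<omega>. (\<integral>\<^sup>+p. indicator C p \<partial>count_space (induced_chords D' (\<Xi>\<^sub>1 \<omega>) (\<Xi>\<^sub>2 \<omega>))) \<partial>M) =
        area (frontier D') / area (frontier D) * (inverse (area (frontier D')) * ?X)"
      unfolding L by (simp only: a_def a'_def)
  next
    have "(\<integral>\<^sup>+\<omega>. num_induced_chords D' (\<Xi>\<^sub>1 \<omega>) (\<Xi>\<^sub>2 \<omega>) \<partial>M) =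
        (\<integral>\<^sup>+\<omega>. (\<integral>\<^sup>+p. indicator UNIV p \<partial>count_space (induced_chords D' (\<Xi>\<^sub>1 \<omega>) (\<Xi>\<^sub>2 \<omega>))) \<partial>M)"
      by (intro nn_integral_cong) (simp add: num_induced_chords_def emeasure_count_space)
    also have "\<dots> = inverse a * (\<integral>\<^sup>+(x, y). ennreal (chord_kernel D' R' x y) * indicator UNIV (x, y) \<partial>?N')"
    proof (rule main)
      show "(UNIV :: ((real^'n::_) \<times> (real^'n::_)) set) \<in> sets (borel \<Otimes>\<^sub>M borel)"
        unfolding borel_prod by simp
    qed
    also have "\<dots> = a' / a" using tot(2) by (simp add: K1 divide_ennreal_def mult.commute)
    finally show "(\<integral>\<^sup>+\<omega>. num_induced_chords D' (\<Xi>\<^sub>1 \<omega>) (\<Xi>\<^sub>2 \<omega>) \<partial>M) = area (frontier D') / area (frontier D)"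
      by (simp add: a_def a'_def)
  qed
qed

end
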